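(* Let $d=2$ and let $(\boldsymbol X_t)_{t\in\mathbb Z}$ be the stationary solution of the diagonal SRE $$\boldsymbol X_t=\mathrm{Diag}(b_1+c_1M_t,\,b_2+c_2M_t)\,\boldsymbol X_{t-1}+\boldsymbol Q_t,\qquad t\in\mathbb Z.$$ Suppose that (A1)--(A6) (listed in the context) hold with $Q_1,Q_2$ and $M$ positive, and that $c_2/c_1>b_2/b_1\ge 1$ with $c_1>0$ (with the convention $0/0=1$). Then $\boldsymbol X_0$ is VSRV of order $(\alpha_1,\alpha_2)$ and its components are asymptotically independent, i.e. its spectral component $\widetilde{\boldsymbol\Theta}_0$ satisfies $$\widetilde{\boldsymbol\Theta}_0\in\{(1,0),(0,1)\}\quad\text{a.s.}$$
   Context: Setting: $b_i,c_i\ge 0$ are constants, $(M_t)$ are iid real random variables, $(\boldsymbol Q_t)$ are iid $\mathbb R^d$-valued random vectors independent of $(M_t)$, and $(M,\boldsymbol Q)$ with $\boldsymbol Q=(Q_1,\dots,Q_d)$ is a generic copy of $(M_t,\boldsymbol Q_t)$. The stationary distribution is the law of $\sum_{k\ge1}\mathbb M_1\cdots\mathbb M_{k-1}\boldsymbol Q_k$ with $\mathbb M_t=\mathrm{Diag}(b_1+c_1M_t,\dots,b_d+c_dM_t)$. Assumptions, for all $1\le i\le d$: (A1) $\mathbb E[\log|b_i+c_iM|]<0$. (A2) There is $\alpha_i>0$ with $\mathbb E[|b_i+c_iM|^{\alpha_i}]=1$. (A3) $\mathbb E[|M|^{\alpha_i+\epsilon}]<\infty$ and $\mathbb E[\|\boldsymbol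 Q\|^{\alpha_i+\epsilon}]<\infty$ for some $\epsilon>0$. (A4) The distribution of $\log|b_i+c_iM|$ is non-arithmetic. (A5) $\mathbb P((b_i+c_iM)x+Q_i=x)<1$ for all $x\in\mathbb R$, and $\mathbb P(Q_i>0)>0$. (A6) For all pairs $i,j$ with $\alpha_i>\alpha_j$: $\lim_{u\to\infty}\log(u)\,\mathbb P(|Q_j|/|Q_i|>u^{\varepsilon})=0$ for all $\varepsilon>0$. Notation: $\|\cdot\|$ is the max-norm; vector operations are coordinatewise; for $\boldsymbol\alpha=(\alpha_1,\dots,\alpha_d)$ with positive entries, $\|\boldsymbol x\|_{\boldsymbol\alpha}=\max_i|x_i|^{\alpha_i}$, and for $\lambda>0$, $\lambda^{-1/\boldsymbol\alpha}\boldsymbol x=(\lambda^{-1/\alpha_i}x_i)_i$. VSRV (vector scaling regular variation) of a random vector: $\boldsymbol X_0$ is VSRV of order $\boldsymbol\alpha$ if $\mathbb P(|X_{0,i}|>x)\sim a_ix^{-\alpha_i}$ as $x\to\infty$ with $a_i>0$ for $1\le i\le d$, $\|\boldsymbol X_0\|_{\boldsymbol\alpha}$ is regularly varying, and the weak limit $$\lim_{x\to\infty}\mathbb P\big(\|\boldsymbol X_0\|_{\boldsymbol\alpha}^{-1/\boldsymbol\alpha}\boldsymbol X_0\in\cdot\,\big|\,\|\boldsymbol X_0\|_{\boldsymbol\alpha}>x\big)=\mathbb P(\widetilde{\boldsymbol\Theta}_0\in\cdot)$$ exists; $\widetilde{\boldsymbol\Theta}_0$ is called the spectral component of $\boldsymbol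 X_0$. *)

theory Defs
  imports "HOL-Probability.Probability" "HOL-Library.Landau_Symbols"
begin

section \<open>The diagonal stochastic recurrence equation\<close>

definition iid_seq :: "'w measure \<Rightarrow> (int \<Rightarrow> 'w \<Rightarrow> 'a::topological_space) \<Rightarrow> bool" where
  "iid_seq P Z \<longleftrightarrow>
     prob_space.indep_vars P (\<lambda>_. borel) Z UNIV \<and>
     (\<forall>t. distr P borel (Z t) = distr P borel (Z 0))"

text \<open>The coordinates of a single \<open>Q t\<close> may be dependent; the two sequences are
  independent of each other as whole processes (independence of the generated \<open>\<sigma>\<close>-algebras;
  the library's \<open>indep_var\<close> needs both variables to have the same type).\<close>

definition noise :: "'w measure \<Rightarrow> (int \<Rightarrow> 'w \<Rightarrow> real) \<Rightarrow> (int \<Rightarrow> 'w \<Rightarrow> real ^ 'd) \<Rightarrow> bool" where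
  "noise P M Q \<longleftrightarrow>
     iid_seq P M \<and> iid_seq P Q \<and>
     prob_space.indep_set P
       (sets (vimage_algebra (space P) (\<lambda>\<omega> t. M t \<omega>) (Pi\<^sub>M UNIV (\<lambda>_. borel))))
       (sets (vimage_algebra (space P) (\<lambda>\<omega> t. Q t \<omega>) (Pi\<^sub>M UNIV (\<lambda>_. borel))))"

definition stationary :: "'w measure \<Rightarrow> (int \<Rightarrow> 'w \<Rightarrow> 'a::topological_space) \<Rightarrow> bool" where
  "stationary P X \<longleftrightarrow>
     (\<forall>t. X t \<in> borel_measurable P) \<and>
     (\<forall>h. distr P (Pi\<^sub>M UNIV (\<lambda>_. borel)) (\<lambda>\<omega> t. X (t + h) \<omega>) =
          distr P (Pi\<^sub>M UNIV (\<lambda>_. borel)) (\<lambda>\<omega> t. X t \<omega>))"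

definition Diag :: "real ^ 'd \<Rightarrow> real ^ 'd ^ 'd" where
  "Diag v = (\<chi> i j. if i = j then v $ i else 0)"

text \<open>Since the products of the multipliers tend to 0 under the standing assumptions, a stationary
  process solving the equation is almost surely unique, so neither causality nor
  the series representation has to be required.\<close>

definition stationary_solution ::
  "'w measure \<Rightarrow> real ^ 'd \<Rightarrow> real ^ 'd \<Rightarrow> (int \<Rightarrow> 'w \<Rightarrow> real) \<Rightarrow> (int \<Rightarrow> 'w \<Rightarrow> real ^ 'd) \<Rightarrow>
   (int \<Rightarrow> 'w \<Rightarrow> real ^ 'd) \<Rightarrow> bool" where
  "stationary_solution P b c M Q X \<longleftrightarrow>
     stationary P X \<and>
     (\<forall>t. AE \<omega> in P. X t \<omega> = Diag (\<chi> i. b $ i + c $ i * M t \<omega>) *v X (t - 1) \<omega> + Q t \<omega>)"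

section \<open>Standing assumptions\<close>

text \<open>In this section \<open>M\<close> and \<open>Q\<close> form a generic copy of the noise at a single time.\<close>

text \<open>The mean of \<open>log \<bar>A\<bar>\<close> is understood in the extended sense, with \<open>log 0 = -\<infinity>\<close>: the mean of
  the positive part is strictly smaller than that of the negative part, so the value
  \<open>-\<infinity>\<close> is allowed. (\<open>ennreal\<close> maps negative numbers to 0.)\<close>

definition log_mean_neg :: "'w measure \<Rightarrow> ('w \<Rightarrow> real) \<Rightarrow> bool" where
  "log_mean_neg P A \<longleftrightarrow>
     (\<integral>\<^sup>+\<omega>. (if A \<omega> = 0 then 0 else ennreal (ln \<bar>A \<omega>\<bar>)) \<partial>P) <
     (\<integral>\<^sup>+\<omega>. (if A \<omega> = 0 then \<infinity> else ennreal (- ln \<bar>A \<omega>\<bar>)) \<partial>P)"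

definition arithmetic :: "real measure \<Rightarrow> bool" where
  "arithmetic \<mu> \<longleftrightarrow> (\<exists>h>0. AE x in \<mu>. x \<in> range (\<lambda>k::int. h * of_int k))"

definition A1 :: "'w measure \<Rightarrow> real ^ 'd \<Rightarrow> real ^ 'd \<Rightarrow> ('w \<Rightarrow> real) \<Rightarrow> bool" where
  "A1 P b c M \<longleftrightarrow> (\<forall>i. log_mean_neg P (\<lambda>\<omega>. b $ i + c $ i * M \<omega>))"

definition A2 :: "'w measure \<Rightarrow> real ^ 'd \<Rightarrow> real ^ 'd \<Rightarrow> ('w \<Rightarrow> real) \<Rightarrow> real ^ 'd \<Rightarrow> bool" where
  "A2 P b c M \<alpha> \<longleftrightarrow>
     (\<forall>i. \<alpha> $ i > 0 \<and>
          has_bochner_integral P (\<lambda>\<omega>. \<bar>b $ i + c $ i * M \<omega>\<bar> powr (\<alpha> $ i)) 1)"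

text \<open>The norm on vectors is the maximum norm \<open>infnorm\<close>, not the Euclidean \<open>norm\<close>.\<close>

definition A3 :: "'w measure \<Rightarrow> ('w \<Rightarrow> real) \<Rightarrow> ('w \<Rightarrow> real ^ 'd) \<Rightarrow> real ^ 'd \<Rightarrow> bool" where
  "A3 P M Q \<alpha> \<longleftrightarrow>
     (\<forall>i. \<exists>\<epsilon>>0. integrable P (\<lambda>\<omega>. \<bar>M \<omega>\<bar> powr (\<alpha> $ i + \<epsilon>)) \<and>
                 integrable P (\<lambda>\<omega>. infnorm (Q \<omega>) powr (\<alpha> $ i + \<epsilon>)))"

text \<open>As \<open>ln 0 = 0\<close> here, a possible atom of the multiplier at 0 plays no role.\<close>

definition A4 :: "'w measure \<Rightarrow> real ^ 'd \<Rightarrow> real ^ 'd \<Rightarrow> ('w \<Rightarrow> real) \<Rightarrow> bool" where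
  "A4 P b c M \<longleftrightarrow> (\<forall>i. \<not> arithmetic (distr P borel (\<lambda>\<omega>. ln \<bar>b $ i + c $ i * M \<omega>\<bar>)))"

definition A5 :: "'w measure \<Rightarrow> real ^ 'd \<Rightarrow> real ^ 'd \<Rightarrow> ('w \<Rightarrow> real) \<Rightarrow> ('w \<Rightarrow> real ^ 'd) \<Rightarrow> bool" where
  "A5 P b c M Q \<longleftrightarrow>
     (\<forall>i. (\<forall>x. measure P {\<omega> \<in> space P. (b $ i + c $ i * M \<omega>) * x + Q \<omega> $ i = x} < 1) \<and>
          measure P {\<omega> \<in> space P. Q \<omega> $ i > 0} > 0)"

text \<open>The quotient is the intended one only where \<open>Q \<omega> $ i \<noteq> 0\<close>; in the theorem the
  coordinates of \<open>Q\<close> are almost surely positive.\<close>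

definition A6 :: "'w measure \<Rightarrow> ('w \<Rightarrow> real ^ 'd) \<Rightarrow> real ^ 'd \<Rightarrow> bool" where
  "A6 P Q \<alpha> \<longleftrightarrow>
     (\<forall>i j. \<alpha> $ i > \<alpha> $ j \<longrightarrow>
        (\<forall>\<epsilon>>0. ((\<lambda>u. ln u * measure P {\<omega> \<in> space P. \<bar>Q \<omega> $ j\<bar> / \<bar>Q \<omega> $ i\<bar> > u powr \<epsilon>})
                 \<longlongrightarrow> 0) at_top))"

text \<open>Quotient of nonnegative reals with \<open>0 / 0 = 1\<close> and \<open>x / 0 = \<infinity>\<close> for \<open>x > 0\<close>.\<close>

definition ratio :: "real \<Rightarrow> real \<Rightarrow> ereal" where
  "ratio x y = (if x = 0 \<and> y = 0 then 1 else ereal x / ereal y)"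

section \<open>Vector scaling regular variation\<close>

definition vnorm :: "real ^ 'd \<Rightarrow> real ^ 'd \<Rightarrow> real" where
  "vnorm \<alpha> x = (MAX i. \<bar>x $ i\<bar> powr (\<alpha> $ i))"

text \<open>\<open>inv_scale \<alpha> l x\<close> is \<open>l\<close> to the power \<open>-1/\<alpha>\<close>, applied coordinatewise to \<open>x\<close>.\<close>

definition inv_scale :: "real ^ 'd \<Rightarrow> real \<Rightarrow> real ^ 'd \<Rightarrow> real ^ 'd" where
  "inv_scale \<alpha> l x = (\<chi> i. l powr (- 1 / \<alpha> $ i) * x $ i)"

definition regularly_varying :: "'w measure \<Rightarrow> ('w \<Rightarrow> real) \<Rightarrow> bool" where
  "regularly_varying P Y \<longleftrightarrow>
     (\<exists>\<kappa>>0. \<forall>s>0.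
        ((\<lambda>x. measure P {\<omega> \<in> space P. Y \<omega> > s * x} / measure P {\<omega> \<in> space P. Y \<omega> > x})
           \<longlongrightarrow> s powr (- \<kappa>)) at_top)"

text \<open>The library's \<open>weak_conv_m\<close> covers sequences of measures on the real line only.\<close>

definition weakly_converges ::
  "('i \<Rightarrow> 'a::topological_space measure) \<Rightarrow> 'a measure \<Rightarrow> 'i filter \<Rightarrow> bool" where
  "weakly_converges \<nu> \<mu> F \<longleftrightarrow>
     (\<forall>f::'a \<Rightarrow> real. continuous_on UNIV f \<longrightarrow> bounded (range f) \<longrightarrow>
        ((\<lambda>x. \<integral>y. f y \<partial>\<nu> x) \<longlongrightarrow> (\<integral>y. f y \<partial>\<mu>)) F)"

text \<open>\<open>uniform_measure P A\<close> is the conditional probability \<open>P\<close> given \<open>A\<close>. The measure \<open>\<mu>\<close> is the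
  law of the spectral component of \<open>X\<close>.\<close>

definition spectral_law ::
  "'w measure \<Rightarrow> ('w \<Rightarrow> real ^ 'd) \<Rightarrow> real ^ 'd \<Rightarrow> (real ^ 'd) measure \<Rightarrow> bool" where
  "spectral_law P X \<alpha> \<mu> \<longleftrightarrow>
     prob_space \<mu> \<and> sets \<mu> = sets borel \<and>
     weakly_converges
       (\<lambda>x. distr (uniform_measure P {\<omega> \<in> space P. vnorm \<alpha> (X \<omega>) > x}) borel
              (\<lambda>\<omega>. inv_scale \<alpha> (vnorm \<alpha> (X \<omega>)) (X \<omega>)))
       \<mu> at_top"

definition VSRV :: "'w measure \<Rightarrow> ('w \<Rightarrow> real ^ 'd) \<Rightarrow> real ^ 'd \<Rightarrow> bool" where
  "VSRV P X \<alpha> \<longleftrightarrow>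
     (\<forall>i. \<alpha> $ i > 0) \<and>
     (\<forall>i. \<exists>a>0. (\<lambda>x. measure P {\<omega> \<in> space P. \<bar>X \<omega> $ i\<bar> > x})
                   \<sim>[at_top] (\<lambda>x. a * x powr (- \<alpha> $ i))) \<and>
     regularly_varying P (\<lambda>\<omega>. vnorm \<alpha> (X \<omega>)) \<and>
     (\<exists>\<mu>. spectral_law P X \<alpha> \<mu>)"

end

theory Submission
  imports Defs "HOL-Complex_Analysis.Cauchy_Integral_Formula" "HOL-Real_Asymp.Real_Asymp"
begin

text \<open>
  Each coordinate satisfies a one-dimensional equation \<open>X = A Y + Q\<close> in law with positive \<open>A\<close>, \<open>Q\<close>.
  Its Mellin transform obeys \<open>E X\<^sup>z (1 - E A\<^sup>z) = E ((A Y + Q)\<^sup>z - (A Y)\<^sup>z)\<close>, whose right-hand side is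
  holomorphic beyond the line \<open>Re z = \<alpha>\<close>, while \<open>1 - E A\<^sup>z\<close> vanishes on this line only at \<open>\<alpha>\<close>, to first
  order, because \<open>log A\<close> is non-arithmetic. A Wiener--Ikehara theorem turns the resulting simple pole into
  \<open>P (X > x) \<sim> a x\<close> to the power \<open>-\<alpha>\<close>.

  For the independence, \<open>A\<^sub>1 < A\<^sub>2\<close> prevents \<open>A\<^sub>1\<close> to the power \<open>\<alpha>\<^sub>1\<close> and \<open>A\<^sub>2\<close> to the power \<open>\<alpha>\<^sub>2\<close>,
  both of mean 1, from being equal, so by the Cauchy--Schwarz inequality the product of their square roots
  has mean less than 1. Hence the mixed moment of \<open>X\<close> of order \<open>(\<alpha>\<^sub>1 / 2, \<alpha>\<^sub>2 / 2)\<close> is finite, and both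
  coordinates are large at the level \<open>x\<close> with probability \<open>o(1 / x)\<close> only.
\<close>

section \<open>A Wiener--Ikehara theorem\<close>

text \<open>The solution is given only as a stationary process: causality is not assumed and no
  moment is known in advance. Both gaps are closed by iterates started from 0 in the past. They are
  functions of past noise, their moments are bounded uniformly by a contraction, and a subsequence
  converges almost surely to the solution, so that independence and, by Fatou's lemma, moments pass
  to the limit. This reaches the moments of order below \<alpha>, but not \<alpha> itself. Beyond
  \<alpha> the two powers in the difference of the overview are kept together: their leading parts
  cancel, and a moment of the solution of order at most \<beta> - 1 < \<alpha> is enough. The tail
  constant is the residue \<psi>(\<alpha>) / (\<alpha> \<phi>'(\<alpha>)) at the pole. It is
  positive because Q adds a strictly positive amount and because convexity makes the derivative
  positive. The orders in the mixed moment are halved for two reasons: each single moment that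
  enters stays below its critical order, and if both scaled coordinates exceed x, the product of
  their square roots still exceeds x.\<close>

definition triangle :: "real \<Rightarrow> real" where
  "triangle x = max 0 (1 - \<bar>x\<bar>)"

text \<open>The Fourier transform of \<open>triangle\<close>, equal to (sin (x / 2) / (x / 2))^2,
  with the removable value at 0 filled in.\<close>

definition fejer :: "real \<Rightarrow> real" where
  "fejer x = (if x = 0 then 1 else 2 * (1 - cos x) / x\<^sup>2)"

lemma triangle_nonneg [simp]: "0 \<le> triangle x"
  by (simp add: triangle_def)

lemma triangle_le_1 [simp]: "triangle x \<le> 1"
  by (simp add: triangle_def)

lemma continuous_triangle [continuous_intros]: "continuous_on A triangle"
  unfolding triangle_def by (intro continuous_intros)

lemma borel_measurable_triangle [measurable]: "triangle \<in> borel_measurable borel"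
  unfolding triangle_def by measurable

lemma integrable_triangle: "integrable lborel triangle"
  by (rule Bochner_Integration.integrable_bound[of _ "indicator {-1..1} :: real \<Rightarrow> real"])
     (auto simp: triangle_def indicator_def)

lemma borel_measurable_fejer [measurable]: "fejer \<in> borel_measurable borel"
  unfolding fejer_def by measurable

lemma fejer_nonneg [simp]: "0 \<le> fejer x"
  by (simp add: fejer_def)

lemma fejer_pos: "0 < x \<Longrightarrow> x < pi \<Longrightarrow> 0 < fejer x"
  using cos_monotone_0_pi[of 0 x] by (simp add: fejer_def)

lemma triangle_iexp: "(\<integral>t. complex_of_real (triangle t) * iexp (t * x) \<partial>lborel) = fejer x"
proof -
  \<comment> \<open>Antiderivatives of (1 + t) e^(itx) and (1 - t) e^(itx), found by parts. Dividing
    by ix forces a separate polynomial for x = 0.\<close>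
  define F where "F = (\<lambda>z::complex. if x = 0 then z + z\<^sup>2 / 2 else (1 + z) * exp (\<i> * (z * x)) / (\<i> * x)
      - exp (\<i> * (z * x)) / (\<i> * x)\<^sup>2)"
  define G where "G = (\<lambda>z::complex. if x = 0 then z - z\<^sup>2 / 2 else (1 - z) * exp (\<i> * (z * x)) / (\<i> * x)
      + exp (\<i> * (z * x)) / (\<i> * x)\<^sup>2)"
  have dF: "((\<lambda>t. F (of_real t)) has_vector_derivative (1 + t) * iexp (t * x)) (at t within A)" for t A
  proof (rule has_vector_derivative_real_field[where f = F])
    show "(F has_field_derivative (1 + complex_of_real t) * iexp (t * x)) (at (complex_of_real t))"
      unfolding F_def
      by (cases "x = 0") (auto intro!: derivative_eq_intros simp: divide_simps power2_eq_square
          algebra_simps)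
  qed
  have dG: "((\<lambda>t. G (of_real t)) has_vector_derivative (1 - t) * iexp (t * x)) (at t within A)" for t A
  proof (rule has_vector_derivative_real_field[where f = G])
    show "(G has_field_derivative (1 - complex_of_real t) * iexp (t * x)) (at (complex_of_real t))"
      unfolding G_def
      by (cases "x = 0") (auto intro!: derivative_eq_intros simp: divide_simps power2_eq_square
          algebra_simps)
  qed
  have F: "has_bochner_integral lborel (\<lambda>t. indicator {-1..0} t *\<^sub>R ((1 + t) * iexp (t * x))) (F
      (of_real 0) - F (of_real (-1)))"
    by (rule has_bochner_integral_FTC_Icc) (use dF in \<open>auto intro!: continuous_intros\<close>)
  have G: "has_bochner_integral lborel (\<lambda>t. indicator {0..1} t *\<^sub>R ((1 - t) * iexp (t * x))) (G (of_real
      1) - G (of_real 0))"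
    by (rule has_bochner_integral_FTC_Icc) (use dG in \<open>auto intro!: continuous_intros\<close>)
  have "(\<integral>t. complex_of_real (triangle t) * iexp (t * x) \<partial>lborel) = 
     (\<integral>t. indicator {-1..0} t *\<^sub>R ((1 + t) * iexp (t * x)) + indicator {0..1} t *\<^sub>R ((1 - t) * iexp (t *
         x)) \<partial>lborel)"
  proof (rule integral_cong_AE)
    \<comment> \<open>The two closed intervals share the point 0, which the sum of the two pieces
      counts twice.\<close>
    show "AE t in lborel. complex_of_real (triangle t) * iexp (t * x) = 
       indicator {-1..0} t *\<^sub>R ((1 + t) * iexp (t * x)) + indicator {0..1} t *\<^sub>R ((1 - t) * iexp (t * x))"
      using AE_lborel_singleton[of 0]
      by eventually_elim (auto simp: triangle_def indicator_def max_def)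
  qed auto
  also have "\<dots> = F 0 - F (-1) + (G 1 - G 0)"
    using has_bochner_integral_integral_eq[OF has_bochner_integral_add[OF F G]] by simp
  also have "\<dots> = fejer x"
  proof (cases "x = 0")
    case True
    then show ?thesis by (simp add: F_def G_def fejer_def)
  next
    case False
    have e: "iexp x = cos x + \<i> * sin x" "iexp (- x) = cos x - \<i> * sin x"
      by (simp_all add: exp_Euler exp_minus_Euler cos_of_real sin_of_real)
    have "F 0 - F (-1) + (G 1 - G 0) = (iexp x + iexp (- x) - 2) / (\<i> * x)\<^sup>2"
      using False by (simp add: F_def G_def add_divide_distrib diff_divide_distrib)
    also have "\<dots> = fejer x"
      unfolding e using False by (simp add: fejer_def power_mult_distrib field_simps)
    finally show ?thesis .
  qed
  finally show ?thesis .
qed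

text \<open>A Fourier transform is bounded by the total mass, and its value at 0 shows that
  \<open>triangle\<close> has mass 1.\<close>

lemma fejer_le_1: "fejer x \<le> 1"
proof -
  have "complex_of_real (\<integral>t. triangle t \<partial>lborel) = complex_of_real (fejer 0)"
    using triangle_iexp[of 0] by simp
  then have 1: "(\<integral>t. triangle t \<partial>lborel) = 1" unfolding of_real_eq_iff by (simp add: fejer_def)
  have "fejer x = norm (\<integral>t. complex_of_real (triangle t) * iexp (t * x) \<partial>lborel)"
    by (simp only: triangle_iexp norm_of_real abs_of_nonneg[OF fejer_nonneg])
  also have "\<dots> \<le> (\<integral>t. norm (complex_of_real (triangle t) * iexp (t * x)) \<partial>lborel)"
    by (rule integral_norm_bound)
  also have "\<dots> = (\<integral>t. triangle t \<partial>lborel)"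
    by (simp add: norm_mult)
  finally show ?thesis using 1 by simp
qed

lemma integrable_fejer: "integrable lborel fejer"
proof -
  \<comment> \<open>The constant 5 adds the bound 1 for \<open>fejer\<close> and the bound 4 for 2
    (1 - cos x).\<close>
  have "(1 + x\<^sup>2) * fejer x \<le> 5" for x
  proof (cases "x = 0")
    case False
    have "x\<^sup>2 * fejer x = 2 * (1 - cos x)" using False by (simp add: fejer_def)
    then show ?thesis using fejer_le_1[of x] cos_ge_minus_one[of x] by (simp only: ring_distribs)
  qed (simp add: fejer_def)
  then have *: "fejer x \<le> 5 * inverse (1 + x\<^sup>2)" for x
    by (simp add: field_simps add_pos_nonneg)
  have "integrable lborel (\<lambda>x::real. inverse (1 + x\<^sup>2))"
    using integrable_inverse_1_plus_square by (simp add: set_integrable_def)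
  then have "integrable lborel (\<lambda>x::real. 5 * inverse (1 + x\<^sup>2))" by (rule integrable_mult_right)
  then show ?thesis
    by (rule Bochner_Integration.integrable_bound) (use * in \<open>auto intro: AE_I2\<close>)
qed

text \<open>Shifting the variable by \<open>pi / u\<close> changes the sign of the oscillating factor.\<close>

lemma Riemann_Lebesgue:
  fixes g :: "real \<Rightarrow> complex"
  assumes cont: "continuous_on UNIV g" and supp: "\<And>x. \<bar>x\<bar> > 1 \<Longrightarrow> g x = 0"
  shows "((\<lambda>u. \<integral>x. g x * iexp (x * u) \<partial>lborel) \<longlongrightarrow> 0) at_top"
proof -
  have [measurable]: "g \<in> borel_measurable borel"
    by (rule borel_measurable_continuous_onI[OF cont])
  have "bounded (g ` {-1..1})"
    by (intro compact_imp_bounded compact_continuous_image continuous_on_subset[OF cont]) auto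
  then obtain B where B: "\<And>x. x \<in> {-1..1} \<Longrightarrow> norm (g x) \<le> B"
    unfolding bounded_iff by blast
  have gB: "norm (g x) \<le> B" for x
    proof (cases "\<bar>x\<bar> > 1")
    case True
    then show ?thesis using supp[of x] order_trans[OF norm_ge_zero B[of 0]] by auto
  next
    case False
    then show ?thesis using B[of x] by (auto simp: abs_if split: if_splits)
  qed
  have B0: "B \<ge> 0" using gB[of 0] norm_ge_zero[of "g 0"] by linarith
  have int_B: "integrable lborel (\<lambda>x. c * indicator {p..q} x :: real)" for c p q :: real
    by (rule integrable_mult_right) (auto simp: emeasure_lborel_Icc_eq)
  have int_g: "integrable lborel (\<lambda>x. g x)"
    by (rule Bochner_Integration.integrable_bound[of _ "\<lambda>x. B * indicator {-1..1} x :: real"])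
       (use int_B gB supp B0 in \<open>auto simp: indicator_def not_le abs_le_iff intro!: AE_I2\<close>)
  have int_e: "integrable lborel (\<lambda>x. g x * iexp (x * u))" for u
    by (rule Bochner_Integration.integrable_bound[OF int_g]) (auto simp: norm_mult)
  have shift: "(\<integral>x. g x * iexp (x * u) \<partial>lborel) = - (\<integral>x. g (x + pi / u) * iexp (x * u) \<partial>lborel)" 
    if "u > 0" for u
  proof -
    have "(\<integral>x. g x * iexp (x * u) \<partial>lborel) = (\<integral>x. g (pi / u + 1 * x) * iexp ((pi / u + 1 * x) * u) \<partial>lborel)"
      by (subst lborel_integral_real_affine[where c = 1 and t = "pi / u"]) auto
    also have "(\<lambda>x. g (pi / u + 1 * x) * iexp ((pi / u + 1 * x) * u)) = (\<lambda>x. - (g (x + pi / u) * iexp (x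
        * u)))"
    proof
      fix x
      have "iexp ((pi / u + 1 * x) * u) = exp (\<i> * pi + \<i> * (x * u))"
        using that by (simp add: ring_distribs mult_ac)
      also have "\<dots> = - iexp (x * u)" by (subst exp_add) simp
      finally show "g (pi / u + 1 * x) * iexp ((pi / u + 1 * x) * u) = - (g (x + pi / u) * iexp (x * u))"
        by (simp add: add.commute)
    qed
    finally show ?thesis by simp
  qed
  have int_s: "integrable lborel (\<lambda>x. g (x + c) * iexp (x * u))" for c u
  proof -
    have "integrable lborel (\<lambda>x. g (c + 1 * x))"
      by (rule lborel_integrable_real_affine[OF int_g]) simp
    then show ?thesis
      by (rule Bochner_Integration.integrable_bound) (auto simp: norm_mult add.commute)
  qed
  \<comment> \<open>Averaging the integral with its shifted copy leaves a difference of translates,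
    which no longer oscillates and is small by continuity.\<close>
  have bound: "norm (\<integral>x. g x * iexp (x * u) \<partial>lborel) \<le> (\<integral>x. norm (g x - g (x + pi / u)) \<partial>lborel)"
    if "u > 0" for u
  proof -
    have "2 * (\<integral>x. g x * iexp (x * u) \<partial>lborel) =
        (\<integral>x. g x * iexp (x * u) \<partial>lborel) - (\<integral>x. g (x + pi / u) * iexp (x * u) \<partial>lborel)"
      using shift[OF that] by simp
    also have "\<dots> = (\<integral>x. g x * iexp (x * u) - g (x + pi / u) * iexp (x * u) \<partial>lborel)"
      by (rule Bochner_Integration.integral_diff[symmetric]) (rule int_e int_s)+
    also have "\<dots> = (\<integral>x. (g x - g (x + pi / u)) * iexp (x * u) \<partial>lborel)"
      by (simp add: algebra_simps)
    finally have "norm (2 * (\<integral>x. g x * iexp (x * u) \<partial>lborel)) \<le> (\<integral>x. norm ((g x - g (x + pi / u)) * iexp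
        (x * u)) \<partial>lborel)"
      by (simp only: integral_norm_bound)
    then have "2 * norm (\<integral>x. g x * iexp (x * u) \<partial>lborel) \<le> (\<integral>x. norm (g x - g (x + pi / u)) \<partial>lborel)"
      by (simp add: norm_mult)
    then show ?thesis
      using norm_ge_zero[of "\<integral>x. g x * iexp (x * u) \<partial>lborel"] by linarith
  qed
  have "((\<lambda>u. \<integral>x. norm (g x - g (x + pi / u)) \<partial>lborel) \<longlongrightarrow> integral\<^sup>L lborel (\<lambda>x::real. 0)) at_top"
  proof (rule integral_dominated_convergence_at_top[where w = "\<lambda>x. 2 * B * indicator {-2..2} x :: real"])
    show "\<forall>\<^sub>F u in at_top. AE x in lborel. norm (norm (g x - g (x + pi / u))) \<le> 2 * B * indicator {-2..2} x"
      using eventually_ge_at_top[of pi]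
    proof eventually_elim
      case (elim u)
      then have "0 < u" using pi_gt_zero by linarith
      \<comment> \<open>The shift is at most 1, so both translates vanish outside {-2..2}.\<close>
      then have "0 \<le> pi / u" "pi / u \<le> 1" using elim by auto
      show ?case
      proof (rule AE_I2)
        fix x
        have "norm (g x - g (x + pi / u)) \<le> 2 * B"
          using norm_triangle_ineq4[of "g x" "g (x + pi / u)"] gB[of x] gB[of "x + pi / u"] by linarith
        moreover have "g x = 0" "g (x + pi / u) = 0" if "x \<notin> {-2..2}"
          using that \<open>0 \<le> pi / u\<close> \<open>pi / u \<le> 1\<close> by (auto intro!: supp)
        ultimately show "norm (norm (g x - g (x + pi / u))) \<le> 2 * B * indicator {-2..2} x"
          by (auto simp: indicator_def)
      qed
    qed
    show "AE x in lborel. ((\<lambda>u. norm (g x - g (x + pi / u))) \<longlongrightarrow> 0) at_top"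
    proof (rule AE_I2)
      fix x
      have "isCont g x" using cont by (simp add: continuous_on_eq_continuous_at)
      moreover have "((\<lambda>u. x + pi / u) \<longlongrightarrow> x) at_top" by real_asymp
      ultimately have "((\<lambda>u. g (x + pi / u)) \<longlongrightarrow> g x) at_top" by (rule isCont_tendsto_compose)
      then have "((\<lambda>u. norm (g x - g (x + pi / u))) \<longlongrightarrow> norm (g x - g x)) at_top"
        by (intro tendsto_intros)
      then show "((\<lambda>u. norm (g x - g (x + pi / u))) \<longlongrightarrow> 0) at_top" by simp
    qed
  qed (auto intro: int_B)
  then have lim: "((\<lambda>u. \<integral>x. norm (g x - g (x + pi / u)) \<partial>lborel) \<longlongrightarrow> 0) at_top" by simp
  show ?thesis
    by (rule Lim_null_comparison[OF eventually_mono[OF eventually_gt_at_top[of 0]] lim]) (rule bound)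
qed

section \<open>Laplace integrals of exponentials over half-lines\<close>

lemma Laplace_indicator_atLeast:
  fixes z :: complex
  assumes "0 < Re z"
  shows "has_bochner_integral lborel (\<lambda>t. indicator {0..} t *\<^sub>R exp (- (z * of_real t))) (1 / z)"
proof -
  have z: "z \<noteq> 0" using assms by auto
  have "(\<integral>\<^sup>+ t. ennreal (exp (- Re z * t)) * indicator {0..} t \<partial>lborel) = 0 - (- exp (- Re z * 0) / Re z)"
  proof (rule nn_integral_FTC_atLeast)
    show "DERIV (\<lambda>t. - exp (- Re z * t) / Re z) x :> exp (- Re z * x)" for x
      using assms by (auto intro!: derivative_eq_intros)
    have "((\<lambda>t. exp (- Re z * t)) \<longlongrightarrow> 0) at_top" using assms by real_asymp
    from tendsto_divide[OF tendsto_minus[OF this] tendsto_const[of "Re z"]]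
    show "((\<lambda>t. - exp (- Re z * t) / Re z) \<longlongrightarrow> 0) at_top" using assms by simp
  qed auto
  then have fin: "(\<integral>\<^sup>+ t. ennreal (exp (- Re z * t)) * indicator {0..} t \<partial>lborel) < \<infinity>"
    by simp
  have int: "integrable lborel (\<lambda>t. indicator {0..} t *\<^sub>R exp (- (z * of_real t)))"
  proof (rule integrableI_bounded)
    have "(\<integral>\<^sup>+ t. ennreal (norm (indicator {0..} t *\<^sub>R exp (- (z * of_real t)))) \<partial>lborel) =
          (\<integral>\<^sup>+ t. ennreal (exp (- Re z * t)) * indicator {0..} t \<partial>lborel)"
      by (intro nn_integral_cong) (auto simp: indicator_def)
    then show "(\<integral>\<^sup>+ t. ennreal (norm (indicator {0..} t *\<^sub>R exp (- (z * of_real t)))) \<partial>lborel) < \<infinity>"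
      using fin by simp
  qed auto
  have trunc: "(\<integral>t. indicator {..y} t *\<^sub>R (indicator {0..} t *\<^sub>R exp (- (z * of_real t))) \<partial>lborel) = (1
      - exp (- (z * of_real y))) / z"
    if "0 \<le> y" for y :: real
  proof -
    have "(\<integral>t. indicator {..y} t *\<^sub>R (indicator {0..} t *\<^sub>R exp (- (z * of_real t))) \<partial>lborel) =
      (\<integral>t. indicator {0..y} t *\<^sub>R exp (- (z * of_real t)) \<partial>lborel)"
      by (intro Bochner_Integration.integral_cong) (auto simp: indicator_def)
    also have "\<dots> = (\<lambda>w. - exp (- (z * w)) / z) (of_real y) - (\<lambda>w. - exp (- (z * w)) / z) (of_real 0)"
    proof (rule integral_FTC_Icc[where F = "\<lambda>t. (\<lambda>w. - exp (- (z * w)) / z) (of_real t)"])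
      show "((\<lambda>t. (\<lambda>w. - exp (- (z * w)) / z) (of_real t)) has_vector_derivative exp (- (z *
          complex_of_real x))) (at x within {0..y})" for x
        by (rule has_vector_derivative_real_field) (use z in \<open>auto intro!: derivative_eq_intros\<close>)
    qed (use that in \<open>auto intro!: continuous_intros\<close>)
    also have "\<dots> = (1 - exp (- (z * of_real y))) / z"
      using z by (simp add: field_simps)
    finally show ?thesis .
  qed
  have lim1: "((\<lambda>y. (1 - exp (- (z * of_real y))) / z) \<longlongrightarrow> (\<integral>t. indicator {0..} t *\<^sub>R exp (- (z * of_real
      t)) \<partial>lborel)) at_top"
    using tendsto_integral_at_top[OF _ int]
    by (rule Lim_transform_eventually) (auto intro!: eventually_mono[OF eventually_ge_at_top[of 0]]
        trunc simp del: scaleR_scaleR)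
  have "((\<lambda>y. exp (- Re z * y)) \<longlongrightarrow> 0) at_top" using assms by real_asymp
  then have "((\<lambda>y. exp (- (z * of_real y))) \<longlongrightarrow> 0) at_top"
    by (subst tendsto_norm_zero_iff[symmetric]) simp
  then have "((\<lambda>y. (1 - exp (- (z * of_real y))) / z) \<longlongrightarrow> (1 - 0) / z) at_top"
    by (intro tendsto_intros) (use z in auto)
  with lim1 have "(\<integral>t. indicator {0..} t *\<^sub>R exp (- (z * of_real t)) \<partial>lborel) = (1 - 0) / z"
    by (rule tendsto_unique[rotated]) simp
  then show ?thesis using int by (simp add: has_bochner_integral_iff)
qed

text \<open>The reflection t -> w - t reduces this to the half-line [0, \<infinity>). The open
  half-line is the one that matches the event \<open>t < W\<close> later on; it differs from the
  reflected closed one by the null set {w}.\<close>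

lemma exp_integral_below:
  fixes c :: complex
  assumes "0 < Re c"
  shows "has_bochner_integral lborel (\<lambda>t. indicator {t. t < w} t *\<^sub>R exp (c * of_real t)) (exp (c *
      of_real w) / c)"
proof -
  have "has_bochner_integral lborel (\<lambda>t. indicator {0..} (w + - 1 * t) *\<^sub>R exp (- (c * of_real (w + - 1
      * t)))) ((1 / c) /\<^sub>R \<bar>- 1\<bar>)"
    using lborel_has_bochner_integral_real_affine_iff[of "- 1" "\<lambda>t. indicator {0..} t *\<^sub>R exp (- (c *
        of_real t))" "1 / c" w]
      Laplace_indicator_atLeast[OF assms] by simp
  then have "has_bochner_integral lborel (\<lambda>t. exp (c * of_real w) * (indicator {0..} (w + - 1 * t) *\<^sub>R
      exp (- (c * of_real (w + - 1 * t))))) (exp (c * of_real w) * (1 / c))"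
    by (intro has_bochner_integral_mult_right) simp
  moreover have "AE t in lborel. exp (c * of_real w) * (indicator {0..} (w + - 1 * t) *\<^sub>R exp (- (c *
      of_real (w + - 1 * t)))) =
      indicator {t. t < w} t *\<^sub>R exp (c * of_real t)"
    using AE_lborel_singleton[of w]
  proof eventually_elim
    case (elim t)
    have "exp (c * of_real w) * exp (- (c * of_real (w + - 1 * t))) = exp (c * of_real t)"
      by (simp add: mult_exp_exp algebra_simps)
    then show ?case using elim by (auto simp: indicator_def)
  qed
  ultimately show ?thesis
    by (subst has_bochner_integral_cong_AE[symmetric]) auto
qed

text \<open>Fubini, with the kernel written as the transform of \<open>triangle\<close>. As
  \<open>triangle\<close> has compact support, the average of g against the kernel sees the Fourier
  transform of g only at frequencies within distance 1 of \<xi>; this is why continuity of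
  \<open>H\<close> on a line, without any decay, will be enough.\<close>

lemma fejer_smoothing:
  fixes g :: "real \<Rightarrow> real"
  assumes g: "integrable lborel g"
  shows "(\<integral>t. of_real (g t * fejer (u - t)) * iexp (\<xi> * (u - t)) \<partial>lborel) =
    (\<integral>\<theta>. triangle \<theta> * iexp ((\<theta> + \<xi>) * u) * (\<integral>t. g t * exp (- (\<i> * of_real (\<theta> + \<xi>) * t)) \<partial>lborel) \<partial>lborel)"
proof -
  have [measurable]: "g \<in> borel_measurable borel" using borel_measurable_integrable[OF g] by simp
  define F :: "real \<times> real \<Rightarrow> complex" where "F = (\<lambda>(t, \<theta>). g t * triangle \<theta> * iexp ((\<theta> + \<xi>) * (u - t)))"
  have [measurable]: "F \<in> borel_measurable (lborel \<Otimes>\<^sub>M lborel)" unfolding F_def by measurable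
  have int: "integrable (lborel \<Otimes>\<^sub>M lborel) F"
  proof (rule lborel_pair.Fubini_integrable)
    have "(\<integral>\<theta>. norm (F (t, \<theta>)) \<partial>lborel) = \<bar>g t\<bar> * (\<integral>\<theta>. triangle \<theta> \<partial>lborel)" for t
      by (simp add: F_def norm_mult)
    then show "integrable lborel (\<lambda>t. \<integral>\<theta>. norm (F (t, \<theta>)) \<partial>lborel)"
      using g by simp
    show "AE t in lborel. integrable lborel (\<lambda>\<theta>. F (t, \<theta>))"
    proof (rule AE_I2)
      fix t
      show "integrable lborel (\<lambda>\<theta>. F (t, \<theta>))"
        by (rule Bochner_Integration.integrable_bound[OF integrable_mult_right[OF integrable_triangle,
            of "\<bar>g t\<bar>"]])
           (auto simp: F_def norm_mult)
    qed
  qed simp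
  have "(\<integral>t. (\<integral>\<theta>. F (t, \<theta>) \<partial>lborel) \<partial>lborel) = (\<integral>\<theta>. (\<integral>t. F (t, \<theta>) \<partial>lborel) \<partial>lborel)"
    using lborel_pair.Fubini_integral[of "\<lambda>t \<theta>. F (t, \<theta>)"] int by simp
  moreover have "(\<integral>\<theta>. F (t, \<theta>) \<partial>lborel) = of_real (g t * fejer (u - t)) * iexp (\<xi> * (u - t))" for t
  proof -
    have "(\<integral>\<theta>. F (t, \<theta>) \<partial>lborel) = (\<integral>\<theta>. (of_real (g t) * iexp (\<xi> * (u - t))) * (of_real (triangle \<theta>) *
        iexp (\<theta> * (u - t))) \<partial>lborel)"
      by (intro Bochner_Integration.integral_cong refl) (simp add: F_def ring_distribs exp_add mult_ac)
    also have "\<dots> = (of_real (g t) * iexp (\<xi> * (u - t))) * fejer (u - t)"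
      by (subst integral_mult_right_zero) (simp only: triangle_iexp)
    finally show ?thesis by (simp add: mult_ac)
  qed
  moreover have "(\<integral>t. F (t, \<theta>) \<partial>lborel) = triangle \<theta> * iexp ((\<theta> + \<xi>) * u) * (\<integral>t. g t * exp (- (\<i> *
      of_real (\<theta> + \<xi>) * t)) \<partial>lborel)" for \<theta>
  proof -
    have "(\<integral>t. F (t, \<theta>) \<partial>lborel) = (\<integral>t. (triangle \<theta> * iexp ((\<theta> + \<xi>) * u)) * (g t * exp (- (\<i> * of_real
        (\<theta> + \<xi>) * t))) \<partial>lborel)"
    proof (intro Bochner_Integration.integral_cong refl)
      fix t
      have "iexp ((\<theta> + \<xi>) * (u - t)) = exp (\<i> * ((\<theta> + \<xi>) * u) + - (\<i> * of_real (\<theta> + \<xi>) * t))"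
        by (simp add: algebra_simps)
      also have "\<dots> = iexp ((\<theta> + \<xi>) * u) * exp (- (\<i> * of_real (\<theta> + \<xi>) * t))"
        by (subst exp_add) simp
      finally show "F (t, \<theta>) = (triangle \<theta> * iexp ((\<theta> + \<xi>) * u)) * (g t * exp (- (\<i> * of_real (\<theta> + \<xi>) *
          t)))"
        by (simp add: F_def mult_ac)
    qed
    then show ?thesis by (simp only: integral_mult_right_zero)
  qed
  ultimately show ?thesis by simp
qed

text \<open>The theorem on a logarithmic scale: the two-sided Laplace transform of f is a simple
  pole at 0 plus a remainder that is continuous up to the line Re z = 0. It is required only on a
  strip of width \<open>s0\<close>, since the transform to which this is applied diverges further to
  the right. Monotonicity enters only in the final theorem.\<close>

locale Wiener_Ikehara =
  fixes f :: "real \<Rightarrow> real" and H :: "complex \<Rightarrow> complex" and a s0 :: real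
  assumes f_borel [measurable]: "f \<in> borel_measurable borel"
    and f_nonneg: "\<And>t. 0 \<le> f t"
    and a_pos: "0 < a" and s0_pos: "0 < s0"
    and integrable_f: "\<And>s. 0 < s \<Longrightarrow> s \<le> s0 \<Longrightarrow> integrable lborel (\<lambda>t. f t * exp (- s * t))"
    and Laplace_f: "\<And>z. 0 < Re z \<Longrightarrow> Re z \<le> s0 \<Longrightarrow>
        (\<integral>t. of_real (f t) * exp (- (z * of_real t)) \<partial>lborel) = of_real a / z + H z"
    and continuous_H: "continuous_on {z. 0 \<le> Re z \<and> Re z \<le> s0} H"
begin

text \<open>The boundary value at s = 0 of the right-hand side of
  \<open>smoothing_identity\<close>.\<close>

definition J :: "real \<Rightarrow> real \<Rightarrow> complex" where
  "J \<xi> u = (\<integral>\<theta>. triangle \<theta> * iexp ((\<theta> + \<xi>) * u) * H (\<i> * of_real (\<theta> + \<xi>)) \<partial>lborel)"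

text \<open>Subtracting \<open>a\<close> times the step function removes exactly the pole a / z from
  the transform, so that \<open>H\<close> alone is left under the integral.\<close>

lemma smoothing_identity:
  assumes s: "0 < s" "s \<le> s0"
  shows "(\<integral>t. of_real ((f t - a * indicator {0..} t) * exp (- s * t) * fejer (u - t)) * iexp (\<xi> * (u -
      t)) \<partial>lborel) =
    (\<integral>\<theta>. triangle \<theta> * iexp ((\<theta> + \<xi>) * u) * H (s + \<i> * of_real (\<theta> + \<xi>)) \<partial>lborel)"
proof -
  have "integrable lborel (\<lambda>t. norm (indicator {0..} t *\<^sub>R exp (- (of_real s * complex_of_real t))))"
    using Laplace_indicator_atLeast[of "of_real s"] s by (intro integrable_norm) (auto simp:
        has_bochner_integral_iff)
  then have int2: "integrable lborel (\<lambda>t. indicator {0..} t * exp (- s * t))"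
    by (simp add: norm_mult)
  have int: "integrable lborel (\<lambda>t. (f t - a * indicator {0..} t) * exp (- s * t))"
    using Bochner_Integration.integrable_diff[OF integrable_f[OF s] integrable_mult_right[OF int2, of a]]
    by (simp add: algebra_simps)
  have "(\<integral>t. of_real ((f t - a * indicator {0..} t) * exp (- s * t)) * exp (- (\<i> * of_real (\<theta> + \<xi>) * t))
      \<partial>lborel) =
      H (s + \<i> * of_real (\<theta> + \<xi>))" for \<theta> :: real
  proof -
    let ?z = "s + \<i> * of_real (\<theta> + \<xi>)"
    have z: "0 < Re ?z" "Re ?z \<le> s0" using s by auto
    have e: "exp (- (s * t)) * exp (- (\<i> * of_real (\<theta> + \<xi>) * t)) = exp (- (?z * t))" for t :: real
      by (simp add: exp_add[symmetric] exp_of_real[symmetric] algebra_simps)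
    have L: "has_bochner_integral lborel (\<lambda>t. a * (indicator {0..} t *\<^sub>R exp (- (?z * of_real t)))) (a *
        (1 / ?z))"
      by (intro has_bochner_integral_mult_right Laplace_indicator_atLeast z)
    have "integrable lborel (\<lambda>t. of_real (f t) * exp (- (?z * of_real t)))"
      by (rule Bochner_Integration.integrable_bound[OF integrable_f[OF s]]) (auto simp: norm_mult f_nonneg)
    then have "has_bochner_integral lborel (\<lambda>t. of_real (f t) * exp (- (?z * of_real t))) (a / ?z + H ?z)"
      using Laplace_f[OF z] by (simp add: has_bochner_integral_iff)
    from has_bochner_integral_diff[OF this L]
    have "(\<integral>t. of_real (f t) * exp (- (?z * of_real t)) - a * (indicator {0..} t *\<^sub>R exp (- (?z *
        of_real t))) \<partial>lborel) = H ?z"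
      by (simp add: has_bochner_integral_iff)
    also have "(\<lambda>t. of_real (f t) * exp (- (?z * of_real t)) - a * (indicator {0..} t *\<^sub>R exp (- (?z *
        of_real t)))) =
       (\<lambda>t. of_real ((f t - a * indicator {0..} t) * exp (- s * t)) * exp (- (\<i> * of_real (\<theta> + \<xi>) * t)))"
    proof
      fix t
      have "of_real ((f t - a * indicator {0..} t) * exp (- s * t)) * exp (- (\<i> * of_real (\<theta> + \<xi>) * t)) =
          of_real (f t - a * indicator {0..} t) * (of_real (exp (- (s * t))) * exp (- (\<i> * of_real (\<theta> +
              \<xi>) * t)))"
        by (simp only: of_real_mult mult.assoc mult_minus_left)
      also have "\<dots> = of_real (f t - a * indicator {0..} t) * exp (- (?z * t))"
        by (simp only: e)
      finally show "of_real (f t) * exp (- (?z * of_real t)) - a * (indicator {0..} t *\<^sub>R exp (- (?z *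
          of_real t))) =
         of_real ((f t - a * indicator {0..} t) * exp (- s * t)) * exp (- (\<i> * of_real (\<theta> + \<xi>) * t))"
        by (simp add: left_diff_distrib scaleR_conv_of_real)
    qed
    finally show ?thesis .
  qed
  then show ?thesis
    using fejer_smoothing[OF int, of u \<xi>] by simp
qed

lemma H_bounded:
  obtains B where "0 \<le> B" "\<And>s \<theta>. 0 \<le> s \<Longrightarrow> s \<le> s0 \<Longrightarrow> \<bar>\<theta>\<bar> \<le> 1 \<Longrightarrow> norm (H (of_real s + \<i> * of_real (\<theta> + \<xi>))) \<le> B"
proof -
  let ?g = "\<lambda>(s, \<theta>). H (of_real s + \<i> * of_real (\<theta> + \<xi>))"
  have "compact (?g ` ({0..s0} \<times> {-1..1}))"
    unfolding case_prod_unfold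
    by (intro compact_continuous_image compact_Times continuous_on_compose2[OF continuous_H]
        continuous_intros) auto
  then have "bounded (?g ` ({0..s0} \<times> {-1..1}))" by (rule compact_imp_bounded)
  then obtain B where B: "\<And>x. x \<in> {0..s0} \<times> {-1..1} \<Longrightarrow> norm (?g x) \<le> B"
    unfolding bounded_iff by blast
  show thesis
  proof (rule that[of "max B 0"])
    fix s \<theta> :: real assume "0 \<le> s" "s \<le> s0" "\<bar>\<theta>\<bar> \<le> 1"
    then show "norm (H (of_real s + \<i> * of_real (\<theta> + \<xi>))) \<le> max B 0"
      using B[of "(s, \<theta>)"] by (auto simp: abs_le_iff)
  qed simp
qed

lemma continuous_H_line: "continuous_on UNIV (\<lambda>\<theta>. H (of_real s + \<i> * of_real (\<theta> + \<xi>)))" if "0 \<le> s" "s \<le>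
    s0" for s \<xi> :: real
  by (rule continuous_on_compose2[OF continuous_H]) (use that in \<open>auto intro!: continuous_intros\<close>)

lemma borel_measurable_H_line [measurable]:
  "(\<lambda>\<theta>. H (of_real s + \<i> * of_real (\<theta> + \<xi>))) \<in> borel_measurable borel" if "0 \<le> s" "s \<le> s0" for s \<xi> :: real
  using continuous_H_line[OF that] by (rule borel_measurable_continuous_onI)

lemma tendsto_J:
  assumes s: "\<And>n. 0 < s n" "\<And>n. s n \<le> s0" "s \<longlonglongrightarrow> 0"
  shows "(\<lambda>n. \<integral>\<theta>. triangle \<theta> * iexp ((\<theta> + \<xi>) * u) * H (s n + \<i> * of_real (\<theta> + \<xi>)) \<partial>lborel) \<longlonglongrightarrow> J \<xi> u"
proof -
  obtain B where B: "0 \<le> B" "\<And>s \<theta>. 0 \<le> s \<Longrightarrow> s \<le> s0 \<Longrightarrow> \<bar>\<theta>\<bar> \<le> 1 \<Longrightarrow> norm (H (of_real s + \<i> * of_real (\<theta> + \<xi>)))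
      \<le> B"
    using H_bounded[of \<xi>] by blast
  have s0: "0 \<le> s n" for n using s(1)[of n] by simp
  show ?thesis
    unfolding J_def
  proof (rule integral_dominated_convergence[where w = "\<lambda>\<theta>. triangle \<theta> * B"])
    show "AE \<theta> in lborel. (\<lambda>n. triangle \<theta> * iexp ((\<theta> + \<xi>) * u) * H (s n + \<i> * of_real (\<theta> + \<xi>))) \<longlonglongrightarrow>
        triangle \<theta> * iexp ((\<theta> + \<xi>) * u) * H (\<i> * of_real (\<theta> + \<xi>))"
    proof (rule AE_I2)
      fix \<theta> :: real
      have "(\<lambda>n. H (s n + \<i> * of_real (\<theta> + \<xi>))) \<longlonglongrightarrow> H (\<i> * of_real (\<theta> + \<xi>))"
        by (rule continuous_on_tendsto_compose[OF continuous_H])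
           (use s s0 s0_pos in \<open>auto intro!: tendsto_eq_intros\<close>)
      then show "(\<lambda>n. triangle \<theta> * iexp ((\<theta> + \<xi>) * u) * H (s n + \<i> * of_real (\<theta> + \<xi>))) \<longlonglongrightarrow> triangle \<theta> *
          iexp ((\<theta> + \<xi>) * u) * H (\<i> * of_real (\<theta> + \<xi>))"
        by (intro tendsto_intros)
    qed
    show "AE \<theta> in lborel. norm (triangle \<theta> * iexp ((\<theta> + \<xi>) * u) * H (s n + \<i> * of_real (\<theta> + \<xi>))) \<le>
        triangle \<theta> * B" for n
    proof (rule AE_I2)
      fix \<theta> :: real
      show "norm (triangle \<theta> * iexp ((\<theta> + \<xi>) * u) * H (s n + \<i> * of_real (\<theta> + \<xi>))) \<le> triangle \<theta> * B"
        using B(2)[of "s n" \<theta>] s(2)[of n] s0[of n]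
        by (cases "\<bar>\<theta>\<bar> \<le> 1") (auto simp: norm_mult mult_left_mono, simp add: triangle_def)
    qed
    show "(\<lambda>\<theta>. triangle \<theta> * iexp ((\<theta> + \<xi>) * u) * H (\<i> * of_real (\<theta> + \<xi>))) \<in> borel_measurable lborel"
      using borel_measurable_H_line[of 0 \<xi>] s0_pos by simp
    show "(\<lambda>\<theta>. triangle \<theta> * iexp ((\<theta> + \<xi>) * u) * H (s n + \<i> * of_real (\<theta> + \<xi>))) \<in> borel_measurable
        lborel" for n
      using borel_measurable_H_line[of "s n" \<xi>] s(2)[of n] s0[of n] by simp
  qed (simp add: integrable_triangle)
qed

lemma J_tendsto_0: "(J \<xi> \<longlongrightarrow> 0) at_top"
proof -
  have "((\<lambda>u. \<integral>\<theta>. (triangle \<theta> * H (\<i> * of_real (\<theta> + \<xi>))) * iexp (\<theta> * u) \<partial>lborel) \<longlongrightarrow> 0) at_top"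
    by (rule Riemann_Lebesgue)
       (use continuous_H_line[of 0 \<xi>] s0_pos in \<open>auto simp: triangle_def intro!: continuous_intros\<close>)
  then have *: "((\<lambda>u. norm (\<integral>\<theta>. (triangle \<theta> * H (\<i> * of_real (\<theta> + \<xi>))) * iexp (\<theta> * u) \<partial>lborel)) \<longlongrightarrow> 0) at_top"
    by (rule tendsto_norm_zero)
  have "J \<xi> u = iexp (\<xi> * u) * (\<integral>\<theta>. (triangle \<theta> * H (\<i> * of_real (\<theta> + \<xi>))) * iexp (\<theta> * u) \<partial>lborel)" for u
    unfolding J_def by (subst integral_mult_right_zero[symmetric], rule Bochner_Integration.integral_cong)
      (simp_all add: exp_add ring_distribs mult_ac)
  then have "norm (J \<xi> u) = norm (\<integral>\<theta>. (triangle \<theta> * H (\<i> * of_real (\<theta> + \<xi>))) * iexp (\<theta> * u) \<partial>lborel)" for u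
    by (simp add: norm_mult)
  with * show ?thesis by (simp add: tendsto_norm_zero_iff[symmetric, of "J \<xi>"])
qed

text \<open>The convergence factor exp (- s t) is removed in two rounds. At frequency 0 the smoothed
  integrals stay bounded as s tends to 0, and Fatou's lemma makes f integrable against the window.
  This integrability then supplies the dominating function with which the limit is taken at every
  frequency.\<close>

lemma smoothed_integrable_and_eq:
  shows integrable_f_fejer: "integrable lborel (\<lambda>t. f t * fejer (u - t))"
    and smoothed_eq: "(\<integral>t. of_real ((f t - a * indicator {0..} t) * fejer (u - t)) * iexp (\<xi> * (u - t))
        \<partial>lborel) = J \<xi> u"
proof -
  define s where "s n = s0 * inverse (real (Suc n))" for n
  have s_pos: "0 < s n" for n using s0_pos by (simp add: s_def)
  have s_le: "s n \<le> s0" for n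
    using s0_pos by (simp add: s_def field_simps)
  have "s \<longlonglongrightarrow> s0 * 0"
    unfolding s_def by (intro tendsto_intros LIMSEQ_inverse_real_of_nat)
  then have s_lim: "s \<longlonglongrightarrow> 0" by simp
  have int_fejer: "integrable lborel (\<lambda>t. fejer (u - t))"
    using lborel_integrable_real_affine[OF integrable_fejer, of "-1" u] by simp
  have exp_lim: "(\<lambda>n. exp (- s n * t)) \<longlonglongrightarrow> 1" for t
    using s_lim by (auto intro!: tendsto_eq_intros)
  have int_n: "integrable lborel (\<lambda>t. f t * exp (- s n * t) * fejer (u - t))" for n
    by (rule Bochner_Integration.integrable_bound[OF integrable_f[OF s_pos[of n] s_le[of n]]])
       (auto simp: f_nonneg abs_mult intro!: AE_I2 mult_right_le_one_le fejer_le_1)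
  have int_0: "integrable lborel (\<lambda>t. a * indicator {0..} t * exp (- s n * t) * fejer (u - t))" for n
    by (rule Bochner_Integration.integrable_bound[OF integrable_mult_right[OF int_fejer, of a]])
       (use a_pos s_pos[of n] in \<open>auto simp: indicator_def abs_mult intro!: AE_I2 mult_left_le_one_le\<close>)
  have diff: "(\<integral>t. (f t - a * indicator {0..} t) * exp (- s n * t) * fejer (u - t) \<partial>lborel) =
      (\<integral>t. f t * exp (- s n * t) * fejer (u - t) \<partial>lborel) - (\<integral>t. a * indicator {0..} t * exp (- s n * t)
          * fejer (u - t) \<partial>lborel)" for n
    using Bochner_Integration.integral_diff[OF int_n[of n] int_0[of n]] by (simp add: left_diff_distrib)
  \<comment> \<open>At frequency 0 the oscillating factor is 1, so the identity controls the
    integral of a nonnegative function once the contribution of the step function is moved to the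
    right.\<close>
  have le: "(\<integral>t. f t * exp (- s n * t) * fejer (u - t) \<partial>lborel) \<le>
      norm (\<integral>\<theta>. triangle \<theta> * iexp ((\<theta> + 0) * u) * H (s n + \<i> * of_real (\<theta> + 0)) \<partial>lborel) + a * (\<integral>t.
          fejer (u - t) \<partial>lborel)" for n
  proof -
    have "of_real (\<integral>t. (f t - a * indicator {0..} t) * exp (- s n * t) * fejer (u - t) \<partial>lborel) =
      (\<integral>\<theta>. triangle \<theta> * iexp ((\<theta> + 0) * u) * H (s n + \<i> * of_real (\<theta> + 0)) \<partial>lborel)"
      using smoothing_identity[OF s_pos[of n] s_le[of n], of u 0] by (simp del: of_real_mult of_real_diff)
    then have "\<bar>\<integral>t. (f t - a * indicator {0..} t) * exp (- s n * t) * fejer (u - t) \<partial>lborel\<bar> =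
      norm (\<integral>\<theta>. triangle \<theta> * iexp ((\<theta> + 0) * u) * H (s n + \<i> * of_real (\<theta> + 0)) \<partial>lborel)"
      by (simp only: norm_of_real[symmetric, where 'a = complex])
    moreover have "(\<integral>t. a * indicator {0..} t * exp (- s n * t) * fejer (u - t) \<partial>lborel) \<le> (\<integral>t. a *
        fejer (u - t) \<partial>lborel)"
      by (intro integral_mono int_0 integrable_mult_right int_fejer)
         (use a_pos s_pos[of n] in \<open>auto simp: indicator_def intro!: mult_left_le_one_le\<close>)
    ultimately show ?thesis using diff[of n] by simp
  qed
  have "convergent (\<lambda>n. \<integral>\<theta>. triangle \<theta> * iexp ((\<theta> + 0) * u) * H (s n + \<i> * of_real (\<theta> + 0)) \<partial>lborel)"
    using tendsto_J[OF s_pos s_le s_lim, of 0 u] by (rule convergentI)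
  then have "Bseq (\<lambda>n. \<integral>\<theta>. triangle \<theta> * iexp ((\<theta> + 0) * u) * H (s n + \<i> * of_real (\<theta> + 0)) \<partial>lborel)"
    by (rule convergent_imp_Bseq)
  then obtain C where C: "\<And>n. norm (\<integral>\<theta>. triangle \<theta> * iexp ((\<theta> + 0) * u) * H (s n + \<i> * of_real (\<theta> + 0))
      \<partial>lborel) \<le> C"
    by (rule BseqE) blast
  define D where "D = C + a * (\<integral>t. fejer (u - t) \<partial>lborel)"
  have nn: "(\<integral>\<^sup>+t. ennreal (f t * exp (- s n * t) * fejer (u - t)) \<partial>lborel) \<le> ennreal D" for n
    using le[of n] C[of n] by (subst nn_integral_eq_integral[OF int_n]) (auto simp: f_nonneg D_def
        intro!: ennreal_leI)
  have "(\<integral>\<^sup>+t. ennreal (f t * fejer (u - t)) \<partial>lborel) = (\<integral>\<^sup>+t. liminf (\<lambda>n. ennreal (f t * exp (- s n *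
      t) * fejer (u - t))) \<partial>lborel)"
  proof (intro nn_integral_cong)
    fix t
    have "(\<lambda>n. ennreal (f t * exp (- s n * t) * fejer (u - t))) \<longlonglongrightarrow> ennreal (f t * 1 * fejer (u - t))"
      by (intro tendsto_intros tendsto_ennrealI exp_lim)
    from lim_imp_Liminf[OF sequentially_bot this]
    show "ennreal (f t * fejer (u - t)) = liminf (\<lambda>n. ennreal (f t * exp (- s n * t) * fejer (u - t)))"
      by simp
  qed
  also have "\<dots> \<le> liminf (\<lambda>n. \<integral>\<^sup>+t. ennreal (f t * exp (- s n * t) * fejer (u - t)) \<partial>lborel)"
    by (rule nn_integral_liminf) simp
  also have "\<dots> \<le> ennreal D"
    by (rule Liminf_le, simp, intro always_eventually allI nn)
  finally have "(\<integral>\<^sup>+t. ennreal (f t * fejer (u - t)) \<partial>lborel) \<le> ennreal D" .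
  then have "(\<integral>\<^sup>+t. ennreal (norm (f t * fejer (u - t))) \<partial>lborel) < \<infinity>"
    by (simp add: f_nonneg order_le_less_trans)
  then show int: "integrable lborel (\<lambda>t. f t * fejer (u - t))"
    by (intro integrableI_bounded) auto
  have "(\<lambda>n. \<integral>t. of_real ((f t - a * indicator {0..} t) * exp (- s n * t) * fejer (u - t)) * iexp (\<xi> *
      (u - t)) \<partial>lborel) \<longlonglongrightarrow>
     (\<integral>t. of_real ((f t - a * indicator {0..} t) * fejer (u - t)) * iexp (\<xi> * (u - t)) \<partial>lborel)"
  proof (rule integral_dominated_convergence[where w = "\<lambda>t. f t * fejer (u - t) + f t * exp (- s0 * t) +
      a * fejer (u - t)"])
    show "integrable lborel (\<lambda>t. f t * fejer (u - t) + f t * exp (- s0 * t) + a * fejer (u - t))"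
      using int integrable_f[of s0] s0_pos int_fejer by (intro Bochner_Integration.integrable_add) auto
    show "AE t in lborel. (\<lambda>n. of_real ((f t - a * indicator {0..} t) * exp (- s n * t) * fejer (u - t))
        * iexp (\<xi> * (u - t))) \<longlonglongrightarrow>
        of_real ((f t - a * indicator {0..} t) * fejer (u - t)) * iexp (\<xi> * (u - t))"
    proof (rule AE_I2)
      fix t
      have "(\<lambda>n. of_real ((f t - a * indicator {0..} t) * exp (- s n * t) * fejer (u - t)) * iexp (\<xi> *
          (u - t))) \<longlonglongrightarrow>
        of_real ((f t - a * indicator {0..} t) * 1 * fejer (u - t)) * iexp (\<xi> * (u - t))"
        by (intro tendsto_intros exp_lim)
      then show "(\<lambda>n. of_real ((f t - a * indicator {0..} t) * exp (- s n * t) * fejer (u - t)) * iexp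
          (\<xi> * (u - t))) \<longlonglongrightarrow>
        of_real ((f t - a * indicator {0..} t) * fejer (u - t)) * iexp (\<xi> * (u - t))" by simp
    qed
    show "AE t in lborel. norm (of_real ((f t - a * indicator {0..} t) * exp (- s n * t) * fejer (u -
        t)) * iexp (\<xi> * (u - t))) \<le>
       f t * fejer (u - t) + f t * exp (- s0 * t) + a * fejer (u - t)" for n
    proof (rule AE_I2)
      fix t
      have "norm (of_real ((f t - a * indicator {0..} t) * exp (- s n * t) * fejer (u - t)) * iexp (\<xi> *
          (u - t))) =
          \<bar>f t - a * indicator {0..} t\<bar> * exp (- s n * t) * fejer (u - t)"
        by (simp add: norm_mult abs_mult del: of_real_mult of_real_diff)
      also have "\<dots> \<le> (f t + a * indicator {0..} t) * exp (- s n * t) * fejer (u - t)"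
        using f_nonneg[of t] a_pos by (intro mult_right_mono) (auto simp: indicator_def)
      also have "\<dots> = f t * exp (- s n * t) * fejer (u - t) + a * (indicator {0..} t * exp (- s n * t)) *
          fejer (u - t)"
        by (simp add: algebra_simps)
      \<comment> \<open>For t >= 0 the exponential is at most 1. For t < 0 it grows, but no faster
        than at \<open>s0\<close>, where f is known to be integrable.\<close>
      also have "f t * exp (- s n * t) * fejer (u - t) \<le> f t * fejer (u - t) + f t * exp (- s0 * t)"
      proof (cases "0 \<le> t")
        case True
        then have "exp (- s n * t) \<le> 1" using s_pos[of n] by simp
        then have "f t * exp (- s n * t) * fejer (u - t) \<le> f t * 1 * fejer (u - t)"
          by (intro mult_right_mono mult_left_mono f_nonneg fejer_nonneg)
        then show ?thesis using mult_nonneg_nonneg[OF f_nonneg[of t] exp_ge_zero[of "- s0 * t"]] by simp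
      next
        case False
        then have "exp (- s n * t) \<le> exp (- s0 * t)" using s_le[of n] by (simp add: mult_right_mono_neg)
        then have "f t * exp (- s n * t) * fejer (u - t) \<le> f t * exp (- s0 * t) * 1"
          by (intro mult_mono f_nonneg fejer_nonneg fejer_le_1 mult_left_mono mult_nonneg_nonneg) auto
        then show ?thesis using mult_nonneg_nonneg[OF f_nonneg[of t] fejer_nonneg[of "u - t"]] by simp
      qed
      also have "a * (indicator {0..} t * exp (- s n * t)) * fejer (u - t) \<le> a * 1 * fejer (u - t)"
        using a_pos s_pos[of n] by (intro mult_right_mono mult_left_mono) (auto simp: indicator_def)
      finally show "norm (of_real ((f t - a * indicator {0..} t) * exp (- s n * t) * fejer (u - t)) *
          iexp (\<xi> * (u - t))) \<le>
         f t * fejer (u - t) + f t * exp (- s0 * t) + a * fejer (u - t)" by simp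
    qed
  qed simp_all
  then have "(\<lambda>n. \<integral>\<theta>. triangle \<theta> * iexp ((\<theta> + \<xi>) * u) * H (s n + \<i> * of_real (\<theta> + \<xi>)) \<partial>lborel) \<longlonglongrightarrow>
     (\<integral>t. of_real ((f t - a * indicator {0..} t) * fejer (u - t)) * iexp (\<xi> * (u - t)) \<partial>lborel)"
    by (simp only: smoothing_identity[OF s_pos s_le])
  then show "(\<integral>t. of_real ((f t - a * indicator {0..} t) * fejer (u - t)) * iexp (\<xi> * (u - t)) \<partial>lborel)
      = J \<xi> u"
    by (rule LIMSEQ_unique[OF _ tendsto_J[OF s_pos s_le s_lim, of \<xi> u]])
qed

lemma integrable_fejer_window: "integrable lborel (\<lambda>x. f (u - x) * fejer x)"
  using lborel_integrable_real_affine[OF integrable_f_fejer[of u], of "-1" u] by simp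

text \<open>Reflected to u - t, the window stays fixed at 0 while f moves. The step function becomes
  the indicator of {..u}, which exhausts the line; what remains is \<open>J\<close>, which tends to
  0 by the Riemann-Lebesgue lemma.\<close>

lemma fejer_window_tendsto:
  "((\<lambda>u. \<integral>x. of_real (f (u - x) * fejer x) * iexp (\<xi> * x) \<partial>lborel) \<longlongrightarrow>
     (\<integral>x. of_real (a * fejer x) * iexp (\<xi> * x) \<partial>lborel)) at_top"
proof -
  have eq: "(\<integral>x. of_real (f (u - x) * fejer x) * iexp (\<xi> * x) \<partial>lborel) =
      J \<xi> u + (\<integral>x. of_real (a * indicator {..u} x * fejer x) * iexp (\<xi> * x) \<partial>lborel)" for u
  proof -
    have "J \<xi> u = (\<integral>x. of_real ((f (u - x) - a * indicator {0..} (u - x)) * fejer x) * iexp (\<xi> * x)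
        \<partial>lborel)"
      unfolding smoothed_eq[symmetric]
      by (subst lborel_integral_real_affine[where c = "-1" and t = u]) auto
    also have "\<dots> = (\<integral>x. of_real (f (u - x) * fejer x) * iexp (\<xi> * x) - of_real (a * indicator {..u} x *
        fejer x) * iexp (\<xi> * x) \<partial>lborel)"
      by (intro Bochner_Integration.integral_cong) (auto simp: algebra_simps indicator_def)
    also have "\<dots> = (\<integral>x. of_real (f (u - x) * fejer x) * iexp (\<xi> * x) \<partial>lborel) - (\<integral>x. of_real (a *
        indicator {..u} x * fejer x) * iexp (\<xi> * x) \<partial>lborel)"
    proof (rule Bochner_Integration.integral_diff)
      show "integrable lborel (\<lambda>x. complex_of_real (f (u - x) * fejer x) * iexp (\<xi> * x))"
        by (rule Bochner_Integration.integrable_bound[OF integrable_fejer_window[of u]]) (auto simp: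
            norm_mult)
      show "integrable lborel (\<lambda>x. complex_of_real (a * indicator {..u} x * fejer x) * iexp (\<xi> * x))"
        by (rule Bochner_Integration.integrable_bound[OF integrable_mult_right[OF integrable_fejer, of a]])
           (auto simp: norm_mult indicator_def)
    qed
    finally show ?thesis by simp
  qed
  have "((\<lambda>u. \<integral>x. of_real (a * indicator {..u} x * fejer x) * iexp (\<xi> * x) \<partial>lborel) \<longlongrightarrow>
     (\<integral>x. of_real (a * fejer x) * iexp (\<xi> * x) \<partial>lborel)) at_top"
  proof -
    have "integrable lborel (\<lambda>x. complex_of_real (a * fejer x) * iexp (\<xi> * x))"
      by (rule Bochner_Integration.integrable_bound[OF integrable_mult_right[OF integrable_fejer, of a]])
         (auto simp: norm_mult)
    from tendsto_integral_at_top[OF _ this]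
    have "((\<lambda>u. \<integral>x. indicator {..u} x *\<^sub>R (of_real (a * fejer x) * iexp (\<xi> * x)) \<partial>lborel) \<longlongrightarrow>
     (\<integral>x. of_real (a * fejer x) * iexp (\<xi> * x) \<partial>lborel)) at_top" by simp
    also have "(\<lambda>u x. indicator {..u} x *\<^sub>R (of_real (a * fejer x) * iexp (\<xi> * x))) = (\<lambda>u x. of_real (a
        * indicator {..u} x * fejer x) * iexp (\<xi> * x))"
      by (intro ext) (simp add: indicator_def)
    finally show ?thesis .
  qed
  from tendsto_add[OF J_tendsto_0 this] show ?thesis unfolding eq by simp
qed

text \<open>By \<open>fejer_window_tendsto\<close>, the characteristic functions of the measures with density
  \<open>\<lambda>x. f (u - x) * fejer x\<close> converge for all frequencies, so Levy's continuity theorem replaces the Fejer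
  window by the indicator of an interval.\<close>

lemma window_average_tendsto:
  assumes "0 < h" 
  shows "((\<lambda>u. \<integral>x. f (u - x) * fejer x * indicator {0<..h} x \<partial>lborel) \<longlongrightarrow>
    a * (\<integral>x. fejer x * indicator {0<..h} x \<partial>lborel)) at_top"
proof (rule tendsto_at_topI_sequentially)
  fix X :: "nat \<Rightarrow> real" assume X: "filterlim X at_top sequentially"
  define c where "c u = (\<integral>x. f (u - x) * fejer x \<partial>lborel)" for u
  define d where "d = (\<integral>x. a * fejer x \<partial>lborel)"
  have c_lim: "(c \<longlongrightarrow> d) at_top"
  proof -
    have "((\<lambda>u. complex_of_real (c u)) \<longlongrightarrow> complex_of_real d) at_top"
      using fejer_window_tendsto[of 0] unfolding c_def d_def by (simp del: of_real_mult)
    then show ?thesis by (simp add: tendsto_of_real_iff)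
  qed
  have int_af: "integrable lborel (\<lambda>x. a * fejer x)" by (intro integrable_mult_right integrable_fejer)
  have d_pos: "0 < d"
  proof -
    have "d \<noteq> 0"
    proof
      assume "d = 0"
      then have "AE x in lborel. a * fejer x = 0"
        unfolding d_def using a_pos by (subst (asm) integral_nonneg_eq_0_iff_AE[OF int_af]) auto
      then have "AE x in lborel. x \<notin> {0<..<pi}"
      proof eventually_elim
        case (elim x)
        then show ?case using a_pos fejer_pos[of x] by auto
      qed
      then have "emeasure lborel {0<..<pi} = 0"
        by (subst (asm) AE_iff_measurable[OF _ refl]) (auto simp: greaterThanLessThan_def
            greaterThan_def lessThan_def Int_def)
      then show False by simp
    qed
    moreover have "0 \<le> d" unfolding d_def using a_pos by simp
    ultimately show ?thesis by simp
  qed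
  define M' where "M' = density lborel (\<lambda>x. ennreal (a * fejer x / d))"
  \<comment> \<open>The measures are normalised because Levy's theorem concerns probability
    distributions. \<open>M'\<close> is a default value for a mass \<open>c u\<close> that is not
    positive, which happens for only finitely many terms of the sequence.\<close>
  define N where "N u = (if 0 < c u then density lborel (\<lambda>x. ennreal (f (u - x) * fejer x / c u)) else
      M')" for u
  have M': "real_distribution M'"
  proof (intro real_distribution.intro prob_spaceI real_distribution_axioms.intro)
    have "emeasure M' (space M') = (\<integral>\<^sup>+x. ennreal (a * fejer x / d) \<partial>lborel)"
      by (simp add: M'_def emeasure_density)
    also have "\<dots> = ennreal (\<integral>x. a * fejer x / d \<partial>lborel)"
      using a_pos d_pos int_af by (intro nn_integral_eq_integral integrable_divide_zero) auto
    also have "\<dots> = 1"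
      unfolding integral_divide_zero d_def[symmetric] using d_pos by simp
    finally show "emeasure M' (space M') = 1" .
  qed (simp add: M'_def)
  have N: "real_distribution (N u)" for u
  proof (cases "0 < c u")
    case True
    show ?thesis
    proof (intro real_distribution.intro prob_spaceI real_distribution_axioms.intro)
      have "emeasure (N u) (space (N u)) = (\<integral>\<^sup>+x. ennreal (f (u - x) * fejer x / c u) \<partial>lborel)"
        using True by (simp add: N_def emeasure_density)
      also have "\<dots> = ennreal (\<integral>x. f (u - x) * fejer x / c u \<partial>lborel)"
        using True integrable_fejer_window[of u] f_nonneg by (intro nn_integral_eq_integral
            integrable_divide_zero) auto
      also have "\<dots> = 1"
        using True by (simp add: c_def del: times_divide_eq_left)
      finally show "emeasure (N u) (space (N u)) = 1" .
    qed (simp add: N_def M'_def)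
  qed (simp add: N_def M')
  have ev: "\<forall>\<^sub>F n in sequentially. 0 < c (X n)"
    using order_tendstoD(1)[OF filterlim_compose[OF c_lim X] d_pos] .
  have c_X: "(\<lambda>n. c (X n)) \<longlonglongrightarrow> d" using filterlim_compose[OF c_lim X] .
  have char_N: "char (N u) \<xi> = (\<integral>x. of_real (f (u - x) * fejer x) * iexp (\<xi> * x) \<partial>lborel) / c u" if "0 <
      c u" for u \<xi>
  proof -
    have "char (N u) \<xi> = (\<integral>x. (f (u - x) * fejer x / c u) *\<^sub>R iexp (\<xi> * x) \<partial>lborel)"
      using that f_nonneg unfolding N_def char_def by (simp add: integral_density)
    also have "\<dots> = (\<integral>x. of_real (f (u - x) * fejer x) * iexp (\<xi> * x) / c u \<partial>lborel)"
      by (simp add: scaleR_conv_of_real)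
    finally show ?thesis by simp
  qed
  have char_M': "char M' \<xi> = (\<integral>x. of_real (a * fejer x) * iexp (\<xi> * x) \<partial>lborel) / d" for \<xi>
  proof -
    have "char M' \<xi> = (\<integral>x. (a * fejer x / d) *\<^sub>R iexp (\<xi> * x) \<partial>lborel)"
      using d_pos a_pos unfolding M'_def char_def by (simp add: integral_density)
    also have "\<dots> = (\<integral>x. of_real (a * fejer x) * iexp (\<xi> * x) / d \<partial>lborel)"
      by (simp add: scaleR_conv_of_real)
    finally show ?thesis by simp
  qed
  have "weak_conv_m (\<lambda>n. N (X n)) M'"
  proof (rule levy_continuity)
    fix \<xi>
    have "(\<lambda>n. (\<integral>x. of_real (f (X n - x) * fejer x) * iexp (\<xi> * x) \<partial>lborel) / c (X n)) \<longlonglongrightarrow> char M' \<xi>"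
      unfolding char_M' using d_pos
      by (intro tendsto_divide filterlim_compose[OF fejer_window_tendsto X] tendsto_of_real c_X) auto
    then show "(\<lambda>n. char (N (X n)) \<xi>) \<longlonglongrightarrow> char M' \<xi>"
      by (rule Lim_transform_eventually) (use ev in eventually_elim, simp add: char_N)
  qed (auto intro: N M')
  \<comment> \<open>A measure with a density has no atoms, so the distribution functions converge at
    every point, in particular at both ends of the interval.\<close>
  moreover have "isCont (cdf M') x" for x
  proof -
    interpret M': real_distribution M' by (rule M')
    have "emeasure M' {x} = (\<integral>\<^sup>+y. ennreal (a * fejer y / d) * indicator {x} y \<partial>lborel)"
      by (simp add: M'_def emeasure_density)
    also have "\<dots> = 0"
      by (subst nn_integral_0_iff_AE) (use AE_lborel_singleton[of x] in \<open>auto elim!: eventually_mono\<close>)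
    finally show ?thesis by (simp add: M'.isCont_cdf measure_def)
  qed
  ultimately have cdf_lim: "(\<lambda>n. cdf (N (X n)) x) \<longlonglongrightarrow> cdf M' x" for x
    unfolding weak_conv_m_def weak_conv_def by blast
  have win_N: "cdf (N u) h - cdf (N u) 0 = (\<integral>x. f (u - x) * fejer x * indicator {0<..h} x \<partial>lborel) / c
      u" if "0 < c u" for u
  proof -
    interpret N: real_distribution "N u" by (rule N)
    have "cdf (N u) h - cdf (N u) 0 = measure (N u) {0<..h}"
      by (rule N.cdf_diff_eq[OF assms])
    also have "\<dots> = (\<integral>x. indicator {0<..h} x \<partial>N u)" by simp
    also have "\<dots> = (\<integral>x. (f (u - x) * fejer x / c u) *\<^sub>R indicator {0<..h} x \<partial>lborel)"
      using that f_nonneg unfolding N_def if_P[OF that] by (intro integral_density) auto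
    finally show ?thesis by simp
  qed
  have win_M': "cdf M' h - cdf M' 0 = (\<integral>x. a * fejer x * indicator {0<..h} x \<partial>lborel) / d"
  proof -
    interpret M': real_distribution M' by (rule M')
    have "cdf M' h - cdf M' 0 = measure M' {0<..h}"
      by (rule M'.cdf_diff_eq[OF assms])
    also have "\<dots> = (\<integral>x. indicator {0<..h} x \<partial>M')" by simp
    also have "\<dots> = (\<integral>x. (a * fejer x / d) *\<^sub>R indicator {0<..h} x \<partial>lborel)"
      using a_pos d_pos unfolding M'_def by (intro integral_density) auto
    finally show ?thesis by simp
  qed
  have "(\<lambda>n. (cdf (N (X n)) h - cdf (N (X n)) 0) * c (X n)) \<longlonglongrightarrow> (cdf M' h - cdf M' 0) * d"
    by (intro tendsto_intros cdf_lim c_X)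
  then have "(\<lambda>n. \<integral>x. f (X n - x) * fejer x * indicator {0<..h} x \<partial>lborel) \<longlonglongrightarrow> (cdf M' h - cdf M' 0) * d"
    by (rule Lim_transform_eventually) (use ev in eventually_elim, simp add: win_N)
  also have "(cdf M' h - cdf M' 0) * d = a * (\<integral>x. fejer x * indicator {0<..h} x \<partial>lborel)"
    using d_pos by (simp add: win_M' mult.assoc)
  finally show "(\<lambda>n. \<integral>x. f (X n - x) * fejer x * indicator {0<..h} x \<partial>lborel) \<longlonglongrightarrow> a * (\<integral>x. fejer x *
      indicator {0<..h} x \<partial>lborel)" .
qed

text \<open>The Tauberian step. The monotonicity allows f to grow by a factor of at most exp
  (\<beta> x) over a length x, so the averages over a window of length h determine f up to factors
  exp (\<beta> h) and exp (- \<beta> h), and h is then taken small. Windows shorter than pi keep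
  \<open>fejer\<close> positive.\<close>

theorem tendsto_of_antimono:
  assumes anti: "\<And>t t'. t \<le> t' \<Longrightarrow> exp (- \<beta> * t') * f t' \<le> exp (- \<beta> * t) * f t" and \<beta>: "0 < \<beta>"
  shows "(f \<longlongrightarrow> a) at_top"
proof -
  have growth: "f t' \<le> exp (\<beta> * (t' - t)) * f t" if "t \<le> t'" for t t'
  proof -
    have "f t' = exp (\<beta> * t') * (exp (- \<beta> * t') * f t')" by (simp add: exp_minus)
    also have "\<dots> \<le> exp (\<beta> * t') * (exp (- \<beta> * t) * f t)"
      by (intro mult_left_mono anti that) simp
    also have "\<dots> = exp (\<beta> * (t' - t)) * f t" by (simp add: exp_diff right_diff_distrib exp_minus
        field_simps)
    finally show ?thesis .
  qed
  have main: "\<forall>\<^sub>F u in at_top. f u < exp (\<beta> * h) * (a + e)" "\<forall>\<^sub>F u in at_top. exp (- \<beta> * h) * (a - e) < f u"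
    if h: "0 < h" "h < pi" and e: "0 < e" for h e
  proof -
    define k where "k = (\<integral>x. fejer x * indicator {0<..h} x \<partial>lborel)"
    define I where "I u = (\<integral>x. f (u - x) * fejer x * indicator {0<..h} x \<partial>lborel)" for u
    have int_k: "integrable lborel (\<lambda>x. fejer x * indicator {0<..h} x)"
      by (rule integrable_real_mult_indicator) (auto simp: integrable_fejer)
    have int_I: "integrable lborel (\<lambda>x. f (u - x) * fejer x * indicator {0<..h} x)" for u
      by (rule integrable_real_mult_indicator) (auto simp: integrable_fejer_window)
    have k_pos: "0 < k"
    proof -
      have "k \<noteq> 0"
      proof
        assume "k = 0"
        then have "AE x in lborel. fejer x * indicator {0<..h} x = 0"
          unfolding k_def by (subst (asm) integral_nonneg_eq_0_iff_AE[OF int_k]) auto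
        then have "AE x in lborel. x \<notin> {0<..h}"
        proof eventually_elim
          case (elim x)
          then show ?case using fejer_pos[of x] h by (auto simp: indicator_def split: if_splits)
        qed
        then have "emeasure lborel {0<..h} = 0"
          by (subst (asm) AE_iff_measurable[OF _ refl]) (auto simp: greaterThanAtMost_def
              greaterThan_def atMost_def Int_def)
        then show False using h by simp
      qed
      moreover have "0 \<le> k" unfolding k_def by simp
      ultimately show ?thesis by simp
    qed
    have I_lim: "(I \<longlongrightarrow> a * k) at_top"
      unfolding I_def k_def by (rule window_average_tendsto[OF h(1)])
    have lower: "exp (- \<beta> * h) * f u * k \<le> I u" for u
    proof -
      have "exp (- \<beta> * h) * f u * k = (\<integral>x. (exp (- \<beta> * h) * f u) * (fejer x * indicator {0<..h} x) \<partial>lborel)"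
        unfolding k_def by simp
      also have "\<dots> \<le> I u"
        unfolding I_def
      proof (rule integral_mono[OF integrable_mult_right[OF int_k] int_I])
        fix x
        have "exp (- \<beta> * h) * f u \<le> f (u - x)" if "0 < x" "x \<le> h"
        proof -
          have "exp (- \<beta> * h) * f u \<le> exp (- \<beta> * h) * (exp (\<beta> * x) * f (u - x))"
            using growth[of "u - x" u] that by (intro mult_left_mono) auto
          also have "\<dots> = exp (\<beta> * (x - h)) * f (u - x)"
            by (simp add: exp_add[symmetric] algebra_simps mult_exp_exp)
          also have "\<dots> \<le> 1 * f (u - x)"
            using that \<beta> by (intro mult_right_mono f_nonneg) (simp add: mult_nonneg_nonpos)
          finally show ?thesis by simp
        qed
        then show "exp (- \<beta> * h) * f u * (fejer x * indicator {0<..h} x) \<le> f (u - x) * fejer x *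
            indicator {0<..h} x"
          by (auto simp: indicator_def intro!: mult_right_mono)
      qed
      finally show ?thesis .
    qed
    have upper: "I u \<le> exp (\<beta> * h) * f (u - h) * k" for u
    proof -
      have "I u \<le> (\<integral>x. (exp (\<beta> * h) * f (u - h)) * (fejer x * indicator {0<..h} x) \<partial>lborel)"
        unfolding I_def
      proof (rule integral_mono[OF int_I integrable_mult_right[OF int_k]])
        fix x
        have "f (u - x) \<le> exp (\<beta> * h) * f (u - h)" if "0 < x" "x \<le> h"
        proof -
          have "f (u - x) \<le> exp (\<beta> * (h - x)) * f (u - h)"
            using growth[of "u - h" "u - x"] that by simp
          also have "\<dots> \<le> exp (\<beta> * h) * f (u - h)"
            using that \<beta> by (intro mult_right_mono f_nonneg) simp
          finally show ?thesis .
        qed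
        then show "f (u - x) * fejer x * indicator {0<..h} x \<le> exp (\<beta> * h) * f (u - h) * (fejer x *
            indicator {0<..h} x)"
          by (auto simp: indicator_def intro!: mult_right_mono)
      qed
      also have "\<dots> = exp (\<beta> * h) * f (u - h) * k"
        unfolding k_def by simp
      finally show ?thesis .
    qed
    have "\<forall>\<^sub>F u in at_top. I u < (a + e) * k"
      by (rule order_tendstoD(2)[OF I_lim]) (use k_pos e in simp)
    then show "\<forall>\<^sub>F u in at_top. f u < exp (\<beta> * h) * (a + e)"
    proof eventually_elim
      case (elim u)
      then have "exp (- \<beta> * h) * f u * k < (a + e) * k" using lower[of u] by simp
      then have "exp (- \<beta> * h) * f u < a + e" using k_pos by simp
      then show ?case by (simp add: exp_minus field_simps)
    qed
    \<comment> \<open>The upper estimate compares the average at u with f at u - h, so it is read at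
      the shifted point h + u.\<close>
    have "filterlim (\<lambda>u. h + u) at_top at_top" 
      by (rule filterlim_tendsto_add_at_top[OF tendsto_const filterlim_ident])
    from filterlim_compose[OF I_lim this]
    have "\<forall>\<^sub>F u in at_top. (a - e) * k < I (h + u)"
      by (rule order_tendstoD(1)) (use k_pos e in simp)
    then show "\<forall>\<^sub>F u in at_top. exp (- \<beta> * h) * (a - e) < f u"
    proof eventually_elim
      case (elim u)
      then have "(a - e) * k < exp (\<beta> * h) * f u * k" using upper[of "h + u"] by simp
      then have "a - e < exp (\<beta> * h) * f u" using k_pos by simp
      then show ?case by (simp add: exp_minus field_simps)
    qed
  qed
  have near: "\<forall>\<^sub>F x in at_right (0::real). 0 < x \<and> x < pi"
    using eventually_at_right_real[of 0 pi] by simp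
  show ?thesis
  proof (rule order_tendstoI)
    fix y assume "y < a"
    \<comment> \<open>One small number x serves both as the window length h and as the error
      e.\<close>
    have "((\<lambda>x. exp (- \<beta> * x) * (a - x)) \<longlongrightarrow> exp (- \<beta> * 0) * (a - 0)) (at_right 0)"
      by (intro tendsto_intros)
    then have "\<forall>\<^sub>F x in at_right 0. y < exp (- \<beta> * x) * (a - x)"
      by (rule order_tendstoD(1)) (use \<open>y < a\<close> in simp)
    with near have "\<exists>x. (0 < x \<and> x < pi) \<and> y < exp (- \<beta> * x) * (a - x)"
      by (intro eventually_happens'[OF _ eventually_conj]) auto
    then obtain x where "0 < x" "x < pi" "y < exp (- \<beta> * x) * (a - x)" by blast
    with main(2)[of x x] show "\<forall>\<^sub>F u in at_top. y < f u"
      by (auto elim!: eventually_mono)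
  next
    fix y assume "a < y"
    have "((\<lambda>x. exp (\<beta> * x) * (a + x)) \<longlongrightarrow> exp (\<beta> * 0) * (a + 0)) (at_right 0)"
      by (intro tendsto_intros)
    then have "\<forall>\<^sub>F x in at_right 0. exp (\<beta> * x) * (a + x) < y"
      by (rule order_tendstoD(2)) (use \<open>a < y\<close> in simp)
    with near have "\<exists>x. (0 < x \<and> x < pi) \<and> exp (\<beta> * x) * (a + x) < y"
      by (intro eventually_happens'[OF _ eventually_conj]) auto
    then obtain x where "0 < x" "x < pi" "exp (\<beta> * x) * (a + x) < y" by blast
    with main(1)[of x x] show "\<forall>\<^sub>F u in at_top. f u < y"
      by (auto elim!: eventually_mono)
  qed
qed

end

section \<open>Holomorphy of integrals depending on a parameter\<close>

text \<open>Only the functions themselves need an integrable bound: Cauchy's inequality on discs of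
  radius r / 3 turns it into a bound for the derivatives, hence for the difference quotients, and
  dominated convergence applies.\<close>

lemma has_field_derivative_integral:
  fixes g :: "complex \<Rightarrow> 'a \<Rightarrow> complex"
  assumes r: "0 < r"
    and meas: "\<And>z. z \<in> ball z0 r \<Longrightarrow> g z \<in> borel_measurable M"
    and hol: "\<And>x. x \<in> space M \<Longrightarrow> (\<lambda>z. g z x) holomorphic_on ball z0 r"
    and h: "integrable M h"
    and dom: "AE x in M. \<forall>z\<in>ball z0 r. norm (g z x) \<le> h x"
  shows "integrable M (\<lambda>x. deriv (\<lambda>z. g z x) z0)"
    and "((\<lambda>z. \<integral>x. g z x \<partial>M) has_field_derivative (\<integral>x. deriv (\<lambda>z. g z x) z0 \<partial>M)) (at z0)"
proof -
  have int_g: "integrable M (g z)" if "z \<in> ball z0 r" for z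
    by (rule Bochner_Integration.integrable_bound[OF h meas[OF that]])
       (use dom that in \<open>auto elim!: eventually_mono intro: order_trans[OF _ abs_ge_self]\<close>)
  \<comment> \<open>Increments shorter than r / 3 leave room for a Cauchy circle of radius r / 3
    around each point of the segment from z0.\<close>
  have quot: "integrable M (\<lambda>x. deriv (\<lambda>z. g z x) z0) \<and>
    (\<lambda>n. \<integral>x. (g (z0 + X n) x - g z0 x) / X n \<partial>M) \<longlonglongrightarrow> (\<integral>x. deriv (\<lambda>z. g z x) z0 \<partial>M)"
    if X: "X \<longlonglongrightarrow> 0" "\<And>n. X n \<noteq> 0" "\<And>n. norm (X n) < r / 3" for X :: "nat \<Rightarrow> complex"
  proof -
    have in_ball: "z0 + X n \<in> ball z0 r" for n using X(3)[of n] r by (simp add: dist_norm)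
    have z0: "z0 \<in> ball z0 r" using r by simp
    have lim: "(\<lambda>n. (g (z0 + X n) x - g z0 x) / X n) \<longlonglongrightarrow> deriv (\<lambda>z. g z x) z0" if "x \<in> space M" for x
    proof -
      have "((\<lambda>z. g z x) has_field_derivative deriv (\<lambda>z. g z x) z0) (at z0)"
        using hol[OF that] z0 by (rule holomorphic_derivI[OF _ open_ball])
      then have "(\<lambda>h. (g (z0 + h) x - g z0 x) / h) \<midarrow>0\<rightarrow> deriv (\<lambda>z. g z x) z0"
        by (simp add: DERIV_def)
      then show ?thesis using X unfolding tendsto_at_iff_sequentially comp_def by auto
    qed
    have meas_q: "(\<lambda>x. (g (z0 + X n) x - g z0 x) / X n) \<in> borel_measurable M" for n
      using meas[OF in_ball[of n]] meas[OF z0] by simp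
    have meas_d: "(\<lambda>x. deriv (\<lambda>z. g z x) z0) \<in> borel_measurable M"
      by (rule borel_measurable_LIMSEQ_metric[OF meas_q lim])
    have dom': "AE x in M. norm ((g (z0 + X n) x - g z0 x) / X n) \<le> 3 / r * h x" for n
      using dom AE_space
    proof eventually_elim
      case (elim x)
      have hol_x: "(\<lambda>z. g z x) holomorphic_on ball z0 r" by (rule hol[OF elim(2)])
      have "norm (g (z0 + X n) x - g z0 x) \<le> (h x / (r / 3)) * norm (z0 + X n - z0)"
      proof (rule field_differentiable_bound[where S = "ball z0 (r / 3)" and f' = "deriv (\<lambda>z. g z x)"])
        fix z assume z: "z \<in> ball z0 (r / 3)"
        have sub: "cball z (r / 3) \<subseteq> ball z0 r"
        proof
          fix w assume "w \<in> cball z (r / 3)"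
          then have "dist z0 w < r / 3 + r / 3"
            using z dist_triangle[of z0 w z] by simp
          then show "w \<in> ball z0 r" using r by simp
        qed
        then have "z \<in> ball z0 r" using r by (auto simp: subset_iff)
        then have "((\<lambda>z. g z x) has_field_derivative deriv (\<lambda>z. g z x) z) (at z)"
          by (rule holomorphic_derivI[OF hol_x open_ball])
        then show "((\<lambda>z. g z x) has_field_derivative deriv (\<lambda>z. g z x) z) (at z within ball z0 (r / 3))"
          by (rule has_field_derivative_at_within)
        have "norm ((deriv ^^ 1) (\<lambda>z. g z x) z) \<le> fact 1 * h x / (r / 3) ^ 1"
        proof (rule Cauchy_inequality)
          show "(\<lambda>z. g z x) holomorphic_on ball z (r / 3)"
            by (rule holomorphic_on_subset[OF hol_x]) (use sub ball_subset_cball in blast)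
          show "continuous_on (cball z (r / 3)) (\<lambda>z. g z x)"
            by (rule continuous_on_subset[OF holomorphic_on_imp_continuous_on[OF hol_x] sub])
          show "norm (g w x) \<le> h x" if "norm (z - w) = r / 3" for w
            using elim(1) sub that by (auto simp: subset_iff dist_norm)
        qed (use r in simp)
        then show "norm (deriv (\<lambda>z. g z x) z) \<le> h x / (r / 3)" by simp
      qed (use r X(3)[of n] in \<open>auto simp: dist_norm\<close>)
      then show ?case
        using X(2)[of n] r by (simp add: norm_divide field_simps)
    qed
    show ?thesis
    proof (intro conjI)
      show "integrable M (\<lambda>x. deriv (\<lambda>z. g z x) z0)"
        by (rule integrable_dominated_convergence[where s = "\<lambda>n x. (g (z0 + X n) x - g z0 x) / X n", OF
            meas_d meas_q _ _ dom'])
           (use h lim in auto)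
      show "(\<lambda>n. \<integral>x. (g (z0 + X n) x - g z0 x) / X n \<partial>M) \<longlonglongrightarrow> (\<integral>x. deriv (\<lambda>z. g z x) z0 \<partial>M)"
        by (rule integral_dominated_convergence[OF meas_d meas_q _ _ dom'])
           (use h lim in auto)
    qed
  qed
  \<comment> \<open>A concrete null sequence of nonzero increments, whose only purpose is to extract
    the integrability of the derivative from \<open>quot\<close>.\<close>
  have "(\<lambda>n. of_real (r / 6) * (inverse (of_nat (Suc n)) :: complex)) \<longlonglongrightarrow> of_real (r / 6) * 0"
    by (intro tendsto_mult tendsto_const LIMSEQ_Suc[OF lim_inverse_n])
  moreover have "norm (of_real (r / 6) * (inverse (of_nat (Suc n)) :: complex)) < r / 3" for n
  proof -
    have "norm (of_real (r / 6) * (inverse (of_nat (Suc n)) :: complex)) = r / 6 * inverse (real (Suc n))"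
      using r by (simp only: norm_mult norm_of_real norm_inverse norm_of_nat)
    also have "\<dots> \<le> r / 6 * 1" using r by (intro mult_left_mono) (auto simp: field_simps)
    finally show ?thesis using r by simp
  qed
  ultimately show "integrable M (\<lambda>x. deriv (\<lambda>z. g z x) z0)"
    using r by (intro quot[THEN conjunct1, of "\<lambda>n. of_real (r / 6) * inverse (of_nat (Suc n))"])
      (auto simp del: of_nat_Suc simp flip: of_nat_Suc)
  show "((\<lambda>z. \<integral>x. g z x \<partial>M) has_field_derivative (\<integral>x. deriv (\<lambda>z. g z x) z0 \<partial>M)) (at z0)"
    unfolding DERIV_def tendsto_at_iff_sequentially comp_def
  proof (intro allI impI)
    fix X :: "nat \<Rightarrow> complex"
    assume X: "\<forall>i. X i \<in> UNIV - {0}" "X \<longlonglongrightarrow> 0"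
    have "\<forall>\<^sub>F n in sequentially. dist (X n) 0 < r / 3"
      by (rule tendstoD[OF X(2)]) (use r in simp)
    then obtain N where N: "\<And>n. n \<ge> N \<Longrightarrow> norm (X n) < r / 3"
      by (auto simp: eventually_sequentially)
    have "(\<lambda>n. \<integral>x. (g (z0 + X (n + N)) x - g z0 x) / X (n + N) \<partial>M) \<longlonglongrightarrow> (\<integral>x. deriv (\<lambda>z. g z x) z0 \<partial>M)"
      by (rule quot[THEN conjunct2]) (use X N in \<open>auto intro: LIMSEQ_ignore_initial_segment\<close>)
    also have "(\<lambda>n. \<integral>x. (g (z0 + X (n + N)) x - g z0 x) / X (n + N) \<partial>M) =
       (\<lambda>n. ((\<integral>x. g (z0 + X (n + N)) x \<partial>M) - (\<integral>x. g z0 x \<partial>M)) / X (n + N))"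
    proof
      fix n
      have "z0 + X (n + N) \<in> ball z0 r" using N[of "n + N"] r by (simp add: dist_norm)
      then show "(\<integral>x. (g (z0 + X (n + N)) x - g z0 x) / X (n + N) \<partial>M) =
        ((\<integral>x. g (z0 + X (n + N)) x \<partial>M) - (\<integral>x. g z0 x \<partial>M)) / X (n + N)"
        using r by (simp add: Bochner_Integration.integral_diff int_g)
    qed
    finally show "(\<lambda>n. ((\<integral>x. g (z0 + X n) x \<partial>M) - (\<integral>x. g z0 x \<partial>M)) / X n) \<longlonglongrightarrow> (\<integral>x. deriv (\<lambda>z. g z x) z0 \<partial>M)"
      by (rule LIMSEQ_offset)
  qed
qed

section \<open>Inequalities for exponentials and powers\<close>

text \<open>Squaring the weak bound at x / 2 gains the term x^2 / 4, which makes it strict.\<close>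

lemma exp_strict_tangent:
  fixes x :: real
  assumes "x \<noteq> 0"
  shows "1 + x < exp x"
proof (cases "1 + x / 2 \<ge> 0")
  case True
  have "1 + x < (1 + x / 2)\<^sup>2" using zero_less_power2[of x] assms by (simp add: power2_eq_square
      field_simps del: zero_less_power2)
  also have "\<dots> \<le> (exp (x / 2))\<^sup>2" using True exp_ge_add_one_self[of "x / 2"] by (intro power_mono) auto
  also have "\<dots> = exp x" by (simp add: power2_eq_square mult_exp_exp)
  finally show ?thesis .
next
  case False
  then have "1 + x < 0" by simp
  then show ?thesis by (rule order_less_trans) simp
qed

text \<open>The tangent bound is applied at (1 - c) x and at - c x, whose mean with weights c and 1
  - c is 0; multiplication by exp (c x) finishes.\<close>

lemma exp_strict_convex:
  fixes x c :: real
  assumes "0 < c" "c < 1" "x \<noteq> 0"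
  shows "exp (c * x) < 1 - c + c * exp x"
proof -
  have "c * (1 + (1 - c) * x) + (1 - c) * (1 + - c * x) = 1" by (simp add: algebra_simps)
  moreover have "c * (1 + (1 - c) * x) < c * exp ((1 - c) * x)"
    using assms by (intro mult_strict_left_mono exp_strict_tangent) auto
  moreover have "(1 - c) * (1 + - c * x) \<le> (1 - c) * exp (- c * x)"
    using assms exp_ge_add_one_self[of "- c * x"] by (intro mult_left_mono) auto
  ultimately have "1 < c * exp ((1 - c) * x) + (1 - c) * exp (- c * x)" by linarith
  then have "exp (c * x) * 1 < exp (c * x) * (c * exp ((1 - c) * x) + (1 - c) * exp (- c * x))"
    by (intro mult_strict_left_mono) auto
  also have "\<dots> = c * (exp (c * x) * exp ((1 - c) * x)) + (1 - c) * (exp (c * x) * exp (- c * x))"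
    by (simp add: ring_distribs)
  also have "\<dots> = 1 - c + c * exp x"
    unfolding mult_exp_exp by (simp add: algebra_simps)
  finally show ?thesis by simp
qed

lemma exp_convex:
  fixes x c :: real
  assumes "0 < c" "c < 1"
  shows "exp (c * x) \<le> 1 - c + c * exp x"
  using exp_strict_convex[OF assms, of x] by (cases "x = 0") auto

text \<open>A symmetric bound with a fixed constant in front of both powers could destroy a
  contraction. The parameter \<kappa> shifts the loss to the q term and keeps the factor of x powr s
  as close to 1 as desired.\<close>

lemma powr_add_le:
  fixes x q s \<kappa> :: real
  assumes "0 \<le> x" "0 \<le> q" "0 < s" "0 < \<kappa>"
  shows "(x + q) powr s \<le> (1 + \<kappa>) powr s * x powr s + (1 + 1 / \<kappa>) powr s * q powr s"
proof (cases "q \<le> \<kappa> * x")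
  case True
  then have "(x + q) powr s \<le> ((1 + \<kappa>) * x) powr s"
    using assms by (intro powr_mono2) (auto simp: algebra_simps)
  also have "\<dots> = (1 + \<kappa>) powr s * x powr s" using assms by (simp add: powr_mult)
  finally show ?thesis by (simp add: add_increasing2)
next
  case False
  then have "x \<le> q / \<kappa>" using assms by (simp add: field_simps)
  then have "(x + q) powr s \<le> ((1 + 1 / \<kappa>) * q) powr s"
    using assms by (intro powr_mono2) (auto simp: algebra_simps)
  also have "\<dots> = (1 + 1 / \<kappa>) powr s * q powr s" using assms by (simp add: powr_mult)
  finally show ?thesis by (simp add: add_increasing)
qed

text \<open>Subadditivity of the power for \<beta> \<le> 1, a mean value bound for \<beta> > 1. The
  gain is that x enters the right-hand side with order \<beta> - 1 at most, although both powers on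
  the left have order \<beta>.\<close>

lemma powr_add_diff_le:
  fixes x q \<beta> :: real
  assumes "0 \<le> x" "0 < q" "0 < \<beta>"
  shows "(x + q) powr \<beta> - x powr \<beta> \<le> (if \<beta> \<le> 1 then q powr \<beta> else \<beta> * q * (x + q) powr (\<beta> - 1))"
proof (cases "\<beta> \<le> 1")
  case True
  define s where "s = x + q"
  have s: "0 < s" using assms by (simp add: s_def)
  have le: "y \<le> y powr \<beta>" if "0 \<le> y" "y \<le> 1" for y :: real
    using powr_mono'[of \<beta> 1 y] that True by (cases "y = 0") auto
  have "1 = x / s + q / s" using s by (simp add: s_def add_divide_distrib[symmetric])
  also have "\<dots> \<le> (x / s) powr \<beta> + (q / s) powr \<beta>"
    using assms s by (intro add_mono le) (auto simp: s_def)
  also have "\<dots> = (x powr \<beta> + q powr \<beta>) / s powr \<beta>"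
    using assms s by (simp add: powr_divide add_divide_distrib)
  finally have "s powr \<beta> \<le> x powr \<beta> + q powr \<beta>" using s by (simp add: field_simps)
  then show ?thesis using True by (simp add: s_def)
next
  case False
  define s where "s = x + q"
  have s: "0 < s" using assms by (simp add: s_def)
  \<comment> \<open>Bernoulli's inequality for x / s, read off from \<open>exp_convex\<close> with
    weight 1 / \<beta>.\<close>
  have "x / s \<le> 1 - 1 / \<beta> + 1 / \<beta> * (x / s) powr \<beta>"
  proof (cases "x = 0")
    case True
    then show ?thesis using False by simp
  next
    case nz: False
    then have y: "0 < x / s" using assms s by simp
    show ?thesis
      using exp_convex[of "1 / \<beta>" "\<beta> * ln (x / s)"] False y by (simp add: powr_def)
  qed
  then have "\<beta> * (x / s) \<le> \<beta> * (1 - 1 / \<beta> + 1 / \<beta> * (x / s) powr \<beta>)"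
    using assms by (intro mult_left_mono) auto
  also have "\<dots> = \<beta> - 1 + (x / s) powr \<beta>"
    using assms by (simp add: algebra_simps)
  finally have "1 - (x / s) powr \<beta> \<le> \<beta> * (1 - x / s)" by (simp add: algebra_simps)
  also have "1 - x / s = q / s" using s by (simp add: s_def field_simps)
  finally have "s powr \<beta> * (1 - (x / s) powr \<beta>) \<le> s powr \<beta> * (\<beta> * (q / s))"
    by (intro mult_left_mono) auto
  also have "s powr \<beta> * (1 - (x / s) powr \<beta>) = s powr \<beta> - x powr \<beta>"
    using assms s by (simp add: powr_divide field_simps)
  also have "s powr \<beta> * (\<beta> * (q / s)) = \<beta> * q * s powr (\<beta> - 1)"
    using s by (simp add: powr_diff)
  finally show ?thesis using False by (simp add: s_def)
qed

lemma powr_mult_le_powr_add: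
  fixes x y p q :: real
  assumes "0 \<le> x" "0 \<le> y"
  shows "x powr p * y powr q \<le> x powr (2 * p) + y powr (2 * q)"
proof -
  have "x powr p * y powr q \<le> ((x powr p)\<^sup>2 + (y powr q)\<^sup>2) / 2"
    using sum_squares_bound[of "x powr p" "y powr q"] by simp
  also have "\<dots> \<le> (x powr p)\<^sup>2 + (y powr q)\<^sup>2" by simp
  also have "\<dots> = x powr (2 * p) + y powr (2 * q)"
    by (simp add: power2_eq_square powr_add[symmetric])
  finally show ?thesis .
qed

text \<open>Meant for a small random factor r and a merely tight variable x: either x exceeds K,
  which is improbable, or a fractional power of r takes over. The split allows r and x to be
  dependent.\<close>

lemma min_1_mult_le:
  fixes x K r s :: real
  assumes "0 \<le> r" "0 \<le> x" "0 < K" "0 < s" "s \<le> 1"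
  shows "min 1 (r * x) \<le> of_bool (K < x) + K powr s * r powr s"
proof (cases "K < x")
  case False
  then have "x * r \<le> K * r" using assms by (intro mult_right_mono) auto
  then have le: "r * x \<le> K * r" by (simp add: mult.commute)
  have "min 1 y \<le> y powr s" if y: "0 \<le> y" for y :: real
  proof -
    consider "y = 0" | "0 < y" "y \<le> 1" | "1 < y" using y by linarith
    then show ?thesis
    proof cases
      case 2
      then have "y powr 1 \<le> y powr s" using assms by (intro powr_mono') auto
      then show ?thesis using 2 by simp
    next
      case 3
      then have "1 \<le> y powr s" using assms by (intro ge_one_powr_ge_zero) auto
      then show ?thesis by simp
    qed simp
  qed
  then have "min 1 (K * r) \<le> (K * r) powr s" using assms by simp
  then show ?thesis using le False assms by (simp add: powr_mult)
next
  case True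
  have "0 \<le> K powr s * r powr s" by simp
  then show ?thesis using True by (auto simp: min_le_iff_disj)
qed

text \<open>Provides the \<kappa> with which \<open>powr_add_le\<close> preserves a contraction
  factor below 1.\<close>

lemma inflation_factor:
  fixes \<rho> s :: real
  assumes "\<rho> < 1"
  obtains \<kappa> where "0 < \<kappa>" "(1 + \<kappa>) powr s * \<rho> < 1"
proof -
  have "((\<lambda>\<kappa>. (1 + \<kappa>) powr s * \<rho>) \<longlongrightarrow> (1 + 0) powr s * \<rho>) (at_right 0)"
    by (intro tendsto_intros) auto
  then have "\<forall>\<^sub>F \<kappa> in at_right 0. (1 + \<kappa>) powr s * \<rho> < 1"
    by (rule order_tendstoD(2)) (use assms in simp)
  moreover have "\<forall>\<^sub>F \<kappa> in at_right (0::real). 0 < \<kappa>" by (rule eventually_at_right_less)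
  ultimately have "\<exists>\<kappa>. 0 < \<kappa> \<and> (1 + \<kappa>) powr s * \<rho> < 1"
    by (intro eventually_happens'[OF _ eventually_conj]) auto
  then show thesis using that by blast
qed

text \<open>The difference is the integral of z exp (z t) over [u, v], and the modulus of the
  integrand is norm z * exp (Re z * t). Complex differences are thus controlled by real ones without
  separating the two exponentials.\<close>

lemma norm_exp_diff_le:
  fixes z :: complex and u v :: real
  assumes "0 < Re z" "u \<le> v"
  shows "norm (exp (z * v) - exp (z * u)) \<le> norm z / Re z * (exp (Re z * v) - exp (Re z * u))"
proof (cases "u = v")
  case False
  have "norm (exp (z * v) - exp (z * u)) \<le> norm z / Re z * exp (Re z * v) - norm z / Re z * exp (Re z * u)"
  proof (rule differentiable_bound_general[where f' = "\<lambda>t. z * exp (z * of_real t)" and \<phi>' = "\<lambda>t. norm z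
      * exp (Re z * t)"])
    show "((\<lambda>t. exp (z * of_real t)) has_vector_derivative z * exp (z * of_real x)) (at x)" for x
      by (rule has_vector_derivative_real_field) (auto intro!: derivative_eq_intros)
    show "((\<lambda>t. norm z / Re z * exp (Re z * t)) has_vector_derivative norm z * exp (Re z * x)) (at x)" for x
      unfolding has_real_derivative_iff_has_vector_derivative[symmetric]
      using assms by (auto intro!: derivative_eq_intros)
  qed (use False assms in \<open>auto intro!: continuous_intros simp: norm_mult\<close>)
  then show ?thesis by (simp add: right_diff_distrib)
qed simp

text \<open>Dominates the differences of all smaller exponents by the single one at \<beta>. The
  summand 1 pays for negative arguments, where lowering the exponent makes an exponential
  larger.\<close>

lemma exp_diff_mono_exponent:
  fixes s \<beta> u v :: real
  assumes "0 < s" "s \<le> \<beta>" "u \<le> v"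
  shows "exp (s * v) - exp (s * u) \<le> 1 + (exp (\<beta> * v) - exp (\<beta> * u))"
proof -
  consider "v \<le> 0" | "0 \<le> u" | "u \<le> 0" "0 \<le> v" by linarith
  then show ?thesis
  proof cases
    case 1
    then have "exp (s * v) \<le> 1" using assms by (simp add: mult_nonneg_nonpos)
    moreover have "exp (\<beta> * u) \<le> exp (\<beta> * v)" using assms by simp
    moreover have "0 < exp (s * u)" by simp
    ultimately show ?thesis by linarith
  next
    case 2
    have "exp (s * v) - exp (s * u) = exp (s * u) * (exp (s * (v - u)) - 1)"
      by (simp add: right_diff_distrib mult_exp_exp)
    also have "\<dots> \<le> exp (\<beta> * u) * (exp (\<beta> * (v - u)) - 1)"
      using assms 2 by (intro mult_mono) (auto intro: mult_right_mono)
    also have "\<dots> = exp (\<beta> * v) - exp (\<beta> * u)"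
      by (simp add: right_diff_distrib mult_exp_exp)
    finally show ?thesis by simp
  next
    case 3
    then have "exp (s * v) \<le> exp (\<beta> * v)" "exp (\<beta> * u) \<le> 1"
      using assms by (auto intro: mult_right_mono simp: mult_nonneg_nonpos)
    moreover have "0 < exp (s * u)" by simp
    ultimately show ?thesis by linarith
  qed
qed

section \<open>Integrability, Fatou bounds and strict inequalities between means\<close>

lemma nn_finite_if_integrable:
  fixes f :: "'a \<Rightarrow> real"
  assumes "integrable M f" "\<And>\<omega>. 0 \<le> f \<omega>"
  shows "(\<integral>\<^sup>+\<omega>. ennreal (f \<omega>) \<partial>M) < \<infinity>"
  using assms by (subst nn_integral_eq_integral) auto

lemma integrable_if_nn_finite:
  fixes f :: "'a \<Rightarrow> real"
  assumes "f \<in> borel_measurable M" "\<And>\<omega>. 0 \<le> f \<omega>" "(\<integral>\<^sup>+\<omega>. ennreal (f \<omega>) \<partial>M) \<le> ennreal B"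
  shows "integrable M f"
  using assms by (intro integrableI_bounded) (auto intro: le_less_trans)

lemma (in finite_measure) integrable_powr_smaller:
  fixes g :: "'a \<Rightarrow> real"
  assumes [measurable]: "g \<in> borel_measurable M" and "integrable M (\<lambda>\<omega>. \<bar>g \<omega>\<bar> powr t)" and "0 \<le> s" "s \<le> t"
  shows "integrable M (\<lambda>\<omega>. \<bar>g \<omega>\<bar> powr s)"
proof (rule Bochner_Integration.integrable_bound[of _ "\<lambda>\<omega>. 1 + \<bar>g \<omega>\<bar> powr t"])
  show "AE \<omega> in M. norm (\<bar>g \<omega>\<bar> powr s) \<le> norm (1 + \<bar>g \<omega>\<bar> powr t)"
  proof (rule AE_I2)
    fix \<omega>
    have "\<bar>g \<omega>\<bar> powr s \<le> 1 + \<bar>g \<omega>\<bar> powr t"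
    proof (cases "\<bar>g \<omega>\<bar> \<le> 1")
      case True
      then have "\<bar>g \<omega>\<bar> powr s \<le> 1" using assms(3) by (intro powr_le1) auto
      then show ?thesis by (simp add: add_increasing2)
    next
      case False
      then have "\<bar>g \<omega>\<bar> powr s \<le> \<bar>g \<omega>\<bar> powr t" using assms(4) by (intro powr_mono) auto
      then show ?thesis by simp
    qed
    then show "norm (\<bar>g \<omega>\<bar> powr s) \<le> norm (1 + \<bar>g \<omega>\<bar> powr t)" by simp
  qed
qed (use assms(2) in auto)

text \<open>Fatou's lemma, in the form that carries uniform moment bounds from the iterates to their
  limit.\<close>

lemma nn_integral_le_of_tendsto:
  fixes f :: "nat \<Rightarrow> 'a \<Rightarrow> real"
  assumes [measurable]: "\<And>k. f k \<in> borel_measurable M"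
    and lim: "AE \<omega> in M. (\<lambda>k. f k \<omega>) \<longlonglongrightarrow> g \<omega>"
    and B: "\<And>k. (\<integral>\<^sup>+\<omega>. ennreal (f k \<omega>) \<partial>M) \<le> ennreal B"
  shows "(\<integral>\<^sup>+\<omega>. ennreal (g \<omega>) \<partial>M) \<le> ennreal B"
proof -
  have "(\<integral>\<^sup>+\<omega>. ennreal (g \<omega>) \<partial>M) = (\<integral>\<^sup>+\<omega>. liminf (\<lambda>k. ennreal (f k \<omega>)) \<partial>M)"
  proof (rule nn_integral_cong_AE)
    show "AE \<omega> in M. ennreal (g \<omega>) = liminf (\<lambda>k. ennreal (f k \<omega>))"
      using lim
    proof eventually_elim
      case (elim \<omega>)
      from lim_imp_Liminf[OF sequentially_bot tendsto_ennrealI[OF elim]] show ?case by simp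
    qed
  qed
  also have "\<dots> \<le> liminf (\<lambda>k. \<integral>\<^sup>+\<omega>. ennreal (f k \<omega>) \<partial>M)"
    by (rule nn_integral_liminf) simp
  also have "\<dots> \<le> ennreal B"
    by (rule Liminf_le, simp, intro always_eventually allI B)
  finally show ?thesis .
qed

lemma (in prob_space) indep_var_nn_integral:
  fixes U V :: "'a \<Rightarrow> ennreal"
  assumes "indep_var borel U borel V"
  shows "(\<integral>\<^sup>+\<omega>. U \<omega> * V \<omega> \<partial>M) = (\<integral>\<^sup>+\<omega>. U \<omega> \<partial>M) * (\<integral>\<^sup>+\<omega>. V \<omega> \<partial>M)"
proof -
  have **: "(\<lambda>_. borel) = case_bool borel borel"
    by (rule ext) (simp split: bool.split)
  have ind: "indep_vars (\<lambda>_. borel) (case_bool U V) UNIV"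
    using assms unfolding indep_var_def by (subst **)
  have "(\<integral>\<^sup>+\<omega>. (\<Prod>i\<in>UNIV. case_bool U V i \<omega>) \<partial>M) = (\<Prod>i\<in>UNIV. \<integral>\<^sup>+\<omega>. case_bool U V i \<omega> \<partial>M)"
    by (rule indep_vars_nn_integral[OF _ ind]) simp_all
  then show ?thesis by (simp add: UNIV_bool mult.commute)
qed

text \<open>Turns a pointwise inequality that is strict except where U = 0 into a strict inequality
  of means. It is used for convexity gaps and for the square in the Cauchy-Schwarz argument.\<close>

lemma (in prob_space) expectation_pos_off_zero:
  fixes g :: "'a \<Rightarrow> real"
  assumes "integrable M g" "\<not> (AE \<omega> in M. U \<omega> = 0)"
    and "\<And>\<omega>. U \<omega> \<noteq> 0 \<Longrightarrow> 0 < g \<omega>" "\<And>\<omega>. U \<omega> = 0 \<Longrightarrow> g \<omega> = 0"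
  shows "0 < expectation g"
proof -
  have nn: "0 \<le> g \<omega>" for \<omega> using assms(3,4)[of \<omega>] by (cases "U \<omega> = 0") auto
  have "expectation g \<noteq> 0"
  proof
    assume "expectation g = 0"
    then have "AE \<omega> in M. g \<omega> = 0"
      using integral_nonneg_eq_0_iff_AE[OF assms(1)] nn by simp
    then have "AE \<omega> in M. U \<omega> = 0" by eventually_elim (use assms(3) in force)
    then show False using assms(2) by simp
  qed
  moreover have "0 \<le> expectation g" using nn by simp
  ultimately show ?thesis by simp
qed

text \<open>Strict convexity of the moment generating function, which equals 1 at 0 and at \<alpha>
  and therefore lies below 1 in between.\<close>

lemma (in prob_space) expectation_exp_less_1:
  fixes U :: "'a \<Rightarrow> real"
  assumes [measurable]: "U \<in> borel_measurable M"
    and U: "has_bochner_integral M (\<lambda>\<omega>. exp (\<alpha> * U \<omega>)) 1" "\<not> (AE \<omega> in M. U \<omega> = 0)"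
    and s: "0 < s" "s < \<alpha>"
  shows "integrable M (\<lambda>\<omega>. exp (s * U \<omega>))" and "expectation (\<lambda>\<omega>. exp (s * U \<omega>)) < 1"
proof -
  define c where "c = s / \<alpha>"
  have c: "0 < c" "c < 1" using s by (auto simp: c_def)
  have c_eq: "c * (\<alpha> * x) = s * x" for x using s by (simp add: c_def)
  have int: "integrable M (\<lambda>\<omega>. exp (\<alpha> * U \<omega>))" using U(1) by (simp add: has_bochner_integral_iff)
  then have int': "integrable M (\<lambda>\<omega>. 1 - c + c * exp (\<alpha> * U \<omega>))" by simp
  show int_s: "integrable M (\<lambda>\<omega>. exp (s * U \<omega>))"
  proof (rule Bochner_Integration.integrable_bound[OF int'])
    show "AE \<omega> in M. norm (exp (s * U \<omega>)) \<le> norm (1 - c + c * exp (\<alpha> * U \<omega>))"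
    proof (rule AE_I2)
      fix \<omega>
      show "norm (exp (s * U \<omega>)) \<le> norm (1 - c + c * exp (\<alpha> * U \<omega>))"
        using exp_convex[OF c, of "\<alpha> * U \<omega>"] unfolding c_eq by (simp add: abs_le_iff)
    qed
  qed simp
  have "0 < expectation (\<lambda>\<omega>. 1 - c + c * exp (\<alpha> * U \<omega>) - exp (s * U \<omega>))"
  proof (rule expectation_pos_off_zero[OF _ U(2)])
    fix \<omega> assume "U \<omega> \<noteq> 0"
    then show "0 < 1 - c + c * exp (\<alpha> * U \<omega>) - exp (s * U \<omega>)"
      using exp_strict_convex[OF c, of "\<alpha> * U \<omega>"] s unfolding c_eq by simp
  qed (use int' int_s in auto)
  also have "\<dots> = 1 - c + c * 1 - expectation (\<lambda>\<omega>. exp (s * U \<omega>))"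
    using int int_s U(1) by (simp add: has_bochner_integral_iff prob_space)
  finally show "expectation (\<lambda>\<omega>. exp (s * U \<omega>)) < 1" by simp
qed

section \<open>Implicit renewal\<close>

text \<open>The one-dimensional equation in logarithms: U, V and W stand for the logarithms of A, Y
  and A Y + Q. Positivity of Q becomes \<open>less\<close>, stationarity becomes
  \<open>same_law\<close>. Moments of V are available only below \<alpha>, while
  \<open>diff_\<beta>\<close> reaches beyond it; this gap is what places the pole at
  \<alpha>.\<close>

locale additive_renewal = prob_space +
  fixes U V W :: "'a \<Rightarrow> real" and \<alpha> \<beta> :: real
  assumes U_rv [measurable]: "U \<in> borel_measurable M"
    and V_rv [measurable]: "V \<in> borel_measurable M"
    and W_rv [measurable]: "W \<in> borel_measurable M"
    and indep: "indep_var borel U borel V"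
    and same_law: "distr M borel W = distr M borel V"
    and less: "AE \<omega> in M. U \<omega> + V \<omega> < W \<omega>"
    and \<alpha>_pos: "0 < \<alpha>" and \<alpha>_less_\<beta>: "\<alpha> < \<beta>"
    and U_\<alpha>: "has_bochner_integral M (\<lambda>\<omega>. exp (\<alpha> * U \<omega>)) 1"
    and U_\<beta>: "integrable M (\<lambda>\<omega>. exp (\<beta> * U \<omega>))"
    and diff_\<beta>: "integrable M (\<lambda>\<omega>. exp (\<beta> * W \<omega>) - exp (\<beta> * (U \<omega> + V \<omega>)))"
    and V_moment: "\<And>s. 0 < s \<Longrightarrow> s < \<alpha> \<Longrightarrow> integrable M (\<lambda>\<omega>. exp (s * V \<omega>))"
    and nonlattice: "\<And>h. 0 < h \<Longrightarrow> \<not> (AE \<omega> in M. U \<omega> \<in> range (\<lambda>k::int. h * of_int k))"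
begin

text \<open>In terms of the overview, \<phi> z is E A^z, \<psi> z is the right-hand side of the
  Mellin identity and \<eta> z is E X^z. The first two are analytic on the whole
  \<open>strip\<close>, the last one is controlled for Re z < \<alpha> only.\<close>

definition \<phi> :: "complex \<Rightarrow> complex" where "\<phi> z = expectation (\<lambda>\<omega>. exp (z * U \<omega>))"
definition \<psi> :: "complex \<Rightarrow> complex" where "\<psi> z = expectation (\<lambda>\<omega>. exp (z * W \<omega>) - exp (z * (U \<omega> + V \<omega>)))"
definition \<eta> :: "complex \<Rightarrow> complex" where "\<eta> z = expectation (\<lambda>\<omega>. exp (z * V \<omega>))"
definition strip :: "complex set" where "strip = {z. 0 < Re z \<and> Re z < \<beta>}"

section \<open>Analytic properties of the transforms\<close>

lemma open_strip: "open strip"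
  unfolding strip_def by (intro open_Collect_conj open_halfspace_Re_gt open_halfspace_Re_lt)

lemma not_AE_U_0: "\<not> (AE \<omega> in M. U \<omega> = 0)"
proof
  assume "AE \<omega> in M. U \<omega> = 0"
  then have "AE \<omega> in M. U \<omega> \<in> range (\<lambda>k::int. 1 * of_int k)"
    by eventually_elim (auto intro!: image_eqI[of _ _ 0])
  with nonlattice[of 1] show False by simp
qed

lemma integrable_exp_U: "integrable M (\<lambda>\<omega>. exp (s * U \<omega>))" if "0 \<le> s" "s \<le> \<beta>"
proof (rule Bochner_Integration.integrable_bound[OF Bochner_Integration.integrable_add[OF
    integrable_const[of 1] U_\<beta>]])
  show "AE \<omega> in M. norm (exp (s * U \<omega>)) \<le> norm (1 + exp (\<beta> * U \<omega>))"
  proof (rule AE_I2)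
    fix \<omega>
    have "exp (s * U \<omega>) \<le> 1 + exp (\<beta> * U \<omega>)"
    proof (cases "0 \<le> U \<omega>")
      case True
      then have "exp (s * U \<omega>) \<le> exp (\<beta> * U \<omega>)" using that by (simp add: mult_right_mono)
      then show ?thesis by linarith
    next
      case False
      then have "exp (s * U \<omega>) \<le> 1" using that by (simp add: mult_nonneg_nonpos)
      then show ?thesis using exp_ge_zero[of "\<beta> * U \<omega>"] by linarith
    qed
    then show "norm (exp (s * U \<omega>)) \<le> norm (1 + exp (\<beta> * U \<omega>))" by (simp add: add_pos_pos less_imp_le)
  qed
qed simp

lemma integrable_cexp_U: "integrable M (\<lambda>\<omega>. exp (z * of_real (U \<omega>)))" if "0 \<le> Re z" "Re z \<le> \<beta>"
  by (rule Bochner_Integration.integrable_bound[OF integrable_exp_U[OF that]]) auto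

lemma integrable_cexp_V: "integrable M (\<lambda>\<omega>. exp (z * of_real (V \<omega>)))" if "0 < Re z" "Re z < \<alpha>"
  by (rule Bochner_Integration.integrable_bound[OF V_moment[OF that]]) auto

lemma norm_\<phi>_less_1:
  assumes "0 < Re z" "Re z < \<alpha>"
  shows "norm (\<phi> z) < 1"
proof -
  have "norm (\<phi> z) \<le> expectation (\<lambda>\<omega>. norm (exp (z * U \<omega>)))"
    unfolding \<phi>_def by (rule integral_norm_bound)
  also have "\<dots> = expectation (\<lambda>\<omega>. exp (Re z * U \<omega>))" by simp
  also have "\<dots> < 1"
    by (rule expectation_exp_less_1(2)[OF U_rv U_\<alpha> not_AE_U_0 assms])
  finally show ?thesis .
qed

lemma \<phi>_\<alpha>: "\<phi> (of_real \<alpha>) = 1"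
proof -
  have "\<phi> (of_real \<alpha>) = expectation (\<lambda>\<omega>. complex_of_real (exp (\<alpha> * U \<omega>)))"
    by (simp add: \<phi>_def exp_of_real[symmetric])
  also have "\<dots> = 1"
    using U_\<alpha> by (simp only: integral_complex_of_real) (simp add: has_bochner_integral_iff)
  finally show ?thesis .
qed

text \<open>The equality case of |\<phi> z| \<le> \<phi> \<alpha> = 1: a value 1 forces cos
  (\<theta> U) = 1 almost surely, which confines U to the lattice of span 2 pi / |\<theta>|.\<close>

lemma \<phi>_neq_1:
  assumes "Re z = \<alpha>" "z \<noteq> of_real \<alpha>"
  shows "\<phi> z \<noteq> 1"
proof
  assume "\<phi> z = 1"
  define \<theta> where "\<theta> = Im z"
  have \<theta>: "\<theta> \<noteq> 0" using assms by (auto simp: \<theta>_def complex_eq_iff)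
  have int: "integrable M (\<lambda>\<omega>. exp (\<alpha> * U \<omega>))" using U_\<alpha> by (simp add: has_bochner_integral_iff)
  have int_c: "integrable M (\<lambda>\<omega>. exp (\<alpha> * U \<omega>) * cos (\<theta> * U \<omega>))"
    by (rule Bochner_Integration.integrable_bound[OF int]) (auto simp: abs_mult mult_left_le)
  have "1 = Re (\<phi> z)" using \<open>\<phi> z = 1\<close> by simp
  also have "\<dots> = expectation (\<lambda>\<omega>. exp (\<alpha> * U \<omega>) * cos (\<theta> * U \<omega>))"
    unfolding \<phi>_def using integrable_cexp_U[of z] assms \<alpha>_pos \<alpha>_less_\<beta>
    by (subst integral_Re[symmetric]) (auto simp: Re_exp \<theta>_def)
  finally have "expectation (\<lambda>\<omega>. exp (\<alpha> * U \<omega>) - exp (\<alpha> * U \<omega>) * cos (\<theta> * U \<omega>)) = 0"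
    using U_\<alpha> int int_c by (simp add: has_bochner_integral_iff)
  then have "AE \<omega> in M. exp (\<alpha> * U \<omega>) - exp (\<alpha> * U \<omega>) * cos (\<theta> * U \<omega>) = 0"
    by (subst (asm) integral_nonneg_eq_0_iff_AE) (auto intro!: int int_c simp: mult_left_le)
  then have "AE \<omega> in M. U \<omega> \<in> range (\<lambda>k::int. (2 * pi / \<bar>\<theta>\<bar>) * of_int k)"
  proof eventually_elim
    case (elim \<omega>)
    then have "cos (\<theta> * U \<omega>) = 1" by simp
    then obtain k :: int where k: "\<theta> * U \<omega> = of_int k * 2 * pi"
      using cos_one_2pi_int[of "\<theta> * U \<omega>"] by auto
    show ?case
    proof (cases "0 < \<theta>")
      case True
      then show ?thesis using k by (intro image_eqI[of _ _ k]) (auto simp: field_simps)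
    next
      case False
      then show ?thesis using k \<theta> by (intro image_eqI[of _ _ "- k"]) (auto simp: field_simps)
    qed
  qed
  moreover have "0 < 2 * pi / \<bar>\<theta>\<bar>" using \<theta> by simp
  ultimately show False using nonlattice by blast
qed

text \<open>The bound on r keeps Re z away from 0 on the ball, since \<open>norm_exp_diff_le\<close>
  divides by it.\<close>

lemma strip_ball:
  assumes "z0 \<in> strip"
  obtains r where "0 < r" "ball z0 r \<subseteq> strip" "r \<le> Re z0 / 2"
proof -
  obtain r where r: "0 < r" "ball z0 r \<subseteq> strip"
    using open_strip assms by (auto simp: open_contains_ball)
  show thesis
    by (rule that[of "min r (Re z0 / 2)"]) (use r assms in \<open>auto simp: strip_def subset_iff\<close>)
qed

lemma \<phi>_has_derivative:
  fixes z0 :: complex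
  assumes "z0 \<in> strip"
  shows "integrable M (\<lambda>\<omega>. U \<omega> * exp (z0 * U \<omega>))"
    and "(\<phi> has_field_derivative expectation (\<lambda>\<omega>. U \<omega> * exp (z0 * U \<omega>))) (at z0)"
proof -
  obtain r where r: "0 < r" "ball z0 r \<subseteq> strip" "r \<le> Re z0 / 2" using strip_ball[OF assms] .
  have d: "deriv (\<lambda>z. exp (z * of_real (U \<omega>))) z0 = U \<omega> * exp (z0 * U \<omega>)" for \<omega>
    by (rule DERIV_imp_deriv) (auto intro!: derivative_eq_intros)
  have int: "integrable M (\<lambda>\<omega>. 1 + exp (\<beta> * U \<omega>))" using U_\<beta> by simp
  have dom: "AE \<omega> in M. \<forall>z\<in>ball z0 r. norm (exp (z * complex_of_real (U \<omega>))) \<le> 1 + exp (\<beta> * U \<omega>)"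
  proof (intro AE_I2 ballI)
    fix \<omega> z assume "z \<in> ball z0 r"
    then have z: "0 < Re z" "Re z < \<beta>" using r by (auto simp: strip_def)
    have eq: "norm (exp (z * complex_of_real (U \<omega>))) = exp (Re z * U \<omega>)" by simp
    show "norm (exp (z * of_real (U \<omega>))) \<le> 1 + exp (\<beta> * U \<omega>)"
    proof (cases "0 \<le> U \<omega>")
      case True
      then have "Re z * U \<omega> \<le> \<beta> * U \<omega>" using z by (intro mult_right_mono) auto
      then have "exp (Re z * U \<omega>) \<le> exp (\<beta> * U \<omega>)" by (simp only: exp_le_cancel_iff)
      then show ?thesis unfolding eq by linarith
    next
      case False
      then have "exp (Re z * U \<omega>) \<le> 1" using z by (simp add: mult_nonneg_nonpos)
      then show ?thesis using exp_ge_zero[of "\<beta> * U \<omega>"] unfolding eq by linarith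
    qed
  qed
  have "(\<lambda>z. exp (z * complex_of_real (U \<omega>))) holomorphic_on ball z0 r" for \<omega>
    by (intro holomorphic_intros)
  note D = has_field_derivative_integral[OF r(1) _ this int dom, unfolded d]
  show "integrable M (\<lambda>\<omega>. U \<omega> * exp (z0 * U \<omega>))" by (rule D(1)) simp
  show "(\<phi> has_field_derivative expectation (\<lambda>\<omega>. U \<omega> * exp (z0 * U \<omega>))) (at z0)"
    unfolding \<phi>_def by (rule D(2)) simp
qed

text \<open>For Re z \<ge> \<alpha> the two exponentials need not be integrable one by one, so the
  dominating function is built from their difference at the exponent \<beta>.\<close>

lemma \<psi>_differentiable:
  assumes "z0 \<in> strip"
  shows "\<psi> field_differentiable (at z0)"
proof -
  obtain r where r: "0 < r" "ball z0 r \<subseteq> strip" "r \<le> Re z0 / 2" using strip_ball[OF assms] .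
  \<comment> \<open>An upper bound of norm z / Re z on the ball.\<close>
  define C where "C = (norm z0 + r) / (Re z0 / 2)"
  have Re0: "0 < Re z0" using assms by (simp add: strip_def)
  define h where "h \<omega> = C * (1 + (exp (\<beta> * W \<omega>) - exp (\<beta> * (U \<omega> + V \<omega>))))" for \<omega>
  have int: "integrable M h" unfolding h_def using diff_\<beta> by auto
  have dom: "AE \<omega> in M. \<forall>z\<in>ball z0 r. norm (exp (z * of_real (W \<omega>)) - exp (z * (of_real (U \<omega>) + of_real
      (V \<omega>)))) \<le> h \<omega>"
    using less
  proof eventually_elim
    case (elim \<omega>)
    show ?case
    proof
      fix z assume z: "z \<in> ball z0 r"
      then have "0 < Re z" "Re z < \<beta>" using r by (auto simp: strip_def)
      have "\<bar>Re (z0 - z)\<bar> \<le> norm (z0 - z)" by (rule abs_Re_le_cmod)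
      then have Rez: "Re z0 / 2 \<le> Re z" using z r(3) by (simp add: dist_norm)
      have "norm z \<le> norm z0 + r"
        using z norm_triangle_ineq2[of z z0] by (simp add: dist_norm norm_minus_commute)
      then have C: "norm z / Re z \<le> C"
        unfolding C_def using Rez Re0 r(1) by (intro frac_le) auto
      have "norm (exp (z * of_real (W \<omega>)) - exp (z * of_real (U \<omega> + V \<omega>))) \<le>
         norm z / Re z * (exp (Re z * W \<omega>) - exp (Re z * (U \<omega> + V \<omega>)))"
        by (rule norm_exp_diff_le) (use \<open>0 < Re z\<close> elim in auto)
      also have "\<dots> \<le> norm z / Re z * (1 + (exp (\<beta> * W \<omega>) - exp (\<beta> * (U \<omega> + V \<omega>))))"
        using \<open>0 < Re z\<close> \<open>Re z < \<beta>\<close> elim by (intro mult_left_mono exp_diff_mono_exponent) auto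
      also have "\<dots> \<le> h \<omega>"
        unfolding h_def using elim \<alpha>_pos \<alpha>_less_\<beta> by (intro mult_right_mono C) (auto simp:
            add_nonneg_nonneg)
      finally show "norm (exp (z * of_real (W \<omega>)) - exp (z * (of_real (U \<omega>) + of_real (V \<omega>)))) \<le> h \<omega>" by
          simp
    qed
  qed
  have "(\<lambda>z. exp (z * complex_of_real (W \<omega>)) - exp (z * (of_real (U \<omega>) + of_real (V \<omega>)))) holomorphic_on
      ball z0 r" for \<omega>
    by (intro holomorphic_intros)
  note D = has_field_derivative_integral(2)[OF r(1) _ this int dom]
  then show ?thesis unfolding \<psi>_def field_differentiable_def by (intro exI) (simp)
qed

lemma \<phi>_holomorphic: "\<phi> holomorphic_on strip"
  using \<phi>_has_derivative(2) open_strip by (auto simp: holomorphic_on_open)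

lemma \<psi>_holomorphic: "\<psi> holomorphic_on strip"
  using \<psi>_differentiable by (auto simp: holomorphic_on_def intro: field_differentiable_at_within)

text \<open>x e^x - e^x + 1 is positive for x \<noteq> 0. Taken at x = \<alpha> U, the mean of the
  last two terms cancels and \<alpha> times the derivative is left. Its positivity makes the zero of
  1 - \<phi> at \<alpha> simple.\<close>

lemma \<phi>_deriv_pos:
  obtains m where "0 < m" "deriv \<phi> (of_real \<alpha>) = of_real m"
proof -
  have \<alpha>: "of_real \<alpha> \<in> strip" using \<alpha>_pos \<alpha>_less_\<beta> by (simp add: strip_def)
  define m where "m = expectation (\<lambda>\<omega>. U \<omega> * exp (\<alpha> * U \<omega>))"
  have eq: "U \<omega> * exp (of_real \<alpha> * complex_of_real (U \<omega>)) = of_real (U \<omega> * exp (\<alpha> * U \<omega>))" for \<omega>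
    by (simp add: exp_of_real[symmetric])
  have "integrable M (\<lambda>\<omega>. complex_of_real (U \<omega> * exp (\<alpha> * U \<omega>)))"
    using \<phi>_has_derivative(1)[OF \<alpha>] by (simp only: eq)
  then have int: "integrable M (\<lambda>\<omega>. U \<omega> * exp (\<alpha> * U \<omega>))"
    by (simp only: complex_of_real_integrable_eq)
  have "deriv \<phi> (of_real \<alpha>) = expectation (\<lambda>\<omega>. complex_of_real (U \<omega> * exp (\<alpha> * U \<omega>)))"
    using DERIV_imp_deriv[OF \<phi>_has_derivative(2)[OF \<alpha>]] by (simp only: eq)
  also have "\<dots> = of_real m" by (simp only: integral_complex_of_real m_def)
  finally have d: "deriv \<phi> (of_real \<alpha>) = of_real m" .
  have "0 < expectation (\<lambda>\<omega>. \<alpha> * (U \<omega> * exp (\<alpha> * U \<omega>)) - exp (\<alpha> * U \<omega>) + 1)"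
  proof (rule expectation_pos_off_zero[OF _ not_AE_U_0])
    fix \<omega> assume "U \<omega> \<noteq> 0"
    then have "exp (\<alpha> * U \<omega>) * (1 + - (\<alpha> * U \<omega>)) < exp (\<alpha> * U \<omega>) * exp (- (\<alpha> * U \<omega>))"
      using \<alpha>_pos by (intro mult_strict_left_mono exp_strict_tangent) auto
    also have "\<dots> = 1" by (simp add: mult_exp_exp)
    finally show "0 < \<alpha> * (U \<omega> * exp (\<alpha> * U \<omega>)) - exp (\<alpha> * U \<omega>) + 1" by (simp add: algebra_simps)
  qed (use int U_\<alpha> in \<open>auto simp: has_bochner_integral_iff\<close>)
  also have "\<dots> = \<alpha> * m"
    using int U_\<alpha> by (simp add: has_bochner_integral_iff m_def prob_space)
  finally have "0 < m" using \<alpha>_pos by (simp add: zero_less_mult_iff)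
  then show thesis using d by (rule that)
qed

section \<open>The functional equation and its right-hand side at the critical point\<close>

lemma \<eta>_W: "\<eta> z = expectation (\<lambda>\<omega>. exp (z * W \<omega>))"
proof -
  have "\<eta> z = integral\<^sup>L (distr M borel V) (\<lambda>x. exp (z * of_real x))"
    unfolding \<eta>_def by (subst integral_distr) auto
  also have "\<dots> = integral\<^sup>L (distr M borel W) (\<lambda>x. exp (z * of_real x))"
    by (simp only: same_law)
  also have "\<dots> = expectation (\<lambda>\<omega>. exp (z * W \<omega>))"
    by (subst integral_distr) auto
  finally show ?thesis .
qed

lemma W_moment: "integrable M (\<lambda>\<omega>. exp (s * W \<omega>))" if "0 < s" "s < \<alpha>"
proof -
  have "integrable (distr M borel V) (\<lambda>x. exp (s * x))"
    using V_moment[OF that] by (subst integrable_distr_eq) auto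
  then have "integrable (distr M borel W) (\<lambda>x. exp (s * x))" by (simp only: same_law)
  then show ?thesis by (subst (asm) integrable_distr_eq) auto
qed

text \<open>Equality in law turns the term with W into \<eta> z, and independence factors the term
  with U + V as \<phi> z times \<eta> z. The terms are integrable on their own only to the left of
  \<alpha>.\<close>

lemma renewal_equation:
  assumes "0 < Re z" "Re z < \<alpha>"
  shows "\<eta> z * (1 - \<phi> z) = \<psi> z"
proof -
  have U: "integrable M (\<lambda>\<omega>. exp (z * of_real (U \<omega>)))"
    by (rule integrable_cexp_U) (use assms \<alpha>_less_\<beta> in auto)
  have V: "integrable M (\<lambda>\<omega>. exp (z * of_real (V \<omega>)))"
    by (rule integrable_cexp_V[OF assms])
  have W: "integrable M (\<lambda>\<omega>. exp (z * of_real (W \<omega>)))"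
    by (rule Bochner_Integration.integrable_bound[OF W_moment[OF assms]]) auto
  have ind: "indep_var borel (\<lambda>\<omega>. exp (z * of_real (U \<omega>))) borel (\<lambda>\<omega>. exp (z * of_real (V \<omega>)))"
    using indep_var_compose[OF indep, of "\<lambda>x. exp (z * of_real x)" borel "\<lambda>x. exp (z * of_real x)" borel]
    by (simp add: comp_def)
  have UV: "integrable M (\<lambda>\<omega>. exp (z * of_real (U \<omega>)) * exp (z * of_real (V \<omega>)))"
    by (rule indep_var_integrable[OF ind U V])
  have "\<psi> z = expectation (\<lambda>\<omega>. exp (z * of_real (W \<omega>)) - exp (z * of_real (U \<omega>)) * exp (z * of_real (V \<omega>)))"
    unfolding \<psi>_def by (simp add: ring_distribs exp_add)
  also have "\<dots> = \<eta> z - \<phi> z * \<eta> z"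
    using W UV indep_var_lebesgue_integral[OF ind U V] unfolding \<eta>_W[of z]
    by (simp add: \<eta>_W[symmetric]) (simp add: \<phi>_def \<eta>_def)
  finally show ?thesis by (simp add: algebra_simps)
qed

text \<open>The strict inequality \<open>less\<close> keeps the residue, and with it the tail
  constant, from vanishing.\<close>

lemma \<psi>_\<alpha>_pos:
  obtains p where "0 < p" "\<psi> (of_real \<alpha>) = of_real p"
proof -
  define p where "p = expectation (\<lambda>\<omega>. exp (\<alpha> * W \<omega>) - exp (\<alpha> * (U \<omega> + V \<omega>)))"
  have int: "integrable M (\<lambda>\<omega>. exp (\<alpha> * W \<omega>) - exp (\<alpha> * (U \<omega> + V \<omega>)))"
  proof (rule Bochner_Integration.integrable_bound[OF Bochner_Integration.integrable_add[OF
      integrable_const[of 1] diff_\<beta>]])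
    show "AE \<omega> in M. norm (exp (\<alpha> * W \<omega>) - exp (\<alpha> * (U \<omega> + V \<omega>))) \<le>
       norm (1 + (exp (\<beta> * W \<omega>) - exp (\<beta> * (U \<omega> + V \<omega>))))"
      using less
    proof eventually_elim
      case (elim \<omega>)
      then have "exp (\<alpha> * (U \<omega> + V \<omega>)) \<le> exp (\<alpha> * W \<omega>)" using \<alpha>_pos by simp
      then show ?case
        using exp_diff_mono_exponent[of \<alpha> \<beta> "U \<omega> + V \<omega>" "W \<omega>"] elim \<alpha>_pos \<alpha>_less_\<beta> by simp
    qed
  qed simp
  have nn: "AE \<omega> in M. 0 \<le> exp (\<alpha> * W \<omega>) - exp (\<alpha> * (U \<omega> + V \<omega>))"
    using less by eventually_elim (use \<alpha>_pos in simp)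
  have "p \<noteq> 0"
  proof
    assume "p = 0"
    then have "AE \<omega> in M. exp (\<alpha> * W \<omega>) - exp (\<alpha> * (U \<omega> + V \<omega>)) = 0"
      unfolding p_def using integral_nonneg_eq_0_iff_AE[OF int nn] by simp
    with less have "AE \<omega> in M. False"
      by eventually_elim (use \<alpha>_pos in simp)
    then show False by simp
  qed
  moreover have "0 \<le> p" unfolding p_def using nn by (rule integral_nonneg_AE)
  moreover have "\<psi> (of_real \<alpha>) = of_real p"
  proof -
    have "\<psi> (of_real \<alpha>) = expectation (\<lambda>\<omega>. complex_of_real (exp (\<alpha> * W \<omega>) - exp (\<alpha> * (U \<omega> + V \<omega>))))"
      unfolding \<psi>_def by (simp add: exp_of_real[symmetric])
    then show ?thesis by (simp only: integral_complex_of_real p_def)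
  qed
  ultimately show thesis by (intro that[of p]) auto
qed

section \<open>The Laplace transform of the tail and its asymptotics\<close>

definition tail :: "real \<Rightarrow> real" where
  "tail t = exp (\<alpha> * t) * prob {\<omega> \<in> space M. t < W \<omega>}"

text \<open>Fubini: the integral of exp ((\<alpha> - z) t) over t < W is exp ((\<alpha> - z) W) /
  (\<alpha> - z). The factor exp (\<alpha> t) in \<open>tail\<close> reflects the critical line to
  Re z = 0, with convergence on its right.\<close>

lemma tail_Laplace:
  fixes z :: complex
  assumes z: "0 < Re z" "Re z < \<alpha>"
  shows "has_bochner_integral lborel (\<lambda>t. of_real (tail t) * exp (- (z * of_real t))) (\<eta> (\<alpha> - z) / (\<alpha> - z))"
proof -
  define c where "c = of_real \<alpha> - z"
  have c: "0 < Re c" "Re c < \<alpha>" using z by (auto simp: c_def)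
  interpret MB: pair_sigma_finite M lborel ..
  define F :: "'a \<Rightarrow> real \<Rightarrow> complex" where "F \<omega> t = indicator {t. t < W \<omega>} t *\<^sub>R exp (c * of_real t)" for \<omega> t
  have F_eq: "case_prod F = (\<lambda>(\<omega>, t). if t < W \<omega> then exp (c * of_real t) else 0)"
    by (auto simp: F_def fun_eq_iff)
  have [measurable]: "case_prod F \<in> borel_measurable (M \<Otimes>\<^sub>M lborel)"
    unfolding F_eq by measurable
  have inner: "(\<integral>t. F \<omega> t \<partial>lborel) = exp (c * of_real (W \<omega>)) / c" "integrable lborel (F \<omega>)" for \<omega>
    using exp_integral_below[OF c(1), of "W \<omega>"] unfolding F_def has_bochner_integral_iff by auto
  have inner_norm: "(\<integral>t. norm (F \<omega> t) \<partial>lborel) = exp (Re c * W \<omega>) / Re c" for \<omega>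
  proof -
    have "complex_of_real (\<integral>t. norm (F \<omega> t) \<partial>lborel) = (\<integral>t. complex_of_real (norm (F \<omega> t)) \<partial>lborel)" by simp
    also have "\<dots> = (\<integral>t. indicator {t. t < W \<omega>} t *\<^sub>R exp (of_real (Re c) * of_real t) \<partial>lborel)"
      by (intro Bochner_Integration.integral_cong) (auto simp: F_def indicator_def exp_of_real[symmetric])
    also have "\<dots> = exp (of_real (Re c) * of_real (W \<omega>)) / of_real (Re c)"
      using exp_integral_below[of "of_real (Re c)" "W \<omega>"] c(1) by (simp add: has_bochner_integral_iff)
    also have "\<dots> = complex_of_real (exp (Re c * W \<omega>) / Re c)" by (simp add: exp_of_real[symmetric])
    finally show ?thesis by (simp only: of_real_eq_iff)
  qed
  have int: "integrable (M \<Otimes>\<^sub>M lborel) (case_prod F)"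
  proof (rule MB.Fubini_integrable)
    show "integrable M (\<lambda>\<omega>. \<integral>t. norm (case_prod F (\<omega>, t)) \<partial>lborel)"
      using W_moment[OF c] by (simp add: inner_norm)
    show "AE \<omega> in M. integrable lborel (\<lambda>t. case_prod F (\<omega>, t))"
      using inner(2) by simp
  qed simp
  have outer: "expectation (\<lambda>\<omega>. F \<omega> t) = of_real (tail t) * exp (- (z * of_real t))" for t
  proof -
    have "expectation (\<lambda>\<omega>. F \<omega> t) = expectation (\<lambda>\<omega>. complex_of_real (indicator {\<omega> \<in> space M. t < W \<omega>}
        \<omega>) * exp (c * of_real t))"
      by (intro Bochner_Integration.integral_cong) (auto simp: F_def indicator_def)
    also have "\<dots> = complex_of_real (prob {\<omega> \<in> space M. t < W \<omega>}) * exp (c * of_real t)"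
      by (simp only: integral_mult_left_zero integral_complex_of_real) simp
    also have "exp (c * of_real t) = complex_of_real (exp (\<alpha> * t)) * exp (- (z * of_real t))"
      unfolding c_def by (simp add: exp_of_real[symmetric] mult_exp_exp algebra_simps)
    finally show ?thesis by (simp add: tail_def)
  qed
  have "integrable lborel (\<lambda>t. expectation (\<lambda>\<omega>. F \<omega> t))"
    by (rule MB.integrable_snd[OF int])
  moreover have "(\<integral>t. expectation (\<lambda>\<omega>. F \<omega> t) \<partial>lborel) = \<eta> c / c"
    by (subst MB.Fubini_integral[OF int]) (simp add: inner \<eta>_W)
  ultimately show ?thesis
    unfolding outer c_def[symmetric] by (simp add: has_bochner_integral_iff)
qed

lemma borel_measurable_tail [measurable]: "tail \<in> borel_measurable borel"
proof -
  have "mono (\<lambda>t. - prob {\<omega> \<in> space M. t < W \<omega>})"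
    by (auto simp: mono_def intro!: finite_measure_mono)
  then have "(\<lambda>t. - prob {\<omega> \<in> space M. t < W \<omega>}) \<in> borel_measurable borel" by (rule borel_measurable_mono)
  then have "(\<lambda>t. - (- prob {\<omega> \<in> space M. t < W \<omega>})) \<in> borel_measurable borel" by (rule
      borel_measurable_uminus)
  then show ?thesis unfolding tail_def by simp
qed

theorem tail_convergence: "\<exists>a>0. (tail \<longlongrightarrow> a) at_top"
proof -
  obtain m where m: "0 < m" "deriv \<phi> (of_real \<alpha>) = of_real m" using \<phi>_deriv_pos .
  obtain p where p: "0 < p" "\<psi> (of_real \<alpha>) = of_real p" using \<psi>_\<alpha>_pos .
  \<comment> \<open>The residue \<psi>(\<alpha>) / (\<alpha> \<phi>'(\<alpha>)): the factor \<alpha>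
    comes from the denominator \<alpha> - z of \<open>tail_Laplace\<close> at z = 0.\<close>
  define a where "a = p / (\<alpha> * m)"
  have a: "0 < a" using m p \<alpha>_pos by (simp add: a_def)
  \<comment> \<open>The cofactor of the simple zero of \<phi> - 1 at \<alpha>; the singularity there
    is removable.\<close>
  define q where "q z = (if z = of_real \<alpha> then deriv \<phi> (of_real \<alpha>) else (\<phi> z - \<phi> (of_real \<alpha>)) / (z -
      of_real \<alpha>))" for z
  have q_hol: "q holomorphic_on strip"
    unfolding q_def by (rule pole_lemma_open[OF \<phi>_holomorphic open_strip])
  have q_eq: "\<phi> z - 1 = (z - of_real \<alpha>) * q z" for z
    by (simp add: q_def \<phi>_\<alpha>)
  have q_nz: "q z \<noteq> 0" if "0 < Re z" "Re z \<le> \<alpha>" for z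
  proof (cases "z = of_real \<alpha>")
    case True
    then show ?thesis using m by (simp add: q_def)
  next
    case False
    have "\<phi> z \<noteq> 1" using \<phi>_neq_1[of z] norm_\<phi>_less_1[of z] that False by (cases "Re z = \<alpha>") auto
    then show ?thesis using False q_eq[of z] by auto
  qed
  \<comment> \<open>Half of \<alpha> keeps \<alpha> - z at a positive distance from the line Re =
    0.\<close>
  define s0 where "s0 = \<alpha> / 2"
  \<comment> \<open>The reflected domain on which dividing by \<open>q\<close> is safe. It contains
    the strip 0 \<le> Re z \<le> \<open>s0\<close> including its left edge, because \<open>q\<close>
    has no zero on the line Re = \<alpha>.\<close>
  define T where "T = (\<lambda>z. of_real \<alpha> - z) -` (strip \<inter> q -` (- {0}))"
  have "open (strip \<inter> q -` (- {0}))"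
    by (rule continuous_open_preimage[OF holomorphic_on_imp_continuous_on[OF q_hol] open_strip]) auto
  then have T: "open T"
    unfolding T_def by (intro open_vimage) (auto intro!: continuous_intros)
  define N where "N z = \<psi> (of_real \<alpha> - z) / ((of_real \<alpha> - z) * q (of_real \<alpha> - z))" for z
  have "(\<lambda>z. \<psi> (of_real \<alpha> - z)) holomorphic_on T" "(\<lambda>z. q (of_real \<alpha> - z)) holomorphic_on T"
    by (rule holomorphic_on_compose_gen[where g = \<psi> and f = "\<lambda>z. of_real \<alpha> - z" and t = strip, unfolded
        o_def];
        use \<psi>_holomorphic in \<open>auto simp: T_def intro!: holomorphic_intros\<close>)
       (rule holomorphic_on_compose_gen[where g = q and f = "\<lambda>z. of_real \<alpha> - z" and t = strip, unfolded
           o_def];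
        use q_hol in \<open>auto simp: T_def intro!: holomorphic_intros\<close>)
  then have N_hol: "N holomorphic_on T"
    unfolding N_def by (intro holomorphic_intros) (auto simp: T_def strip_def)
  \<comment> \<open>The difference quotient of \<open>N\<close> at 0: splitting N z / z into N 0 / z
    and H z isolates the pole and leaves a holomorphic remainder.\<close>
  define H where "H z = (if z = 0 then deriv N 0 else (N z - N 0) / (z - 0))" for z
  have H_hol: "H holomorphic_on T"
    unfolding H_def by (rule pole_lemma_open[OF N_hol T])
  have sub: "{z. 0 \<le> Re z \<and> Re z \<le> s0} \<subseteq> T"
    using q_nz \<alpha>_pos \<alpha>_less_\<beta> by (auto simp: T_def s0_def strip_def)
  have N0: "N 0 = of_real a"
    using m p by (simp add: N_def q_def a_def)
  interpret WI: Wiener_Ikehara tail H a s0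
  proof
    show "0 \<le> tail t" for t by (simp add: tail_def)
    show "0 < s0" using \<alpha>_pos by (simp add: s0_def)
    show "integrable lborel (\<lambda>t. tail t * exp (- s * t))" if "0 < s" "s \<le> s0" for s
    proof -
      have "integrable lborel (\<lambda>t. complex_of_real (tail t * exp (- s * t)))"
        using tail_Laplace[of "of_real s"] that \<alpha>_pos
        by (simp add: has_bochner_integral_iff s0_def exp_of_real[symmetric])
      then show ?thesis by (simp only: complex_of_real_integrable_eq)
    qed
    show "continuous_on {z. 0 \<le> Re z \<and> Re z \<le> s0} H"
      by (rule continuous_on_subset[OF holomorphic_on_imp_continuous_on[OF H_hol] sub])
    show "(\<integral>t. of_real (tail t) * exp (- (z * of_real t)) \<partial>lborel) = of_real a / z + H z" if "0 < Re z"
        "Re z \<le> s0" for z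
    proof -
      have z: "0 < Re z" "Re z < \<alpha>" using that \<alpha>_pos by (auto simp: s0_def)
      define w where "w = of_real \<alpha> - z"
      have w: "0 < Re w" "Re w < \<alpha>" "w \<noteq> 0" "z \<noteq> 0" using z by (auto simp: w_def)
      have q: "q w \<noteq> 0" using q_nz[of w] w by simp
      have "1 - \<phi> w = z * q w" using q_eq[of w] by (simp add: w_def algebra_simps)
      then have "\<eta> w * (z * q w) = \<psi> w" using renewal_equation[OF w(1,2)] by simp
      then have "\<eta> w / w = \<psi> w / (w * q w) / z" using q w by (simp add: field_simps)
      also have "\<dots> = N z / z" by (simp add: N_def w_def)
      also have "\<dots> = of_real a / z + H z" using w by (simp add: H_def N0 diff_divide_distrib)
      finally show ?thesis
        using tail_Laplace[OF z] by (simp add: has_bochner_integral_iff w_def)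
    qed
  qed (use a in auto)
  have "(tail \<longlongrightarrow> a) at_top"
  proof (rule WI.tendsto_of_antimono[OF _ \<alpha>_pos])
    fix t t' :: real assume "t \<le> t'"
    have "exp (- \<alpha> * t) * tail t = prob {\<omega> \<in> space M. t < W \<omega>}" for t
      by (simp add: tail_def mult_exp_exp mult.assoc[symmetric])
    then show "exp (- \<alpha> * t') * tail t' \<le> exp (- \<alpha> * t) * tail t"
      using \<open>t \<le> t'\<close> by (auto intro!: finite_measure_mono)
  qed
  then show ?thesis using a by blast
qed

end

section \<open>The diagonal equation\<close>

lemma borel_measurable_vec_nth_comp [measurable (raw)]:
  "f \<in> borel_measurable N \<Longrightarrow> (\<lambda>x. f x $ i) \<in> borel_measurable N" for f :: "_ \<Rightarrow> real ^ 'd::finite"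
  by (rule measurable_compose[of f N borel]) (auto intro!: borel_measurable_continuous_onI
      continuous_intros)

text \<open>The dimension stays arbitrary here; two coordinates at a time are compared. Strict
  positivity of \<open>c\<close> and of the noise makes all multipliers positive, so that logarithms
  can be taken.\<close>

locale diagonal_SRE = prob_space P for P :: "'w measure" +
  fixes b c :: "real ^ 'd::finite" and M :: "int \<Rightarrow> 'w \<Rightarrow> real" and Q X :: "int \<Rightarrow> 'w \<Rightarrow> real ^ 'd"
  assumes noise: "noise P M Q"
    and solution: "stationary_solution P b c M Q X"
    and b_nonneg: "\<And>i. 0 \<le> b $ i" and c_pos: "\<And>i. 0 < c $ i"
    and pos_0: "AE \<omega> in P. M 0 \<omega> > 0 \<and> (\<forall>i. Q 0 \<omega> $ i > 0)"
begin

section \<open>Independence of the joint noise over time\<close>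

definition \<xi> :: "int \<Rightarrow> 'w \<Rightarrow> real \<times> (real ^ 'd)" where
  "\<xi> t \<omega> = (M t \<omega>, Q t \<omega>)"

lemma indep_M: "indep_vars (\<lambda>_. borel) M UNIV"
  and indep_Q: "indep_vars (\<lambda>_. borel) Q UNIV"
  and law_M: "distr P borel (M t) = distr P borel (M 0)"
  and law_Q: "distr P borel (Q t) = distr P borel (Q 0)"
  using noise by (auto simp: noise_def iid_seq_def)

lemma borel_measurable_M [measurable]: "M t \<in> borel_measurable P"
  using indep_M by (auto simp: indep_vars_def)

lemma borel_measurable_Q [measurable]: "Q t \<in> borel_measurable P"
  using indep_Q by (auto simp: indep_vars_def)

lemma borel_measurable_X [measurable]: "X t \<in> borel_measurable P"
  using solution by (auto simp: stationary_solution_def stationary_def)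

lemma borel_measurable_\<xi> [measurable]: "\<xi> t \<in> measurable P (borel \<Otimes>\<^sub>M borel)"
  unfolding \<xi>_def by measurable

text \<open>Intersections of finitely many coordinate events lie in the \<sigma>-algebras of the
  whole processes, so the independence of the processes separates M from Q; independence within each
  sequence then splits both factors.\<close>

lemma prob_Int_M_Q:
  assumes "finite J" "J \<noteq> {}"
    and C: "\<And>j. j \<in> J \<Longrightarrow> C j \<in> sets borel" and D: "\<And>j. j \<in> J \<Longrightarrow> D j \<in> sets borel"
  shows "prob (\<Inter>j\<in>J. (M j -` C j \<inter> space P) \<inter> (Q j -` D j \<inter> space P)) =
    (\<Prod>j\<in>J. prob (M j -` C j \<inter> space P)) * (\<Prod>j\<in>J. prob (Q j -` D j \<inter> space P))"
proof -
  let ?SM = "sets (vimage_algebra (space P) (\<lambda>\<omega> t. M t \<omega>) (Pi\<^sub>M UNIV (\<lambda>_. borel)))"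
  let ?SQ = "sets (vimage_algebra (space P) (\<lambda>\<omega> t. Q t \<omega>) (Pi\<^sub>M UNIV (\<lambda>_. borel)))"
  have ind: "indep_set ?SM ?SQ" using noise by (simp add: noise_def)
  have gen: "(\<Inter>j\<in>J. Z j -` E j \<inter> space P) \<in> sets (vimage_algebra (space P) (\<lambda>\<omega> t. Z t \<omega>) (Pi\<^sub>M UNIV (\<lambda>_.
      borel)))"
    if E: "\<And>j. j \<in> J \<Longrightarrow> E j \<in> sets borel" for Z :: "int \<Rightarrow> 'w \<Rightarrow> 'b::topological_space" and E
  proof -
    have eq: "(\<Inter>j\<in>J. Z j -` E j \<inter> space P) = (\<lambda>\<omega> t. Z t \<omega>) -` {f. \<forall>j\<in>J. f j \<in> E j} \<inter> space P"
      using assms(2) by auto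
    have "{f \<in> space (Pi\<^sub>M UNIV (\<lambda>_. borel)). \<forall>j\<in>J. f j \<in> E j} \<in> sets (Pi\<^sub>M UNIV (\<lambda>_::int. borel :: 'b
        measure))"
      using E assms(1) by measurable
    then have "{f. \<forall>j\<in>J. f j \<in> E j} \<in> sets (Pi\<^sub>M UNIV (\<lambda>_::int. borel :: 'b measure))"
      by (simp add: space_PiM)
    then have "(\<lambda>\<omega> t. Z t \<omega>) -` {f. \<forall>j\<in>J. f j \<in> E j} \<inter> space P \<in>
       sets (vimage_algebra (space P) (\<lambda>\<omega> t. Z t \<omega>) (Pi\<^sub>M UNIV (\<lambda>_. borel)))"
      by (rule in_vimage_algebra)
    then show ?thesis by (simp only: eq)
  qed
  have "(\<Inter>j\<in>J. (M j -` C j \<inter> space P) \<inter> (Q j -` D j \<inter> space P)) =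
      (\<Inter>j\<in>J. M j -` C j \<inter> space P) \<inter> (\<Inter>j\<in>J. Q j -` D j \<inter> space P)" using assms(2) by auto
  also have "prob \<dots> = prob (\<Inter>j\<in>J. M j -` C j \<inter> space P) * prob (\<Inter>j\<in>J. Q j -` D j \<inter> space P)"
    by (rule indep_setD[OF ind gen gen]) (use C D in auto)
  also have "prob (\<Inter>j\<in>J. M j -` C j \<inter> space P) = (\<Prod>j\<in>J. prob (M j -` C j \<inter> space P))"
    by (rule indep_varsD[OF indep_M]) (use assms in auto)
  also have "prob (\<Inter>j\<in>J. Q j -` D j \<inter> space P) = (\<Prod>j\<in>J. prob (Q j -` D j \<inter> space P))"
    by (rule indep_varsD[OF indep_Q]) (use assms in auto)
  finally show ?thesis .
qed

text \<open>Preimages of rectangles form an intersection-stable generator, so independence has to be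
  checked only on them.\<close>

lemma indep_\<xi>: "indep_vars (\<lambda>_. borel \<Otimes>\<^sub>M borel) \<xi> UNIV"
proof -
  define G where "G t = {\<xi> t -` A \<inter> space P | A. A \<in> {C \<times> D | C D. C \<in> sets borel \<and> D \<in> sets borel}}" for t
  have G_elim: "\<exists>C D. C \<in> sets borel \<and> D \<in> sets borel \<and> A = (M t -` C \<inter> space P) \<inter> (Q t -` D \<inter> space P)"
      if A: "A \<in> G t" for A t
  proof -
    obtain C D where CD: "C \<in> sets borel" "D \<in> sets borel" "A = \<xi> t -` (C \<times> D) \<inter> space P"
      using A unfolding G_def by (elim CollectE exE conjE) simp
    moreover have "\<xi> t -` (C \<times> D) \<inter> space P = (M t -` C \<inter> space P) \<inter> (Q t -` D \<inter> space P)"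
      by (auto simp: \<xi>_def)
    ultimately show ?thesis by blast
  qed
  have "indep_sets G UNIV"
  proof (rule indep_setsI)
    show "G t \<subseteq> events" for t
    proof
      fix A assume "A \<in> G t"
      from G_elim[OF this] obtain C D where "C \<in> sets borel" "D \<in> sets borel" "A = (M t -` C \<inter> space P)
          \<inter> (Q t -` D \<inter> space P)"
        by (elim exE conjE)
      then show "A \<in> events" by simp
    qed
    fix A :: "int \<Rightarrow> 'w set" and J :: "int set"
    assume J: "J \<noteq> {}" "J \<subseteq> UNIV" "finite J" and A: "\<forall>j\<in>J. A j \<in> G j"
    have "\<forall>j\<in>J. \<exists>p. fst p \<in> sets borel \<and> snd p \<in> sets borel \<and> A j = (M j -` fst p \<inter> space P) \<inter> (Q j -`
        snd p \<inter> space P)"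
    proof
      fix j assume "j \<in> J"
      then have "A j \<in> G j" using A by simp
      from G_elim[OF this] obtain C D where "C \<in> sets borel" "D \<in> sets borel" "A j = (M j -` C \<inter> space
          P) \<inter> (Q j -` D \<inter> space P)"
        by (elim exE conjE)
      then show "\<exists>p. fst p \<in> sets borel \<and> snd p \<in> sets borel \<and> A j = (M j -` fst p \<inter> space P) \<inter> (Q j -`
          snd p \<inter> space P)"
        by (intro exI[of _ "(C, D)"]) simp
    qed
    then obtain p where p: "\<forall>j\<in>J. fst (p j) \<in> sets borel \<and> snd (p j) \<in> sets borel \<and> A j = (M j -` fst (p
        j) \<inter> space P) \<inter> (Q j -` snd (p j) \<inter> space P)"
      by (rule bchoice[THEN exE])
    define C where "C j = fst (p j)" for j
    define D where "D j = snd (p j)" for j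
    have CD: "\<And>j. j \<in> J \<Longrightarrow> C j \<in> sets borel" "\<And>j. j \<in> J \<Longrightarrow> D j \<in> sets borel"
        "\<And>j. j \<in> J \<Longrightarrow> A j = (M j -` C j \<inter> space P) \<inter> (Q j -` D j \<inter> space P)"
      using p by (auto simp only: C_def D_def)
    \<comment> \<open>The one-element case identifies each factor, after which the two products
      regroup into one over pairs.\<close>
    have single: "prob (A j) = prob (M j -` C j \<inter> space P) * prob (Q j -` D j \<inter> space P)" if "j \<in> J" for j
      using prob_Int_M_Q[of "{j}" C D] CD(1,2)[OF that] unfolding CD(3)[OF that] by simp
    have "(\<Inter>j\<in>J. A j) = (\<Inter>j\<in>J. (M j -` C j \<inter> space P) \<inter> (Q j -` D j \<inter> space P))"
      by (intro INF_cong refl CD(3))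
    then have "prob (\<Inter>j\<in>J. A j) = (\<Prod>j\<in>J. prob (M j -` C j \<inter> space P)) * (\<Prod>j\<in>J. prob (Q j -` D j \<inter> space P))"
      by (simp only: prob_Int_M_Q[OF J(3,1) CD(1,2)])
    also have "\<dots> = (\<Prod>j\<in>J. prob (A j))"
      unfolding prod.distrib[symmetric] by (intro prod.cong refl single[symmetric])
    finally show "prob (\<Inter>j\<in>J. A j) = (\<Prod>j\<in>J. prob (A j))" .
  qed
  moreover have "Int_stable (G t)" for t
  proof (rule Int_stableI)
    have G_I: "\<xi> t -` (C \<times> D) \<inter> space P \<in> G t" if "C \<in> sets borel" "D \<in> sets borel" for C D
      unfolding G_def using that by (intro CollectI exI[of _ "C \<times> D"] conjI refl) auto
    fix A B assume A: "A \<in> G t" and B: "B \<in> G t"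
    obtain C D where CD: "C \<in> sets borel" "D \<in> sets borel" "A = \<xi> t -` (C \<times> D) \<inter> space P"
      using A unfolding G_def by (elim CollectE exE conjE) simp
    obtain C' D' where CD': "C' \<in> sets borel" "D' \<in> sets borel" "B = \<xi> t -` (C' \<times> D') \<inter> space P"
      using B unfolding G_def by (elim CollectE exE conjE) simp
    have "A \<inter> B = \<xi> t -` ((C \<inter> C') \<times> (D \<inter> D')) \<inter> space P" unfolding CD(3) CD'(3) by auto
    then show "A \<inter> B \<in> G t" using CD(1,2) CD'(1,2) by (simp add: G_I sets.Int)
  qed
  ultimately have "indep_sets (\<lambda>t. sigma_sets (space P) (G t)) UNIV"
    by (rule indep_sets_sigma)
  moreover have "sigma_sets (space P) (G t) = {\<xi> t -` A \<inter> space P | A. A \<in> sets (borel \<Otimes>\<^sub>M borel)}" for t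
    unfolding G_def sets_pair_measure space_borel by (subst sigma_sets_vimage_commute[symmetric, where
        \<Omega>' = UNIV]) simp_all
  ultimately show ?thesis
    by (simp add: indep_vars_def2)
qed

text \<open>Both variables are functions of disjoint blocks of one independent family; the
  restriction to \<open>{..<t}\<close> records that \<open>G\<close> sees earlier noise
  only.\<close>

lemma indep_present_past:
  fixes F :: "real \<times> (real ^ 'd) \<Rightarrow> 'b::topological_space" and G :: "_ \<Rightarrow> 'b"
  assumes F: "F \<in> borel_measurable (borel \<Otimes>\<^sub>M borel)"
    and G: "G \<in> borel_measurable (Pi\<^sub>M {..<t} (\<lambda>_. borel \<Otimes>\<^sub>M borel))"
  shows "indep_var borel (\<lambda>\<omega>. F (\<xi> t \<omega>)) borel (\<lambda>\<omega>. G (restrict (\<lambda>s. \<xi> s \<omega>) {..<t}))"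
proof -
  have "(\<lambda>w. F (w t)) \<in> borel_measurable (Pi\<^sub>M {t} (\<lambda>_. borel \<Otimes>\<^sub>M borel))"
    by (rule measurable_compose[OF _ F]) simp
  from indep_var_compose[OF indep_var_restrict[OF indep_\<xi>, of "{t}" "{..<t}"] this G]
  show ?thesis by (simp add: comp_def)
qed

section \<open>Iteration from the past\<close>

text \<open>The value at time t of the recursion started from x at time t - n. It acts on a noise
  path rather than on sample points, so that dependence on the past alone can be stated as
  measurability on a product space.\<close>

fun T :: "'d \<Rightarrow> real \<Rightarrow> nat \<Rightarrow> int \<Rightarrow> (int \<Rightarrow> real \<times> (real ^ 'd)) \<Rightarrow> real" where
  "T i x 0 t w = x"
| "T i x (Suc n) t w = (b $ i + c $ i * fst (w t)) * T i x n (t - 1) w + snd (w t) $ i"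

lemma T_cong: "(\<And>s. s \<le> t \<Longrightarrow> w s = w' s) \<Longrightarrow> T i x n t w = T i x n t w'"
proof (induction n arbitrary: t)
  case (Suc n)
  have "T i x n (t - 1) w = T i x n (t - 1) w'" by (rule Suc.IH) (use Suc.prems in auto)
  then show ?case using Suc.prems[of t] by simp
qed simp

lemma borel_measurable_T: "{..t} \<subseteq> I \<Longrightarrow> T i x n t \<in> borel_measurable (Pi\<^sub>M I (\<lambda>_. borel \<Otimes>\<^sub>M borel))"
proof (induction n arbitrary: t)
  case 0
  have "T i x 0 t = (\<lambda>_. x)" by (rule ext) simp
  then show ?case by simp
next
  case (Suc n)
  have [measurable]: "T i x n (t - 1) \<in> borel_measurable (Pi\<^sub>M I (\<lambda>_. borel \<Otimes>\<^sub>M borel))"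
    by (rule Suc.IH) (use Suc.prems in auto)
  have "t \<in> I" using Suc.prems by auto
  then have [measurable]: "(\<lambda>w. w t) \<in> measurable (Pi\<^sub>M I (\<lambda>_. borel \<Otimes>\<^sub>M borel)) (borel \<Otimes>\<^sub>M borel ::
      (real \<times> (real ^ 'd)) measure)"
    by simp
  have "T i x (Suc n) t = (\<lambda>w. (b $ i + c $ i * fst (w t)) * T i x n (t - 1) w + snd (w t) $ i)" by
      (rule ext) simp
  then show ?case by simp
qed

definition A :: "'d \<Rightarrow> int \<Rightarrow> 'w \<Rightarrow> real" where
  "A i t \<omega> = b $ i + c $ i * M t \<omega>"

text \<open>The iterate started from 0, which is the n-th partial sum of the series for the
  stationary solution.\<close>

definition Y :: "'d \<Rightarrow> nat \<Rightarrow> int \<Rightarrow> 'w \<Rightarrow> real" where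
  "Y i n t \<omega> = T i 0 n t (\<lambda>s. \<xi> s \<omega>)"

lemma Y_0 [simp]: "Y i 0 t \<omega> = 0"
  and Y_Suc [simp]: "Y i (Suc n) t \<omega> = A i t \<omega> * Y i n (t - 1) \<omega> + Q t \<omega> $ i"
  by (simp_all add: Y_def A_def \<xi>_def)

lemma A_\<xi>: "b $ i + c $ i * fst (\<xi> t \<omega>) = A i t \<omega>"
  by (simp add: A_def \<xi>_def)

lemma borel_measurable_A [measurable]: "A i t \<in> borel_measurable P"
  unfolding A_def by measurable

lemma borel_measurable_Y [measurable]: "Y i n t \<in> borel_measurable P"
proof (induction n arbitrary: t)
  case 0
  have "Y i 0 t = (\<lambda>_. 0)" by (rule ext) simp
  then show ?case by simp
next
  case (Suc n)
  note Suc.IH [measurable]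
  have "Y i (Suc n) t = (\<lambda>\<omega>. A i t \<omega> * Y i n (t - 1) \<omega> + Q t \<omega> $ i)" by (rule ext) simp
  then show ?case by simp
qed

lemma T_restrict: "t < t' \<Longrightarrow> T i x n t (restrict (\<lambda>s. \<xi> s \<omega>) {..<t'}) = T i x n t (\<lambda>s. \<xi> s \<omega>)"
  by (rule T_cong) auto

text \<open>As \<open>T\<close> is affine in its initial value, this is the product of the last \<open>n\<close> multipliers.\<close>

definition R :: "'d \<Rightarrow> nat \<Rightarrow> int \<Rightarrow> 'w \<Rightarrow> real" where
  "R i n t \<omega> = T i 1 n t (\<lambda>s. \<xi> s \<omega>) - T i 0 n t (\<lambda>s. \<xi> s \<omega>)"

lemma R_0 [simp]: "R i 0 t \<omega> = 1"
  and R_Suc [simp]: "R i (Suc n) t \<omega> = A i t \<omega> * R i n (t - 1) \<omega>"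
  by (simp_all add: R_def A_def \<xi>_def algebra_simps)

lemma borel_measurable_R [measurable]: "R i n t \<in> borel_measurable P"
proof (induction n arbitrary: t)
  case 0
  have "R i 0 t = (\<lambda>_. 1)" by (rule ext) simp
  then show ?case by simp
next
  case (Suc n)
  note Suc.IH [measurable]
  have "R i (Suc n) t = (\<lambda>\<omega>. A i t \<omega> * R i n (t - 1) \<omega>)" by (rule ext) simp
  then show ?case by simp
qed

text \<open>Positivity is assumed at time 0 only. Equal laws carry it to each time, and countability
  of the integers puts all times into one null set.\<close>

lemma AE_pos: "AE \<omega> in P. \<forall>t. 0 < A i t \<omega> \<and> 0 < Q t \<omega> $ i"
proof -
  have "AE \<omega> in P. 0 < A i t \<omega> \<and> 0 < Q t \<omega> $ i" for t
  proof -
    have "AE x in distr P borel (M 0). 0 < x"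
      by (subst AE_distr_iff) (auto intro!: eventually_mono[OF pos_0])
    then have "AE x in distr P borel (M t). 0 < x" by (simp only: law_M[of t])
    then have M: "AE \<omega> in P. 0 < M t \<omega>" by (subst (asm) AE_distr_iff) auto
    have "AE x in distr P borel (Q 0). 0 < x $ i"
      by (subst AE_distr_iff) (auto intro!: eventually_mono[OF pos_0])
    then have "AE x in distr P borel (Q t). 0 < x $ i" by (simp only: law_Q[of t])
    then have "AE \<omega> in P. 0 < Q t \<omega> $ i" by (subst (asm) AE_distr_iff) auto
    with M show ?thesis
      by eventually_elim (use b_nonneg[of i] c_pos[of i] in \<open>simp add: A_def add_nonneg_pos\<close>)
  qed
  then show ?thesis by (simp add: AE_all_countable)
qed

lemma nn_integral_law_M:
  "f \<in> borel_measurable borel \<Longrightarrow> (\<integral>\<^sup>+\<omega>. f (M t \<omega>) \<partial>P) = (\<integral>\<^sup>+\<omega>. f (M 0 \<omega>) \<partial>P)"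
  using nn_integral_distr[of "M t" P borel f] nn_integral_distr[of "M 0" P borel f] law_M[of t] by simp

lemma nn_integral_law_Q:
  "f \<in> borel_measurable borel \<Longrightarrow> (\<integral>\<^sup>+\<omega>. f (Q t \<omega>) \<partial>P) = (\<integral>\<^sup>+\<omega>. f (Q 0 \<omega>) \<partial>P)"
  using nn_integral_distr[of "Q t" P borel f] nn_integral_distr[of "Q 0" P borel f] law_Q[of t] by simp

lemma Y_nonneg: "(\<And>t. 0 < A i t \<omega> \<and> 0 < Q t \<omega> $ i) \<Longrightarrow> 0 \<le> Y i n t \<omega>"
  by (induction n arbitrary: t) (simp_all add: less_imp_le)

lemma R_nonneg: "(\<And>t. 0 < A i t \<omega>) \<Longrightarrow> 0 \<le> R i n t \<omega>"
  by (induction n arbitrary: t) (simp_all add: less_imp_le)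

section \<open>Moments of the iterates\<close>

lemma nn_integral_A_powr: "(\<integral>\<^sup>+\<omega>. ennreal (A i t \<omega> powr s) \<partial>P) = (\<integral>\<^sup>+\<omega>. ennreal (A i 0 \<omega> powr s) \<partial>P)"
  unfolding A_def by (rule nn_integral_law_M[of "\<lambda>x. ennreal ((b $ i + c $ i * x) powr s)"]) simp

lemma nn_integral_Q_powr: "(\<integral>\<^sup>+\<omega>. ennreal ((Q t \<omega> $ i) powr s) \<partial>P) = (\<integral>\<^sup>+\<omega>. ennreal ((Q 0 \<omega> $ i) powr s)
    \<partial>P)"
  by (rule nn_integral_law_Q[of "\<lambda>x. ennreal ((x $ i) powr s)"]) simp

text \<open>Phrased with nonnegative integrals, so that moments factor before they are known to be
  finite.\<close>

lemma nn_integral_present_past: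
  assumes [measurable]: "F \<in> borel_measurable (borel \<Otimes>\<^sub>M borel)" "G \<in> borel_measurable (Pi\<^sub>M {..<t} (\<lambda>_.
      borel \<Otimes>\<^sub>M borel))"
    and U: "\<And>\<omega>. U \<omega> = F (\<xi> t \<omega>)" and V: "\<And>\<omega>. V \<omega> = G (restrict (\<lambda>s. \<xi> s \<omega>) {..<t})"
  shows "(\<integral>\<^sup>+\<omega>. U \<omega> * V \<omega> \<partial>P) = (\<integral>\<^sup>+\<omega>. U \<omega> \<partial>P) * (\<integral>\<^sup>+\<omega>. V \<omega> \<partial>P)"
  unfolding U V by (rule indep_var_nn_integral[OF indep_present_past]) measurable

lemma R_moment:
  assumes "(\<integral>\<^sup>+\<omega>. ennreal (A i 0 \<omega> powr s) \<partial>P) \<le> ennreal \<rho>" and "0 \<le> \<rho>"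
  shows "(\<integral>\<^sup>+\<omega>. ennreal (R i n t \<omega> powr s) \<partial>P) \<le> ennreal (\<rho> ^ n)"
proof (induction n arbitrary: t)
  case (Suc n)
  have "AE \<omega> in P. ennreal (R i (Suc n) t \<omega> powr s) = ennreal (A i t \<omega> powr s) * ennreal (R i n (t - 1)
      \<omega> powr s)"
    using AE_pos[of i] by eventually_elim (simp add: powr_mult R_nonneg less_imp_le ennreal_mult)
  then have "(\<integral>\<^sup>+\<omega>. ennreal (R i (Suc n) t \<omega> powr s) \<partial>P) =
      (\<integral>\<^sup>+\<omega>. ennreal (A i t \<omega> powr s) * ennreal (R i n (t - 1) \<omega> powr s) \<partial>P)"
    by (rule nn_integral_cong_AE)
  also have "\<dots> = (\<integral>\<^sup>+\<omega>. ennreal (A i t \<omega> powr s) \<partial>P) * (\<integral>\<^sup>+\<omega>. ennreal (R i n (t - 1) \<omega> powr s) \<partial>P)"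
  proof (rule nn_integral_present_past)
    have [measurable]: "T i x n (t - 1) \<in> borel_measurable (Pi\<^sub>M {..<t} (\<lambda>_. borel \<Otimes>\<^sub>M borel))" for x
      by (rule borel_measurable_T) auto
    show "(\<lambda>w. ennreal ((T i 1 n (t - 1) w - T i 0 n (t - 1) w) powr s)) \<in> borel_measurable (Pi\<^sub>M {..<t}
        (\<lambda>_. borel \<Otimes>\<^sub>M borel))"
      by measurable
    show "(\<lambda>p. ennreal ((b $ i + c $ i * fst p) powr s)) \<in> borel_measurable (borel \<Otimes>\<^sub>M (borel :: (real ^
        'd) measure))"
      by measurable
  qed (simp_all add: A_\<xi> R_def T_restrict)
  also have "\<dots> \<le> ennreal \<rho> * ennreal (\<rho> ^ n)"
    using Suc.IH assms(1) by (intro mult_mono) (auto simp: nn_integral_A_powr[of i t])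
  also have "\<dots> = ennreal (\<rho> ^ Suc n)" using assms(2) by (simp add: ennreal_mult)
  finally show ?case .
qed (simp add: emeasure_space_1)

text \<open>The moments obey m (n + 1) \<le> r * m n + C with r < 1. The bound B is the fixed point
  of this affine map, and the start value 0 lies below it.\<close>

lemma Y_moment:
  assumes s: "0 < s"
    and A: "(\<integral>\<^sup>+\<omega>. ennreal (A i 0 \<omega> powr s) \<partial>P) < 1"
    and Q: "(\<integral>\<^sup>+\<omega>. ennreal ((Q 0 \<omega> $ i) powr s) \<partial>P) < \<infinity>"
  obtains B where "0 \<le> B" "\<And>n t. (\<integral>\<^sup>+\<omega>. ennreal (Y i n t \<omega> powr s) \<partial>P) \<le> ennreal B"
proof -
  obtain \<rho> where \<rho>: "0 \<le> \<rho>" "(\<integral>\<^sup>+\<omega>. ennreal (A i 0 \<omega> powr s) \<partial>P) = ennreal \<rho>"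
    using A by (cases "\<integral>\<^sup>+\<omega>. ennreal (A i 0 \<omega> powr s) \<partial>P") auto
  have \<rho>1: "\<rho> < 1" using A \<rho> by simp
  obtain q where q: "0 \<le> q" "(\<integral>\<^sup>+\<omega>. ennreal ((Q 0 \<omega> $ i) powr s) \<partial>P) = ennreal q"
    using Q by (cases "\<integral>\<^sup>+\<omega>. ennreal ((Q 0 \<omega> $ i) powr s) \<partial>P") auto
  obtain \<kappa> where \<kappa>: "0 < \<kappa>" "(1 + \<kappa>) powr s * \<rho> < 1" using inflation_factor[OF \<rho>1] .
  define r where "r = (1 + \<kappa>) powr s * \<rho>"
  define C where "C = (1 + 1 / \<kappa>) powr s * q"
  define B where "B = C / (1 - r)"
  have r: "0 \<le> r" "r < 1" using \<kappa> \<rho> by (auto simp: r_def)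
  have C: "0 \<le> C" using q by (simp add: C_def)
  have B: "0 \<le> B" "r * B + C = B" using r C by (auto simp: B_def field_simps)
  have "(\<integral>\<^sup>+\<omega>. ennreal (Y i n t \<omega> powr s) \<partial>P) \<le> ennreal B" for n t
  proof (induction n arbitrary: t)
    case (Suc n)
    have "AE \<omega> in P. ennreal (Y i (Suc n) t \<omega> powr s) \<le>
      ennreal ((1 + \<kappa>) powr s) * (ennreal (A i t \<omega> powr s) * ennreal (Y i n (t - 1) \<omega> powr s)) + ennreal
          ((1 + 1 / \<kappa>) powr s) * ennreal ((Q t \<omega> $ i) powr s)"
      using AE_pos[of i]
    proof eventually_elim
      case (elim \<omega>)
      have Y: "0 \<le> Y i n (t - 1) \<omega>" by (rule Y_nonneg) (use elim in auto)
      have "Y i (Suc n) t \<omega> powr s \<le> (1 + \<kappa>) powr s * (A i t \<omega> * Y i n (t - 1) \<omega>) powr s + (1 + 1 / \<kappa>)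
          powr s * (Q t \<omega> $ i) powr s"
        unfolding Y_Suc using elim Y s \<kappa> by (intro powr_add_le) (simp_all add: less_imp_le)
      also have "(A i t \<omega> * Y i n (t - 1) \<omega>) powr s = A i t \<omega> powr s * Y i n (t - 1) \<omega> powr s"
        using elim Y by (simp add: powr_mult less_imp_le)
      finally show ?case by (simp flip: ennreal_mult' ennreal_plus add: ennreal_leI)
    qed
    then have "(\<integral>\<^sup>+\<omega>. ennreal (Y i (Suc n) t \<omega> powr s) \<partial>P) \<le>
       (\<integral>\<^sup>+\<omega>. ennreal ((1 + \<kappa>) powr s) * (ennreal (A i t \<omega> powr s) * ennreal (Y i n (t - 1) \<omega> powr s)) +
           ennreal ((1 + 1 / \<kappa>) powr s) * ennreal ((Q t \<omega> $ i) powr s) \<partial>P)"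
      by (rule nn_integral_mono_AE)
    also have "\<dots> = ennreal ((1 + \<kappa>) powr s) * (\<integral>\<^sup>+\<omega>. ennreal (A i t \<omega> powr s) * ennreal (Y i n (t - 1) \<omega>
        powr s) \<partial>P)
        + ennreal ((1 + 1 / \<kappa>) powr s) * (\<integral>\<^sup>+\<omega>. ennreal ((Q t \<omega> $ i) powr s) \<partial>P)"
      by (subst nn_integral_add) (auto simp: nn_integral_cmult)
    also have "(\<integral>\<^sup>+\<omega>. ennreal (A i t \<omega> powr s) * ennreal (Y i n (t - 1) \<omega> powr s) \<partial>P) =
       (\<integral>\<^sup>+\<omega>. ennreal (A i t \<omega> powr s) \<partial>P) * (\<integral>\<^sup>+\<omega>. ennreal (Y i n (t - 1) \<omega> powr s) \<partial>P)"
    proof (rule nn_integral_present_past)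
      have [measurable]: "T i 0 n (t - 1) \<in> borel_measurable (Pi\<^sub>M {..<t} (\<lambda>_. borel \<Otimes>\<^sub>M borel))"
        by (rule borel_measurable_T) auto
      show "(\<lambda>w. ennreal (T i 0 n (t - 1) w powr s)) \<in> borel_measurable (Pi\<^sub>M {..<t} (\<lambda>_. borel \<Otimes>\<^sub>M borel))"
        by measurable
      show "(\<lambda>p. ennreal ((b $ i + c $ i * fst p) powr s)) \<in> borel_measurable (borel \<Otimes>\<^sub>M (borel :: (real
          ^ 'd) measure))"
        by measurable
    qed (simp_all add: A_\<xi> Y_def T_restrict)
    also have "ennreal ((1 + \<kappa>) powr s) * ((\<integral>\<^sup>+\<omega>. ennreal (A i t \<omega> powr s) \<partial>P) * (\<integral>\<^sup>+\<omega>. ennreal (Y i n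
        (t - 1) \<omega> powr s) \<partial>P)) +
         ennreal ((1 + 1 / \<kappa>) powr s) * (\<integral>\<^sup>+\<omega>. ennreal ((Q t \<omega> $ i) powr s) \<partial>P) \<le>
       ennreal ((1 + \<kappa>) powr s) * (ennreal \<rho> * ennreal B) + ennreal ((1 + 1 / \<kappa>) powr s) * ennreal q"
      unfolding nn_integral_A_powr[of i t] nn_integral_Q_powr[of t] \<rho> q
      by (intro add_mono mult_left_mono Suc.IH) auto
    also have "\<dots> = ennreal (r * B + C)"
      unfolding r_def C_def using \<rho>(1) q(1) B(1) by (simp add: ennreal_mult ennreal_plus mult.assoc)
    finally show ?case by (simp only: B(2))
  qed (use s in simp)
  then show thesis using B(1) by (intro that[of B])
qed

text \<open>Multiplying the two one-step bounds gives a main term, contracted by the mixed moment of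
  the multipliers, and cross terms. Each cross term contains at most one of the two past powers, so
  the separate moments of the iterates bound it.\<close>

lemma Y_joint_moment:
  assumes pq: "0 < p" "0 < q"
    and A_joint: "(\<integral>\<^sup>+\<omega>. ennreal (A i 0 \<omega> powr p * A j 0 \<omega> powr q) \<partial>P) < 1"
    and A_i: "(\<integral>\<^sup>+\<omega>. ennreal (A i 0 \<omega> powr p) \<partial>P) < 1" "(\<integral>\<^sup>+\<omega>. ennreal (A i 0 \<omega> powr (2 * p)) \<partial>P) < \<infinity>"
    and A_j: "(\<integral>\<^sup>+\<omega>. ennreal (A j 0 \<omega> powr q) \<partial>P) < 1" "(\<integral>\<^sup>+\<omega>. ennreal (A j 0 \<omega> powr (2 * q)) \<partial>P) < \<infinity>"
    and Q_i: "(\<integral>\<^sup>+\<omega>. ennreal ((Q 0 \<omega> $ i) powr p) \<partial>P) < \<infinity>" "(\<integral>\<^sup>+\<omega>. ennreal ((Q 0 \<omega> $ i) powr (2 * p))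
        \<partial>P) < \<infinity>"
    and Q_j: "(\<integral>\<^sup>+\<omega>. ennreal ((Q 0 \<omega> $ j) powr q) \<partial>P) < \<infinity>" "(\<integral>\<^sup>+\<omega>. ennreal ((Q 0 \<omega> $ j) powr (2 * q))
        \<partial>P) < \<infinity>"
  obtains B where "0 \<le> B" "\<And>n t. (\<integral>\<^sup>+\<omega>. ennreal (Y i n t \<omega> powr p * Y j n t \<omega> powr q) \<partial>P) \<le> ennreal B"
proof -
  obtain \<rho> where \<rho>: "0 \<le> \<rho>" "(\<integral>\<^sup>+\<omega>. ennreal (A i 0 \<omega> powr p * A j 0 \<omega> powr q) \<partial>P) = ennreal \<rho>"
    using A_joint by (cases "\<integral>\<^sup>+\<omega>. ennreal (A i 0 \<omega> powr p * A j 0 \<omega> powr q) \<partial>P") auto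
  have \<rho>1: "\<rho> < 1" using A_joint \<rho> by simp
  \<comment> \<open>Both factors of the product are inflated, hence the exponent p + q.\<close>
  obtain \<kappa> where \<kappa>: "0 < \<kappa>" "(1 + \<kappa>) powr (p + q) * \<rho> < 1" using inflation_factor[OF \<rho>1] .
  obtain Bi where Bi: "0 \<le> Bi" "\<And>n t. (\<integral>\<^sup>+\<omega>. ennreal (Y i n t \<omega> powr p) \<partial>P) \<le> ennreal Bi"
    by (rule Y_moment[OF pq(1) A_i(1) Q_i(1)]) (rule that)
  obtain Bj where Bj: "0 \<le> Bj" "\<And>n t. (\<integral>\<^sup>+\<omega>. ennreal (Y j n t \<omega> powr q) \<partial>P) \<le> ennreal Bj"
    by (rule Y_moment[OF pq(2) A_j(1) Q_j(1)]) (rule that)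
  \<comment> \<open>One variable dominating every mixed product of noise powers at time t. The
    components of Q may be dependent, so products are split into doubled powers, whose moments are
    assumed finite.\<close>
  define N where "N t \<omega> = A i t \<omega> powr (2 * p) + A j t \<omega> powr (2 * q) + (Q t \<omega> $ i) powr (2 * p) + (Q t
      \<omega> $ j) powr (2 * q)" for t \<omega>
  have N_nonneg: "0 \<le> N t \<omega>" for t \<omega> by (simp add: N_def)
  have [measurable]: "N t \<in> borel_measurable P" for t unfolding N_def by measurable
  have N_int: "(\<integral>\<^sup>+\<omega>. ennreal (N t \<omega>) \<partial>P) = (\<integral>\<^sup>+\<omega>. ennreal (A i 0 \<omega> powr (2 * p)) \<partial>P) +
      (\<integral>\<^sup>+\<omega>. ennreal (A j 0 \<omega> powr (2 * q)) \<partial>P) + (\<integral>\<^sup>+\<omega>. ennreal ((Q 0 \<omega> $ i) powr (2 * p)) \<partial>P) +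
      (\<integral>\<^sup>+\<omega>. ennreal ((Q 0 \<omega> $ j) powr (2 * q)) \<partial>P)" for t
    unfolding N_def nn_integral_A_powr[of _ t, symmetric] nn_integral_Q_powr[of t, symmetric]
    by (simp add: nn_integral_add ennreal_plus)
  define m where "m = enn2real (\<integral>\<^sup>+\<omega>. ennreal (N 0 \<omega>) \<partial>P)"
  have m: "0 \<le> m" "(\<integral>\<^sup>+\<omega>. ennreal (N t \<omega>) \<partial>P) = ennreal m" for t
    using A_i(2) A_j(2) Q_i(2) Q_j(2) by (simp_all add: m_def N_int)
  define k1 where "k1 = (1 + \<kappa>) powr p"
  define k2 where "k2 = (1 + \<kappa>) powr q"
  define c1 where "c1 = (1 + 1 / \<kappa>) powr p"
  define c2 where "c2 = (1 + 1 / \<kappa>) powr q"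
  have kc: "0 \<le> k1" "0 \<le> k2" "0 \<le> c1" "0 \<le> c2" by (auto simp: k1_def k2_def c1_def c2_def)
  define D where "D = k1 * c2 + c1 * k2 + c1 * c2"
  have D: "0 \<le> D" using kc by (simp add: D_def)
  define r where "r = k1 * k2 * \<rho>"
  have r: "0 \<le> r" "r < 1" using kc \<rho> \<kappa> by (auto simp: r_def k1_def k2_def powr_add[symmetric])
  define C where "C = D * (m * (Bi + Bj + 1))"
  have C: "0 \<le> C" using D m(1) Bi(1) Bj(1) by (simp add: C_def)
  define B where "B = C / (1 - r)"
  have B: "0 \<le> B" "r * B + C = B" using r C by (auto simp: B_def field_simps)
  have "(\<integral>\<^sup>+\<omega>. ennreal (Y i n t \<omega> powr p * Y j n t \<omega> powr q) \<partial>P) \<le> ennreal B" for n t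
  proof (induction n arbitrary: t)
    case (Suc n)
    have T_meas [measurable]: "T l 0 n (t - 1) \<in> borel_measurable (Pi\<^sub>M {..<t} (\<lambda>_. borel \<Otimes>\<^sub>M borel))" for l
      by (rule borel_measurable_T) auto
    let ?Y = "\<lambda>\<omega>. Y i n (t - 1) \<omega> powr p * Y j n (t - 1) \<omega> powr q"
    let ?S = "\<lambda>\<omega>. Y i n (t - 1) \<omega> powr p + Y j n (t - 1) \<omega> powr q + 1"
    have "AE \<omega> in P. ennreal (Y i (Suc n) t \<omega> powr p * Y j (Suc n) t \<omega> powr q) \<le>
      ennreal (k1 * k2) * (ennreal (A i t \<omega> powr p * A j t \<omega> powr q) * ennreal (?Y \<omega>)) + ennreal D *
          (ennreal (N t \<omega>) * ennreal (?S \<omega>))"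
      using AE_pos[of i] AE_pos[of j]
    proof eventually_elim
      case (elim \<omega>)
      let ?yi = "Y i n (t - 1) \<omega> powr p" and ?yj = "Y j n (t - 1) \<omega> powr q"
      let ?ai = "A i t \<omega> powr p" and ?aj = "A j t \<omega> powr q"
      let ?qi = "(Q t \<omega> $ i) powr p" and ?qj = "(Q t \<omega> $ j) powr q"
      have Y: "0 \<le> Y i n (t - 1) \<omega>" "0 \<le> Y j n (t - 1) \<omega>" by (rule Y_nonneg, use elim in auto)+
      have AQ: "0 < A i t \<omega>" "0 < A j t \<omega>" "0 < Q t \<omega> $ i" "0 < Q t \<omega> $ j" using elim by auto
      have i: "Y i (Suc n) t \<omega> powr p \<le> k1 * (?ai * ?yi) + c1 * ?qi"
        using powr_add_le[of "A i t \<omega> * Y i n (t - 1) \<omega>" "Q t \<omega> $ i" p \<kappa>] AQ Y pq \<kappa>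
        by (simp add: k1_def c1_def powr_mult less_imp_le)
      have j: "Y j (Suc n) t \<omega> powr q \<le> k2 * (?aj * ?yj) + c2 * ?qj"
        using powr_add_le[of "A j t \<omega> * Y j n (t - 1) \<omega>" "Q t \<omega> $ j" q \<kappa>] AQ Y pq \<kappa>
        by (simp add: k2_def c2_def powr_mult less_imp_le)
      have Ns: "?ai * ?qj \<le> N t \<omega>" "?qi * ?aj \<le> N t \<omega>" "?qi * ?qj \<le> N t \<omega>"
        using powr_mult_le_powr_add[of "A i t \<omega>" "Q t \<omega> $ j" p q] powr_mult_le_powr_add[of "Q t \<omega> $ i"
            "A j t \<omega>" p q]
          powr_mult_le_powr_add[of "Q t \<omega> $ i" "Q t \<omega> $ j" p q] AQ
          powr_ge_zero[of "A i t \<omega>" "2 * p"] powr_ge_zero[of "A j t \<omega>" "2 * q"]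
          powr_ge_zero[of "Q t \<omega> $ i" "2 * p"] powr_ge_zero[of "Q t \<omega> $ j" "2 * q"]
        unfolding N_def by linarith+
      have "Y i (Suc n) t \<omega> powr p * Y j (Suc n) t \<omega> powr q \<le> (k1 * (?ai * ?yi) + c1 * ?qi) * (k2 * (?aj
          * ?yj) + c2 * ?qj)"
        using kc by (intro mult_mono i j) auto
      also have "\<dots> = k1 * k2 * (?ai * ?aj * (?yi * ?yj)) + (k1 * c2) * ((?ai * ?qj) * ?yi) + (c1 * k2) *
          ((?qi * ?aj) * ?yj) + (c1 * c2) * ((?qi * ?qj) * 1)"
        by (simp add: algebra_simps)
      also have "\<dots> \<le> k1 * k2 * (?ai * ?aj * (?yi * ?yj)) + (k1 * c2) * (N t \<omega> * ?S \<omega>) + (c1 * k2) * (N t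
          \<omega> * ?S \<omega>) + (c1 * c2) * (N t \<omega> * ?S \<omega>)"
        using kc N_nonneg[of t \<omega>] by (intro add_mono order_refl mult_left_mono mult_mono Ns) auto
      also have "\<dots> = k1 * k2 * (?ai * ?aj * (?yi * ?yj)) + D * (N t \<omega> * ?S \<omega>)"
        by (simp add: D_def algebra_simps)
      finally have le: "Y i (Suc n) t \<omega> powr p * Y j (Suc n) t \<omega> powr q \<le> k1 * k2 * (?ai * ?aj * (?yi *
          ?yj)) + D * (N t \<omega> * ?S \<omega>)" .
      have S: "0 \<le> ?S \<omega>" by (intro add_nonneg_nonneg) auto
      have "ennreal (k1 * k2 * (?ai * ?aj * (?yi * ?yj)) + D * (N t \<omega> * ?S \<omega>)) =
         ennreal (k1 * k2) * (ennreal (?ai * ?aj) * ennreal (?yi * ?yj)) + ennreal D * (ennreal (N t \<omega>)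
             * ennreal (?S \<omega>))"
        using kc D N_nonneg[of t \<omega>] S
        by (subst ennreal_plus) (auto simp: ennreal_mult simp del: ennreal_plus)
      then show ?case using ennreal_leI[OF le] by simp
    qed
    then have "(\<integral>\<^sup>+\<omega>. ennreal (Y i (Suc n) t \<omega> powr p * Y j (Suc n) t \<omega> powr q) \<partial>P) \<le>
       (\<integral>\<^sup>+\<omega>. ennreal (k1 * k2) * (ennreal (A i t \<omega> powr p * A j t \<omega> powr q) * ennreal (?Y \<omega>)) + ennreal
           D * (ennreal (N t \<omega>) * ennreal (?S \<omega>)) \<partial>P)"
      by (rule nn_integral_mono_AE)
    also have "\<dots> = ennreal (k1 * k2) * (\<integral>\<^sup>+\<omega>. ennreal (A i t \<omega> powr p * A j t \<omega> powr q) * ennreal (?Y \<omega>) \<partial>P)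
        + ennreal D * (\<integral>\<^sup>+\<omega>. ennreal (N t \<omega>) * ennreal (?S \<omega>) \<partial>P)"
      by (subst nn_integral_add) (auto simp: nn_integral_cmult)
    also have "(\<integral>\<^sup>+\<omega>. ennreal (A i t \<omega> powr p * A j t \<omega> powr q) * ennreal (?Y \<omega>) \<partial>P) =
       (\<integral>\<^sup>+\<omega>. ennreal (A i t \<omega> powr p * A j t \<omega> powr q) \<partial>P) * (\<integral>\<^sup>+\<omega>. ennreal (?Y \<omega>) \<partial>P)"
    proof (rule nn_integral_present_past)
      show "(\<lambda>w. ennreal (T i 0 n (t - 1) w powr p * T j 0 n (t - 1) w powr q)) \<in> borel_measurable (Pi\<^sub>M
          {..<t} (\<lambda>_. borel \<Otimes>\<^sub>M borel))"
        by measurable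
      show "(\<lambda>x. ennreal ((b $ i + c $ i * fst x) powr p * (b $ j + c $ j * fst x) powr q)) \<in>
          borel_measurable (borel \<Otimes>\<^sub>M (borel :: (real ^ 'd) measure))"
        by measurable
    qed (simp_all add: A_\<xi> Y_def T_restrict)
    also have "(\<integral>\<^sup>+\<omega>. ennreal (N t \<omega>) * ennreal (?S \<omega>) \<partial>P) = (\<integral>\<^sup>+\<omega>. ennreal (N t \<omega>) \<partial>P) * (\<integral>\<^sup>+\<omega>. ennreal
        (?S \<omega>) \<partial>P)"
    proof (rule nn_integral_present_past)
      show "(\<lambda>w. ennreal (T i 0 n (t - 1) w powr p + T j 0 n (t - 1) w powr q + 1)) \<in> borel_measurable
          (Pi\<^sub>M {..<t} (\<lambda>_. borel \<Otimes>\<^sub>M borel))"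
        by measurable
      show "(\<lambda>x. ennreal ((b $ i + c $ i * fst x) powr (2 * p) + (b $ j + c $ j * fst x) powr (2 * q) +
          (snd x $ i) powr (2 * p) + (snd x $ j) powr (2 * q)))
         \<in> borel_measurable (borel \<Otimes>\<^sub>M (borel :: (real ^ 'd) measure))"
        by measurable
      show "ennreal (N t \<omega>) = ennreal ((b $ i + c $ i * fst (\<xi> t \<omega>)) powr (2 * p) + (b $ j + c $ j * fst
          (\<xi> t \<omega>)) powr (2 * q) +
          (snd (\<xi> t \<omega>) $ i) powr (2 * p) + (snd (\<xi> t \<omega>) $ j) powr (2 * q))" for \<omega>
        by (simp add: A_\<xi> N_def) (simp add: \<xi>_def)
    qed (simp_all add: Y_def T_restrict)
    also have "(\<integral>\<^sup>+\<omega>. ennreal (A i t \<omega> powr p * A j t \<omega> powr q) \<partial>P) = ennreal \<rho>"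
      unfolding \<rho>(2)[symmetric] A_def
      by (rule nn_integral_law_M[of "\<lambda>x. ennreal ((b $ i + c $ i * x) powr p * (b $ j + c $ j * x) powr
          q)"]) simp
    also have "(\<integral>\<^sup>+\<omega>. ennreal (?S \<omega>) \<partial>P) = (\<integral>\<^sup>+\<omega>. ennreal (Y i n (t - 1) \<omega> powr p) \<partial>P) + (\<integral>\<^sup>+\<omega>. ennreal
        (Y j n (t - 1) \<omega> powr q) \<partial>P) + 1"
      by (simp add: nn_integral_add ennreal_plus emeasure_space_1)
    also have "ennreal (k1 * k2) * (ennreal \<rho> * (\<integral>\<^sup>+\<omega>. ennreal (?Y \<omega>) \<partial>P)) + ennreal D * ((\<integral>\<^sup>+\<omega>. ennreal
        (N t \<omega>) \<partial>P) *
        ((\<integral>\<^sup>+\<omega>. ennreal (Y i n (t - 1) \<omega> powr p) \<partial>P) + (\<integral>\<^sup>+\<omega>. ennreal (Y j n (t - 1) \<omega> powr q) \<partial>P) + 1)) \<le>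
      ennreal (k1 * k2) * (ennreal \<rho> * ennreal B) + ennreal D * (ennreal m * (ennreal Bi + ennreal Bj + 1))"
      unfolding m(2) by (intro add_mono mult_left_mono Suc.IH Bi(2) Bj(2) order_refl) auto
    also have "\<dots> = ennreal (r * B + C)"
    proof -
      have "ennreal (k1 * k2) * (ennreal \<rho> * ennreal B) = ennreal (r * B)"
        unfolding r_def using kc \<rho>(1) B(1) by (simp add: ennreal_mult mult.assoc)
      moreover have "ennreal D * (ennreal m * (ennreal Bi + ennreal Bj + 1)) = ennreal C"
        unfolding C_def using D m(1) Bi(1) Bj(1) by (simp add: ennreal_mult ennreal_plus)
      ultimately show ?thesis using r(1) B(1) C by (simp add: ennreal_plus)
    qed
    finally show ?case by (simp only: B(2))
  qed simp
  then show thesis using B(1) by (intro that[of B])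
qed


section \<open>Convergence of the iterates to the stationary solution\<close>

lemma law_X: "distr P borel (X t) = distr P borel (X 0)"
proof -
  have [measurable]: "(\<lambda>\<omega> s. X (s + h) \<omega>) \<in> measurable P (Pi\<^sub>M UNIV (\<lambda>_. borel))" for h
    by (rule measurable_PiM_single') (auto simp: space_PiM)
  have shift: "distr (distr P (Pi\<^sub>M UNIV (\<lambda>_. borel)) (\<lambda>\<omega> s. X (s + h) \<omega>)) borel (\<lambda>f. f 0) = distr P
      borel (X h)" for h
    by (subst distr_distr) (auto simp: comp_def)
  have "distr P (Pi\<^sub>M UNIV (\<lambda>_. borel)) (\<lambda>\<omega> s. X (s + t) \<omega>) = distr P (Pi\<^sub>M UNIV (\<lambda>_. borel)) (\<lambda>\<omega> s. X
      (s + 0) \<omega>)"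
    using solution by (simp add: stationary_solution_def stationary_def)
  then show ?thesis using shift[of t] shift[of 0] by simp
qed

lemma AE_recursion: "AE \<omega> in P. \<forall>t. X t \<omega> $ i = A i t \<omega> * X (t - 1) \<omega> $ i + Q t \<omega> $ i"
proof -
  have "(Diag v *v x) $ i = v $ i * x $ i" for v x :: "real ^ 'd"
    by (simp add: Diag_def matrix_vector_mult_def if_distrib[of "\<lambda>y. y * _"] sum.delta cong: if_cong)
  then have "AE \<omega> in P. X t \<omega> $ i = A i t \<omega> * X (t - 1) \<omega> $ i + Q t \<omega> $ i" for t
    using solution unfolding stationary_solution_def by (auto simp: A_def elim!: allE[of _ t]
        eventually_mono)
  then show ?thesis by (simp add: AE_all_countable)
qed

text \<open>Solution and iterate obey the same affine recursion, so the additive noise cancels and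
  the initial difference X (t - n) - 0 is multiplied along.\<close>

lemma X_minus_Y:
  assumes "\<And>t. X t \<omega> $ i = A i t \<omega> * X (t - 1) \<omega> $ i + Q t \<omega> $ i"
  shows "X t \<omega> $ i - Y i n t \<omega> = R i n t \<omega> * X (t - int n) \<omega> $ i"
proof (induction n arbitrary: t)
  case (Suc n)
  have "X t \<omega> $ i - Y i (Suc n) t \<omega> = A i t \<omega> * (X (t - 1) \<omega> $ i - Y i n (t - 1) \<omega>)"
    by (subst assms) (simp add: algebra_simps)
  also have "\<dots> = R i (Suc n) t \<omega> * X (t - int (Suc n)) \<omega> $ i"
    by (subst Suc.IH) (simp add: algebra_simps)
  finally show ?case .
qed simp

text \<open>The error is a product of n multipliers times X (t - n). Stationarity makes the second
  factor tight uniformly in n, while a fractional moment of the first decays geometrically.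
  Truncation at 1 expresses convergence in probability when no moment of X is known.\<close>

lemma Y_tendsto_X_in_prob:
  assumes s: "0 < s" "s \<le> 1" and A: "(\<integral>\<^sup>+\<omega>. ennreal (A i 0 \<omega> powr s) \<partial>P) < 1"
  shows "(\<lambda>n. expectation (\<lambda>\<omega>. min 1 \<bar>X t \<omega> $ i - Y i n t \<omega>\<bar>)) \<longlonglongrightarrow> 0"
proof (rule LIMSEQ_I)
  fix e :: real assume e: "0 < e"
  obtain \<rho> where \<rho>: "0 \<le> \<rho>" "(\<integral>\<^sup>+\<omega>. ennreal (A i 0 \<omega> powr s) \<partial>P) = ennreal \<rho>"
    using A by (cases "\<integral>\<^sup>+\<omega>. ennreal (A i 0 \<omega> powr s) \<partial>P") auto
  have \<rho>1: "\<rho> < 1" using A \<rho> by simp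
  have X_law: "prob {\<omega> \<in> space P. K < \<bar>X u \<omega> $ i\<bar>} = prob {\<omega> \<in> space P. K < \<bar>X 0 \<omega> $ i\<bar>}" for K u
  proof -
    have "measure (distr P borel (X u)) {x. K < \<bar>x $ i\<bar>} = prob {\<omega> \<in> space P. K < \<bar>X u \<omega> $ i\<bar>}" for u
      by (subst measure_distr) (auto intro!: arg_cong[where f = prob])
    from this[of u] this[of 0] show ?thesis by (simp only: law_X[of u])
  qed
  have "(\<lambda>k. prob {\<omega> \<in> space P. real k < \<bar>X 0 \<omega> $ i\<bar>}) \<longlonglongrightarrow> prob (\<Inter>k. {\<omega> \<in> space P. real k < \<bar>X 0 \<omega> $ i\<bar>})"
    by (rule finite_Lim_measure_decseq) (auto simp: decseq_def)
  moreover have "(\<Inter>k. {\<omega> \<in> space P. real k < \<bar>X 0 \<omega> $ i\<bar>}) = {}"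
  proof -
    have "\<exists>k. \<not> real k < \<bar>X 0 \<omega> $ i\<bar>" for \<omega> using real_arch_simple[of "\<bar>X 0 \<omega> $ i\<bar>"] by (auto simp:
        not_less)
    then show ?thesis by blast
  qed
  ultimately have "(\<lambda>k. prob {\<omega> \<in> space P. real k < \<bar>X 0 \<omega> $ i\<bar>}) \<longlonglongrightarrow> 0" by simp
  then have "\<forall>\<^sub>F k in sequentially. prob {\<omega> \<in> space P. real k < \<bar>X 0 \<omega> $ i\<bar>} < e / 2"
    by (rule order_tendstoD(2)) (use e in simp)
  then obtain k0 where k0: "\<And>k. k0 \<le> k \<Longrightarrow> prob {\<omega> \<in> space P. real k < \<bar>X 0 \<omega> $ i\<bar>} < e / 2"
    by (auto simp: eventually_sequentially)
  \<comment> \<open>The successor guarantees K > 0, also when k0 = 0.\<close>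
  define K where "K = real (Suc k0)"
  have K: "0 < K" "prob {\<omega> \<in> space P. K < \<bar>X 0 \<omega> $ i\<bar>} < e / 2" using k0[of "Suc k0"] by (auto simp: K_def)
  have "(\<lambda>n. K powr s * \<rho> ^ n) \<longlonglongrightarrow> K powr s * 0"
    using \<rho> \<rho>1 by (intro tendsto_mult tendsto_const LIMSEQ_realpow_zero) auto
  then have "\<forall>\<^sub>F n in sequentially. K powr s * \<rho> ^ n < e / 2"
    by (intro order_tendstoD(2)) (use e in auto)
  then obtain n0 where n0: "\<And>n. n0 \<le> n \<Longrightarrow> K powr s * \<rho> ^ n < e / 2"
    by (auto simp: eventually_sequentially)
  have "norm (expectation (\<lambda>\<omega>. min 1 \<bar>X t \<omega> $ i - Y i n t \<omega>\<bar>) - 0) < e" if "n0 \<le> n" for n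
  proof -
    let ?u = "t - int n"
    have int: "integrable P (\<lambda>\<omega>. min 1 \<bar>X t \<omega> $ i - Y i n t \<omega>\<bar>)"
      by (rule integrable_const_bound[of _ 1]) auto
    have "AE \<omega> in P. ennreal (min 1 \<bar>X t \<omega> $ i - Y i n t \<omega>\<bar>) \<le>
       indicator {\<omega> \<in> space P. K < \<bar>X ?u \<omega> $ i\<bar>} \<omega> + ennreal (K powr s) * ennreal (R i n t \<omega> powr s)"
      using AE_recursion[of i] AE_pos[of i] AE_space
    proof eventually_elim
      case (elim \<omega>)
      have R: "0 \<le> R i n t \<omega>" by (rule R_nonneg) (use elim(2) in auto)
      have "\<bar>X t \<omega> $ i - Y i n t \<omega>\<bar> = R i n t \<omega> * \<bar>X ?u \<omega> $ i\<bar>"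
        unfolding X_minus_Y[OF elim(1)[rule_format]] by (simp add: abs_mult R)
      then have "min 1 \<bar>X t \<omega> $ i - Y i n t \<omega>\<bar> \<le> of_bool (K < \<bar>X ?u \<omega> $ i\<bar>) + K powr s * R i n t \<omega> powr s"
        using min_1_mult_le[OF R abs_ge_zero K(1) s, of "X ?u \<omega> $ i"] by simp
      then have "ennreal (min 1 \<bar>X t \<omega> $ i - Y i n t \<omega>\<bar>) \<le> ennreal (of_bool (K < \<bar>X ?u \<omega> $ i\<bar>) + K powr
          s * R i n t \<omega> powr s)"
        by (rule ennreal_leI)
      also have "\<dots> = indicator {\<omega> \<in> space P. K < \<bar>X ?u \<omega> $ i\<bar>} \<omega> + ennreal (K powr s) * ennreal (R i n t
          \<omega> powr s)"
        using elim(3) by (auto simp: indicator_def ennreal_mult ennreal_plus)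
      finally show ?case .
    qed
    then have "(\<integral>\<^sup>+\<omega>. ennreal (min 1 \<bar>X t \<omega> $ i - Y i n t \<omega>\<bar>) \<partial>P) \<le>
       (\<integral>\<^sup>+\<omega>. indicator {\<omega> \<in> space P. K < \<bar>X ?u \<omega> $ i\<bar>} \<omega> + ennreal (K powr s) * ennreal (R i n t \<omega> powr
           s) \<partial>P)"
      by (rule nn_integral_mono_AE)
    also have "\<dots> = emeasure P {\<omega> \<in> space P. K < \<bar>X ?u \<omega> $ i\<bar>} + ennreal (K powr s) * (\<integral>\<^sup>+\<omega>. ennreal (R i
        n t \<omega> powr s) \<partial>P)"
      by (subst nn_integral_add) (auto simp: nn_integral_cmult)
    also have "\<dots> \<le> ennreal (prob {\<omega> \<in> space P. K < \<bar>X 0 \<omega> $ i\<bar>}) + ennreal (K powr s) * ennreal (\<rho> ^ n)"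
      unfolding emeasure_eq_measure X_law[of K ?u]
      by (intro add_mono mult_left_mono R_moment order_refl) (use \<rho> in auto)
    also have "\<dots> = ennreal (prob {\<omega> \<in> space P. K < \<bar>X 0 \<omega> $ i\<bar>} + K powr s * \<rho> ^ n)"
      using \<rho> by (simp add: ennreal_plus ennreal_mult)
    finally have "expectation (\<lambda>\<omega>. min 1 \<bar>X t \<omega> $ i - Y i n t \<omega>\<bar>) \<le> prob {\<omega> \<in> space P. K < \<bar>X 0 \<omega> $ i\<bar>}
        + K powr s * \<rho> ^ n"
      using \<rho>(1) by (subst (asm) nn_integral_eq_integral[OF int]) (auto simp del: ennreal_plus)
    also have "\<dots> < e" using K(2) n0[OF that] by simp
    finally show ?thesis by simp
  qed
  then show "\<exists>no. \<forall>n\<ge>no. norm (expectation (\<lambda>\<omega>. min 1 \<bar>X t \<omega> $ i - Y i n t \<omega>\<bar>) - 0) < e" by blast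
qed

text \<open>Mean convergence of the truncated errors gives almost sure convergence along a
  subsequence. Summing over the coordinates first produces one subsequence for all of them.\<close>

lemma Y_tendsto_X_subseq:
  assumes "\<And>i. \<exists>s. 0 < s \<and> s \<le> 1 \<and> (\<integral>\<^sup>+\<omega>. ennreal (A i 0 \<omega> powr s) \<partial>P) < 1"
  obtains r :: "nat \<Rightarrow> nat" where "strict_mono r" "AE \<omega> in P. \<forall>i. (\<lambda>k. Y i (r k) t \<omega>) \<longlonglongrightarrow> X t \<omega> $ i"
proof -
  let ?u = "\<lambda>n \<omega>. \<Sum>i\<in>UNIV. min 1 \<bar>X t \<omega> $ i - Y i n t \<omega>\<bar>"
  have int: "integrable P (\<lambda>\<omega>. min 1 \<bar>X t \<omega> $ i - Y i n t \<omega>\<bar>)" for i n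
    by (rule integrable_const_bound[of _ 1]) auto
  have "(\<lambda>n. expectation (\<lambda>\<omega>. min 1 \<bar>X t \<omega> $ i - Y i n t \<omega>\<bar>)) \<longlonglongrightarrow> 0" for i
  proof -
    obtain s where "0 < s" "s \<le> 1" "(\<integral>\<^sup>+\<omega>. ennreal (A i 0 \<omega> powr s) \<partial>P) < 1" using assms[of i] by blast
    then show ?thesis by (rule Y_tendsto_X_in_prob)
  qed
  then have "(\<lambda>n. \<Sum>i\<in>UNIV. expectation (\<lambda>\<omega>. min 1 \<bar>X t \<omega> $ i - Y i n t \<omega>\<bar>)) \<longlonglongrightarrow> (\<Sum>i\<in>(UNIV::'d set). 0)"
    by (intro tendsto_sum)
  moreover have "expectation (\<lambda>\<omega>. norm (?u n \<omega>)) = (\<Sum>i\<in>UNIV. expectation (\<lambda>\<omega>. min 1 \<bar>X t \<omega> $ i - Y i n t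
      \<omega>\<bar>))" for n
  proof -
    have "expectation (\<lambda>\<omega>. norm (?u n \<omega>)) = expectation (?u n)"
      by (intro Bochner_Integration.integral_cong refl) (simp add: sum_nonneg)
    then show ?thesis by (simp only: Bochner_Integration.integral_sum[OF int])
  qed
  ultimately have "(\<lambda>n. expectation (\<lambda>\<omega>. norm (?u n \<omega>))) \<longlonglongrightarrow> 0" by simp
  from tendsto_L1_AE_subseq[OF _ this]
  obtain r where r: "strict_mono r" "AE \<omega> in P. (\<lambda>k. ?u (r k) \<omega>) \<longlonglongrightarrow> 0" using int by auto
  have "AE \<omega> in P. \<forall>i. (\<lambda>k. Y i (r k) t \<omega>) \<longlonglongrightarrow> X t \<omega> $ i"
    using r(2)
  proof eventually_elim
    case (elim \<omega>)
    show ?case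
    proof
      fix i
      have "(\<lambda>k. min 1 \<bar>X t \<omega> $ i - Y i (r k) t \<omega>\<bar>) \<longlonglongrightarrow> 0"
      proof (rule tendsto_sandwich[OF _ _ tendsto_const elim])
        have "min 1 \<bar>X t \<omega> $ i - Y i (r k) t \<omega>\<bar> \<le> ?u (r k) \<omega>" for k
          by (rule member_le_sum[of i UNIV "\<lambda>i. min 1 \<bar>X t \<omega> $ i - Y i (r k) t \<omega>\<bar>"]) auto
        then show "\<forall>\<^sub>F k in sequentially. min 1 \<bar>X t \<omega> $ i - Y i (r k) t \<omega>\<bar> \<le> ?u (r k) \<omega>"
          by (intro always_eventually allI)
      qed simp
      \<comment> \<open>Once the truncated error is below 1, the truncation is inactive.\<close>
      then have "\<forall>\<^sub>F k in sequentially. min 1 \<bar>X t \<omega> $ i - Y i (r k) t \<omega>\<bar> < 1"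
        by (rule order_tendstoD(2)) simp
      then have "\<forall>\<^sub>F k in sequentially. min 1 \<bar>X t \<omega> $ i - Y i (r k) t \<omega>\<bar> = \<bar>X t \<omega> $ i - Y i (r k) t \<omega>\<bar>"
        by eventually_elim (auto simp: min_def split: if_splits)
      with \<open>(\<lambda>k. min 1 \<bar>X t \<omega> $ i - Y i (r k) t \<omega>\<bar>) \<longlonglongrightarrow> 0\<close>
      have "(\<lambda>k. \<bar>X t \<omega> $ i - Y i (r k) t \<omega>\<bar>) \<longlonglongrightarrow> 0"
        by (rule Lim_transform_eventually)
      then have "(\<lambda>k. X t \<omega> $ i - (X t \<omega> $ i - Y i (r k) t \<omega>)) \<longlonglongrightarrow> X t \<omega> $ i - 0"
        by (intro tendsto_diff tendsto_const) (simp add: tendsto_rabs_zero_iff)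
      then show "(\<lambda>k. Y i (r k) t \<omega>) \<longlonglongrightarrow> X t \<omega> $ i" by simp
    qed
  qed
  then show thesis using r(1) that by blast
qed

text \<open>\<open>X (- 1)\<close> itself need not be measurable with respect to the past noise, only its almost sure
  version \<open>Z\<close> is.\<close>

lemma past_version:
  assumes "\<And>i. \<exists>s. 0 < s \<and> s \<le> 1 \<and> (\<integral>\<^sup>+\<omega>. ennreal (A i 0 \<omega> powr s) \<partial>P) < 1"
  obtains Z :: "'d \<Rightarrow> 'w \<Rightarrow> real" and r :: "nat \<Rightarrow> nat" where
    "\<And>i. Z i \<in> borel_measurable P"
    "\<And>i. AE \<omega> in P. Z i \<omega> = X (- 1) \<omega> $ i"
    "\<And>i. AE \<omega> in P. 0 < Z i \<omega>"
    "\<And>i. AE \<omega> in P. (\<lambda>k. Y i (r k) (- 1) \<omega>) \<longlonglongrightarrow> Z i \<omega>"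
    "\<And>i F. F \<in> borel_measurable (borel \<Otimes>\<^sub>M borel) \<Longrightarrow> indep_var borel (\<lambda>\<omega>. F (\<xi> 0 \<omega>)) borel (Z i)"
proof -
  obtain r :: "nat \<Rightarrow> nat" where r: "strict_mono r" "AE \<omega> in P. \<forall>i. (\<lambda>k. Y i (r k) (- 1) \<omega>) \<longlonglongrightarrow> X (- 1) \<omega> $ i"
    using Y_tendsto_X_subseq[OF assms] .
  \<comment> \<open>A pointwise \<open>lim\<close> of functionals of the noise before time 0 is
    again such a functional at every sample point; the equality with X (- 1) holds only almost
    surely.\<close>
  define Z where "Z i \<omega> = lim (\<lambda>k. Y i (r k) (- 1) \<omega>)" for i \<omega>
  have meas: "Z i \<in> borel_measurable P" for i
    unfolding Z_def by measurable
  have ZX: "AE \<omega> in P. Z i \<omega> = X (- 1) \<omega> $ i" for i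
    using r(2) by eventually_elim (auto simp: Z_def intro: limI)
  have lim: "AE \<omega> in P. (\<lambda>k. Y i (r k) (- 1) \<omega>) \<longlonglongrightarrow> Z i \<omega>" for i
    using r(2) ZX[of i] by eventually_elim auto
  have pos: "AE \<omega> in P. 0 < Z i \<omega>" for i
    using lim[of i] AE_pos[of i]
  proof eventually_elim
    case (elim \<omega>)
    \<comment> \<open>Limits of nonnegative iterates are only nonnegative; the newest noise term is
      a strictly positive lower bound common to all iterates with at least one step.\<close>
    have "Q (- 1) \<omega> $ i \<le> Y i (r k) (- 1) \<omega>" if k: "1 \<le> k" for k
    proof -
      have "k \<le> r k" using r(1) by (rule seq_suble)
      then obtain n where n: "r k = Suc n" using k by (cases "r k") auto
      have "0 \<le> Y i n (- 1 - 1) \<omega>" by (rule Y_nonneg) (use elim(2) in auto)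
      then show ?thesis using elim(2) unfolding n Y_Suc by (simp add: less_imp_le)
    qed
    then have "Q (- 1) \<omega> $ i \<le> Z i \<omega>"
      by (intro LIMSEQ_le_const[OF elim(1)]) blast
    then show ?case using elim(2) by (metis order_less_le_trans)
  qed
  have ind: "indep_var borel (\<lambda>\<omega>. F (\<xi> 0 \<omega>)) borel (Z i)" if F: "F \<in> borel_measurable (borel \<Otimes>\<^sub>M borel)"
      for i F
  proof -
    have [measurable]: "T i 0 n (- 1) \<in> borel_measurable (Pi\<^sub>M {..<0} (\<lambda>_. borel \<Otimes>\<^sub>M borel))" for n
      by (rule borel_measurable_T) auto
    have "(\<lambda>w. lim (\<lambda>k. T i 0 (r k) (- 1) w)) \<in> borel_measurable (Pi\<^sub>M {..<0} (\<lambda>_. borel \<Otimes>\<^sub>M borel))"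
      by measurable
    from indep_present_past[OF F this] show ?thesis
      by (simp add: Z_def[abs_def] T_restrict Y_def)
  qed
  show thesis by (rule that[OF meas ZX pos lim ind])
qed

section \<open>Moments of the multipliers and the tail of one coordinate\<close>

lemma AE_A_eq_exp: "AE \<omega> in P. A i t \<omega> powr s = exp (s * ln (A i t \<omega>))"
  using AE_pos[of i] by eventually_elim (metis less_irrefl powr_def)

lemma A_moment_less_1:
  assumes \<alpha>: "has_bochner_integral P (\<lambda>\<omega>. A i 0 \<omega> powr \<alpha>) 1" and nondeg: "\<not> (AE \<omega> in P. ln (A i 0 \<omega>) = 0)"
    and s: "0 < s" "s < \<alpha>"
  shows "(\<integral>\<^sup>+\<omega>. ennreal (A i 0 \<omega> powr s) \<partial>P) < 1"
proof -
  have "has_bochner_integral P (\<lambda>\<omega>. exp (\<alpha> * ln (A i 0 \<omega>))) 1"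
    using \<alpha> by (subst has_bochner_integral_cong_AE[symmetric, OF _ _ AE_A_eq_exp]) auto
  note E = expectation_exp_less_1[OF _ this nondeg s]
  have "(\<integral>\<^sup>+\<omega>. ennreal (A i 0 \<omega> powr s) \<partial>P) = (\<integral>\<^sup>+\<omega>. ennreal (exp (s * ln (A i 0 \<omega>))) \<partial>P)"
    by (rule nn_integral_cong_AE) (use AE_A_eq_exp[of i 0 s] in \<open>auto elim!: eventually_mono\<close>)
  also have "\<dots> = ennreal (expectation (\<lambda>\<omega>. exp (s * ln (A i 0 \<omega>))))"
    by (rule nn_integral_eq_integral) (use E(1) in auto)
  also have "\<dots> < 1" using E(2) by (simp add: ennreal_less_one_iff)
  finally show ?thesis .
qed

lemma A_moment_less_1_small:
  assumes "has_bochner_integral P (\<lambda>\<omega>. A i 0 \<omega> powr \<alpha>) 1" "\<not> (AE \<omega> in P. ln (A i 0 \<omega>) = 0)" "0 < \<alpha>"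
  shows "\<exists>s. 0 < s \<and> s \<le> 1 \<and> (\<integral>\<^sup>+\<omega>. ennreal (A i 0 \<omega> powr s) \<partial>P) < 1"
  by (rule exI[of _ "min 1 (\<alpha> / 2)"], intro conjI A_moment_less_1[OF assms(1,2)]) (use assms(3) in auto)

lemma integrable_A_powr:
  assumes "0 < s" "integrable P (\<lambda>\<omega>. \<bar>M 0 \<omega>\<bar> powr s)"
  shows "integrable P (\<lambda>\<omega>. A i 0 \<omega> powr s)"
proof (rule Bochner_Integration.integrable_bound[of _ "\<lambda>\<omega>. (1 + 1) powr s * (b $ i) powr s + (1 + 1 / 1)
    powr s * ((c $ i) powr s * \<bar>M 0 \<omega>\<bar> powr s)"])
  show "AE \<omega> in P. norm (A i 0 \<omega> powr s) \<le> norm ((1 + 1) powr s * (b $ i) powr s + (1 + 1 / 1) powr s *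
      ((c $ i) powr s * \<bar>M 0 \<omega>\<bar> powr s))"
    using pos_0
  proof eventually_elim
    case (elim \<omega>)
    then have "A i 0 \<omega> powr s \<le> (1 + 1) powr s * (b $ i) powr s + (1 + 1 / 1) powr s * (c $ i * M 0 \<omega>)
        powr s"
      unfolding A_def using b_nonneg[of i] c_pos[of i] assms(1)
      by (intro powr_add_le) (auto intro!: mult_nonneg_nonneg simp: less_imp_le)
    also have "(c $ i * M 0 \<omega>) powr s = (c $ i) powr s * \<bar>M 0 \<omega>\<bar> powr s"
      using elim c_pos[of i] by (simp add: powr_mult less_imp_le)
    finally show ?case by simp
  qed
qed (use assms(2) in auto)

theorem marginal_tail:
  assumes \<alpha>: "0 < \<alpha>" "has_bochner_integral P (\<lambda>\<omega>. A i 0 \<omega> powr \<alpha>) 1"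
    and nonlattice: "\<And>h. 0 < h \<Longrightarrow> \<not> (AE \<omega> in P. ln (A i 0 \<omega>) \<in> range (\<lambda>k::int. h * of_int k))"
    and \<epsilon>: "0 < \<epsilon>" "integrable P (\<lambda>\<omega>. \<bar>M 0 \<omega>\<bar> powr (\<alpha> + \<epsilon>))" "integrable P (\<lambda>\<omega>. \<bar>Q 0 \<omega> $ i\<bar> powr (\<alpha> + \<epsilon>))"
    and contraction: "\<And>i. \<exists>s. 0 < s \<and> s \<le> 1 \<and> (\<integral>\<^sup>+\<omega>. ennreal (A i 0 \<omega> powr s) \<partial>P) < 1"
  shows "\<exists>a>0. ((\<lambda>x. x powr \<alpha> * prob {\<omega> \<in> space P. x < X 0 \<omega> $ i}) \<longlongrightarrow> a) at_top"
proof -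
  obtain Z r where Z_meas: "\<And>i. Z i \<in> borel_measurable P"
    and Z_X: "\<And>i. AE \<omega> in P. Z i \<omega> = X (- 1) \<omega> $ i"
    and Z_pos: "\<And>i. AE \<omega> in P. 0 < Z i \<omega>"
    and Z_lim: "\<And>i. AE \<omega> in P. (\<lambda>k. Y i (r k) (- 1) \<omega>) \<longlonglongrightarrow> Z i \<omega>"
    and Z_indep: "\<And>i F. F \<in> borel_measurable (borel \<Otimes>\<^sub>M borel) \<Longrightarrow> indep_var borel (\<lambda>\<omega>. F (\<xi> 0 \<omega>)) borel
        (Z i)"
    by (rule past_version[OF contraction]) (rule that)
  note Z_meas [measurable]
  have nondeg: "\<not> (AE \<omega> in P. ln (A i 0 \<omega>) = 0)"
  proof
    assume "AE \<omega> in P. ln (A i 0 \<omega>) = 0"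
    then have "AE \<omega> in P. ln (A i 0 \<omega>) \<in> range (\<lambda>k::int. 1 * of_int k)"
      by eventually_elim (auto intro!: image_eqI[of _ _ 0])
    with nonlattice[of 1] show False by simp
  qed
  have Q_int: "integrable P (\<lambda>\<omega>. \<bar>Q 0 \<omega> $ i\<bar> powr s)" if "0 < s" "s \<le> \<alpha> + \<epsilon>" for s
    by (rule integrable_powr_smaller[OF _ \<epsilon>(3)]) (use that in auto)
  have Q_abs: "AE \<omega> in P. \<bar>Q 0 \<omega> $ i\<bar> = Q 0 \<omega> $ i" using AE_pos[of i] by eventually_elim (simp add:
      less_imp_le)
  have Z_moment: "integrable P (\<lambda>\<omega>. Z i \<omega> powr s)" if s: "0 < s" "s < \<alpha>" for s
  proof -
    have "(\<integral>\<^sup>+\<omega>. ennreal ((Q 0 \<omega> $ i) powr s) \<partial>P) = (\<integral>\<^sup>+\<omega>. ennreal (\<bar>Q 0 \<omega> $ i\<bar> powr s) \<partial>P)"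
      by (rule nn_integral_cong_AE) (use Q_abs in \<open>auto elim!: eventually_mono\<close>)
    also have "\<dots> < \<infinity>" by (rule nn_finite_if_integrable[OF Q_int]) (use s \<epsilon> in auto)
    finally have Q: "(\<integral>\<^sup>+\<omega>. ennreal ((Q 0 \<omega> $ i) powr s) \<partial>P) < \<infinity>" .
    obtain B where B: "0 \<le> B" "\<And>n t. (\<integral>\<^sup>+\<omega>. ennreal (Y i n t \<omega> powr s) \<partial>P) \<le> ennreal B"
      by (rule Y_moment[OF s(1) A_moment_less_1[OF \<alpha>(2) nondeg s] Q]) (rule that)
    have "(\<integral>\<^sup>+\<omega>. ennreal (Z i \<omega> powr s) \<partial>P) \<le> ennreal B"
    proof (rule nn_integral_le_of_tendsto)
      show "AE \<omega> in P. (\<lambda>k. Y i (r k) (- 1) \<omega> powr s) \<longlonglongrightarrow> Z i \<omega> powr s"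
        using Z_lim[of i] Z_pos[of i] by eventually_elim (intro tendsto_powr, auto)
    qed (use B in auto)
    then show ?thesis by (intro integrable_if_nn_finite[where B = B]) auto
  qed
  \<comment> \<open>Within \<epsilon> of \<alpha>, so that the noise has moments of order \<beta>,
    and within 1 / 2 of it, so that \<beta> - 1 is a subcritical order for \<open>Z\<close>.\<close>
  define \<beta> where "\<beta> = \<alpha> + min \<epsilon> (min (\<alpha> / 2) (1 / 2))"
  have \<beta>: "\<alpha> < \<beta>" "0 < \<beta>" "\<beta> \<le> \<alpha> + \<epsilon>" "\<beta> - 1 < \<alpha>" using \<alpha> \<epsilon> by (auto simp: \<beta>_def)
  have A_\<beta>: "integrable P (\<lambda>\<omega>. A i 0 \<omega> powr \<beta>)"
    by (rule integrable_A_powr[OF \<beta>(2)], rule integrable_powr_smaller[OF _ \<epsilon>(2)]) (use \<beta> in auto)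
  have Q_\<beta>: "integrable P (\<lambda>\<omega>. \<bar>Q 0 \<omega> $ i\<bar> powr \<beta>)" by (rule Q_int) (use \<beta> in auto)
  have diff: "integrable P (\<lambda>\<omega>. (A i 0 \<omega> * Z i \<omega> + Q 0 \<omega> $ i) powr \<beta> - (A i 0 \<omega> * Z i \<omega>) powr \<beta>)"
  proof (cases "\<beta> \<le> 1")
    case True
    show ?thesis
    proof (rule Bochner_Integration.integrable_bound[OF Q_\<beta>])
      show "AE \<omega> in P. norm ((A i 0 \<omega> * Z i \<omega> + Q 0 \<omega> $ i) powr \<beta> - (A i 0 \<omega> * Z i \<omega>) powr \<beta>) \<le> norm (\<bar>Q
          0 \<omega> $ i\<bar> powr \<beta>)"
        using AE_pos[of i] Z_pos[of i]
      proof eventually_elim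
        case (elim \<omega>)
        then have x: "0 \<le> A i 0 \<omega> * Z i \<omega>" and q: "0 < Q 0 \<omega> $ i" by (auto simp: less_imp_le)
        have "(A i 0 \<omega> * Z i \<omega>) powr \<beta> \<le> (A i 0 \<omega> * Z i \<omega> + Q 0 \<omega> $ i) powr \<beta>"
          using x q \<beta> by (intro powr_mono2) auto
        then show ?case using powr_add_diff_le[OF x q \<beta>(2)] True q by simp
      qed
    qed simp
  next
    case False
    define C where "C = \<beta> * 2 powr (\<beta> - 1)"
    have C: "0 \<le> C" using \<beta> by (simp add: C_def)
    \<comment> \<open>All noise of time 0 is collected in one factor, a function of \<xi> 0 and
      hence independent of \<open>Z i\<close>.\<close>
    have ind: "indep_var borel (\<lambda>\<omega>. \<bar>Q 0 \<omega> $ i\<bar> powr \<beta> + A i 0 \<omega> powr \<beta>) borel (\<lambda>\<omega>. Z i \<omega> powr (\<beta> - 1))"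
    proof -
      have "(\<lambda>x. \<bar>snd x $ i\<bar> powr \<beta> + (b $ i + c $ i * fst x) powr \<beta>) \<in> borel_measurable (borel \<Otimes>\<^sub>M
          (borel :: (real ^ 'd) measure))"
        by measurable
      from indep_var_compose[OF Z_indep[OF this, of i], of "\<lambda>x. x" borel "\<lambda>x. x powr (\<beta> - 1)" borel]
      show ?thesis by (simp add: comp_def A_\<xi>) (simp add: \<xi>_def)
    qed
    have "integrable P (\<lambda>\<omega>. (\<bar>Q 0 \<omega> $ i\<bar> powr \<beta> + A i 0 \<omega> powr \<beta>) * Z i \<omega> powr (\<beta> - 1))"
      by (rule indep_var_integrable[OF ind]) (use Q_\<beta> A_\<beta> Z_moment[of "\<beta> - 1"] False \<beta> in auto)
    then have int: "integrable P (\<lambda>\<omega>. C * ((\<bar>Q 0 \<omega> $ i\<bar> powr \<beta> + A i 0 \<omega> powr \<beta>) * Z i \<omega> powr (\<beta> - 1) +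
        \<bar>Q 0 \<omega> $ i\<bar> powr \<beta>))"
      using Q_\<beta> by (intro integrable_mult_right Bochner_Integration.integrable_add)
    show ?thesis
    proof (rule Bochner_Integration.integrable_bound[OF int])
      show "AE \<omega> in P. norm ((A i 0 \<omega> * Z i \<omega> + Q 0 \<omega> $ i) powr \<beta> - (A i 0 \<omega> * Z i \<omega>) powr \<beta>) \<le>
        norm (C * ((\<bar>Q 0 \<omega> $ i\<bar> powr \<beta> + A i 0 \<omega> powr \<beta>) * Z i \<omega> powr (\<beta> - 1) + \<bar>Q 0 \<omega> $ i\<bar> powr \<beta>))"
        using AE_pos[of i] Z_pos[of i]
      proof eventually_elim
        case (elim \<omega>)
        define a where "a = A i 0 \<omega>"
        define z where "z = Z i \<omega>"
        define q where "q = Q 0 \<omega> $ i"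
        have pos: "0 < a" "0 < z" "0 < q" using elim by (auto simp: a_def z_def q_def)
        have mono: "(a * z) powr \<beta> \<le> (a * z + q) powr \<beta>"
          using pos \<beta> by (intro powr_mono2) (auto simp: less_imp_le)
        have p1: "q * q powr (\<beta> - 1) = q powr \<beta>" using pos by (simp add: powr_diff)
        have p2: "a * a powr (\<beta> - 1) = a powr \<beta>" using pos by (simp add: powr_diff)
        \<comment> \<open>The product is at most the power \<beta> of the larger of q and a.\<close>
        have qa: "q * a powr (\<beta> - 1) \<le> q powr \<beta> + a powr \<beta>"
        proof (cases "q \<le> a")
          case True
          then have "q * a powr (\<beta> - 1) \<le> a * a powr (\<beta> - 1)" by (intro mult_right_mono) auto
          then show ?thesis unfolding p2 by (simp add: add_increasing)
        next
          case le: False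
          then have "q * a powr (\<beta> - 1) \<le> q * q powr (\<beta> - 1)"
            using pos False by (intro mult_left_mono powr_mono2) auto
          then show ?thesis unfolding p1 by (simp add: add_increasing2)
        qed
        have "(a * z + q) powr \<beta> - (a * z) powr \<beta> \<le> \<beta> * q * (a * z + q) powr (\<beta> - 1)"
          using powr_add_diff_le[of "a * z" q \<beta>] pos \<beta>(2) False by (simp add: less_imp_le)
        also have "(a * z + q) powr (\<beta> - 1) \<le> (1 + 1) powr (\<beta> - 1) * (a * z) powr (\<beta> - 1) + (1 + 1 / 1)
            powr (\<beta> - 1) * q powr (\<beta> - 1)"
          using pos False by (intro powr_add_le) (auto simp: less_imp_le)
        also have "\<dots> = 2 powr (\<beta> - 1) * (a powr (\<beta> - 1) * z powr (\<beta> - 1) + q powr (\<beta> - 1))"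
          using pos by (simp add: powr_mult less_imp_le algebra_simps)
        also have "\<beta> * q * (2 powr (\<beta> - 1) * (a powr (\<beta> - 1) * z powr (\<beta> - 1) + q powr (\<beta> - 1))) =
            C * ((q * a powr (\<beta> - 1)) * z powr (\<beta> - 1) + q * q powr (\<beta> - 1))"
          by (simp add: C_def algebra_simps)
        also have "\<dots> \<le> C * ((q powr \<beta> + a powr \<beta>) * z powr (\<beta> - 1) + q powr \<beta>)"
          unfolding p1 by (intro mult_left_mono add_right_mono mult_right_mono qa C) auto
        finally have "(a * z + q) powr \<beta> - (a * z) powr \<beta> \<le> C * ((q powr \<beta> + a powr \<beta>) * z powr (\<beta> - 1)
            + q powr \<beta>)"
          using \<beta>(2) pos by (auto intro!: mult_left_mono)
        moreover have "0 \<le> C * ((q powr \<beta> + a powr \<beta>) * z powr (\<beta> - 1) + q powr \<beta>)"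
          using C by (intro mult_nonneg_nonneg add_nonneg_nonneg) auto
        ultimately show ?case
          using mono pos unfolding a_def[symmetric] z_def[symmetric] q_def[symmetric] by simp
      qed
    qed simp
  qed
  define U where "U \<omega> = ln (A i 0 \<omega>)" for \<omega>
  define V where "V \<omega> = ln (Z i \<omega>)" for \<omega>
  define W where "W \<omega> = ln (A i 0 \<omega> * Z i \<omega> + Q 0 \<omega> $ i)" for \<omega>
  have [measurable]: "U \<in> borel_measurable P" "V \<in> borel_measurable P" "W \<in> borel_measurable P"
    unfolding U_def V_def W_def by measurable
  \<comment> \<open>Almost surely this is the recursion at time 0, so W has the law of ln X 0; by
    stationarity that is the law of ln X (- 1) and thus of V.\<close>
  have W_X: "AE \<omega> in P. W \<omega> = ln (X 0 \<omega> $ i)"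
    using AE_recursion[of i] Z_X[of i]
  proof eventually_elim
    case (elim \<omega>)
    show ?case using elim(1)[rule_format, of 0] elim(2) by (simp add: W_def)
  qed
  have exps: "AE \<omega> in P. exp (s * V \<omega>) = Z i \<omega> powr s \<and> exp (s * U \<omega>) = A i 0 \<omega> powr s \<and>
      exp (s * W \<omega>) = (A i 0 \<omega> * Z i \<omega> + Q 0 \<omega> $ i) powr s \<and> exp (s * (U \<omega> + V \<omega>)) = (A i 0 \<omega> * Z i \<omega>)
          powr s" for s
    using AE_pos[of i] Z_pos[of i]
  proof eventually_elim
    case (elim \<omega>)
    then have pos: "0 < A i 0 \<omega>" "0 < Z i \<omega>" "0 < Q 0 \<omega> $ i" by auto
    then have "0 < A i 0 \<omega> * Z i \<omega> + Q 0 \<omega> $ i" by (simp add: add_pos_pos)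
    then show ?case using pos by (simp add: U_def V_def W_def powr_def ln_mult)
  qed
  interpret R: additive_renewal P U V W \<alpha> \<beta>
  proof
    have "(\<lambda>x. ln (b $ i + c $ i * fst x)) \<in> borel_measurable (borel \<Otimes>\<^sub>M (borel :: (real ^ 'd)
        measure))" by measurable
    from indep_var_compose[OF Z_indep[OF this, of i], of "\<lambda>x. x" borel ln borel]
    show "indep_var borel U borel V" by (simp add: comp_def A_\<xi> U_def[abs_def] V_def[abs_def])
    have "distr P borel W = distr P borel (\<lambda>\<omega>. ln (X 0 \<omega> $ i))"
      by (rule distr_cong_AE[OF refl refl W_X]) auto
    also have "\<dots> = distr (distr P borel (X 0)) borel (\<lambda>x. ln (x $ i))"
      by (subst distr_distr) (auto simp: comp_def)
    also have "\<dots> = distr (distr P borel (X (- 1))) borel (\<lambda>x. ln (x $ i))"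
      by (simp only: law_X[of "- 1"])
    also have "\<dots> = distr P borel (\<lambda>\<omega>. ln (X (- 1) \<omega> $ i))"
      by (subst distr_distr) (auto simp: comp_def)
    also have "\<dots> = distr P borel V"
      by (rule distr_cong_AE[OF refl refl]) (use Z_X[of i] in \<open>auto simp: V_def elim!: eventually_mono\<close>)
    finally show "distr P borel W = distr P borel V" .
    show "AE \<omega> in P. U \<omega> + V \<omega> < W \<omega>"
      using AE_pos[of i] Z_pos[of i]
    proof eventually_elim
      case (elim \<omega>)
      then have pos: "0 < A i 0 \<omega>" "0 < Z i \<omega>" "0 < Q 0 \<omega> $ i" by auto
      then have "ln (A i 0 \<omega> * Z i \<omega>) < ln (A i 0 \<omega> * Z i \<omega> + Q 0 \<omega> $ i)"
        by (subst ln_less_cancel_iff) (auto intro!: add_pos_pos)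
      then show ?case using pos by (simp add: U_def V_def W_def ln_mult)
    qed
    show "has_bochner_integral P (\<lambda>\<omega>. exp (\<alpha> * U \<omega>)) 1"
      using \<alpha>(2) by (subst has_bochner_integral_cong_AE[where g = "\<lambda>\<omega>. A i 0 \<omega> powr \<alpha>"]) (use exps[of \<alpha>]
          in \<open>auto elim!: eventually_mono\<close>)
    show "integrable P (\<lambda>\<omega>. exp (\<beta> * U \<omega>))"
      using A_\<beta> by (subst integrable_cong_AE[where g = "\<lambda>\<omega>. A i 0 \<omega> powr \<beta>"]) (use exps[of \<beta>] in \<open>auto
          elim!: eventually_mono\<close>)
    show "integrable P (\<lambda>\<omega>. exp (\<beta> * W \<omega>) - exp (\<beta> * (U \<omega> + V \<omega>)))"
      using diff by (subst integrable_cong_AE[where g = "\<lambda>\<omega>. (A i 0 \<omega> * Z i \<omega> + Q 0 \<omega> $ i) powr \<beta> - (A i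
          0 \<omega> * Z i \<omega>) powr \<beta>"])
        (simp_all, use exps[of \<beta>] in eventually_elim, simp)
    show "integrable P (\<lambda>\<omega>. exp (s * V \<omega>))" if "0 < s" "s < \<alpha>" for s
      using Z_moment[OF that] by (subst integrable_cong_AE[where g = "\<lambda>\<omega>. Z i \<omega> powr s"]) (use exps[of
          s] in \<open>auto elim!: eventually_mono\<close>)
    show "\<not> (AE \<omega> in P. U \<omega> \<in> range (\<lambda>k::int. h * of_int k))" if "0 < h" for h
      using nonlattice[OF that] by (simp add: U_def)
  qed (use \<alpha> \<beta> in auto)
  obtain a where a: "0 < a" "(R.tail \<longlongrightarrow> a) at_top" using R.tail_convergence by blast
  have "((\<lambda>x. R.tail (ln x)) \<longlongrightarrow> a) at_top"
    by (rule filterlim_compose[OF a(2) ln_at_top])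
  then have "((\<lambda>x. x powr \<alpha> * prob {\<omega> \<in> space P. x < X 0 \<omega> $ i}) \<longlongrightarrow> a) at_top"
  proof (rule Lim_transform_eventually)
    show "\<forall>\<^sub>F x in at_top. R.tail (ln x) = x powr \<alpha> * prob {\<omega> \<in> space P. x < X 0 \<omega> $ i}"
      using eventually_gt_at_top[of 0]
    proof eventually_elim
      case (elim x)
      have "prob {\<omega> \<in> space P. ln x < W \<omega>} = prob {\<omega> \<in> space P. x < X 0 \<omega> $ i}"
      proof (rule finite_measure_eq_AE)
        show "AE \<omega> in P. \<omega> \<in> {\<omega> \<in> space P. ln x < W \<omega>} \<longleftrightarrow> \<omega> \<in> {\<omega> \<in> space P. x < X 0 \<omega> $ i}"
          using AE_pos[of i] Z_pos[of i] Z_X[of i] AE_recursion[of i]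
        proof eventually_elim
          case (elim \<omega>)
          have pos: "0 < A i 0 \<omega>" "0 < Z i \<omega>" "0 < Q 0 \<omega> $ i" using elim(1,2) by auto
          then have "0 < A i 0 \<omega> * Z i \<omega> + Q 0 \<omega> $ i" by (simp add: add_pos_pos)
          moreover have "X 0 \<omega> $ i = A i 0 \<omega> * Z i \<omega> + Q 0 \<omega> $ i" using elim(3) elim(4)[rule_format, of
              0] by simp
          ultimately show ?case using \<open>0 < x\<close> by (simp add: W_def)
        qed
      qed auto
      then show ?case using elim by (simp add: R.tail_def powr_def)
    qed
  qed
  then show ?thesis using a(1) by blast
qed

text \<open>The proof rests on the finiteness of the mixed moment of order \<open>(\<alpha> i / 2, \<alpha> j / 2)\<close>, which
  dominates both coordinates being large at once.\<close>

theorem joint_tail: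
  assumes \<alpha>i: "0 < \<alpha>i" "has_bochner_integral P (\<lambda>\<omega>. A i 0 \<omega> powr \<alpha>i) 1" "\<not> (AE \<omega> in P. ln (A i 0 \<omega>) = 0)"
      "integrable P (\<lambda>\<omega>. \<bar>Q 0 \<omega> $ i\<bar> powr \<alpha>i)"
    and \<alpha>j: "0 < \<alpha>j" "has_bochner_integral P (\<lambda>\<omega>. A j 0 \<omega> powr \<alpha>j) 1" "\<not> (AE \<omega> in P. ln (A j 0 \<omega>) = 0)"
      "integrable P (\<lambda>\<omega>. \<bar>Q 0 \<omega> $ j\<bar> powr \<alpha>j)"
    and different: "\<not> (AE \<omega> in P. A i 0 \<omega> powr \<alpha>i = A j 0 \<omega> powr \<alpha>j)"
    and contraction: "\<And>i. \<exists>s. 0 < s \<and> s \<le> 1 \<and> (\<integral>\<^sup>+\<omega>. ennreal (A i 0 \<omega> powr s) \<partial>P) < 1"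
  shows "((\<lambda>x. x * prob {\<omega> \<in> space P. x < (X 0 \<omega> $ i) powr \<alpha>i \<and> x < (X 0 \<omega> $ j) powr \<alpha>j}) \<longlongrightarrow> 0) at_top"
proof -
  obtain Z r where Z_meas: "\<And>i. Z i \<in> borel_measurable P"
    and Z_X: "\<And>i. AE \<omega> in P. Z i \<omega> = X (- 1) \<omega> $ i"
    and Z_pos: "\<And>i. AE \<omega> in P. 0 < Z i \<omega>"
    and Z_lim: "\<And>i. AE \<omega> in P. (\<lambda>k. Y i (r k) (- 1) \<omega>) \<longlonglongrightarrow> Z i \<omega>"
    by (rule past_version[OF contraction]) (rule that)
  note Z_meas [measurable]
  define p where "p = \<alpha>i / 2"
  define q where "q = \<alpha>j / 2"
  have pq: "0 < p" "0 < q" "p < \<alpha>i" "q < \<alpha>j" "2 * p = \<alpha>i" "2 * q = \<alpha>j" using \<alpha>i(1) \<alpha>j(1) by (auto simp: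
      p_def q_def)
  have int_A: "integrable P (\<lambda>\<omega>. A i 0 \<omega> powr \<alpha>i)" "integrable P (\<lambda>\<omega>. A j 0 \<omega> powr \<alpha>j)"
    using \<alpha>i(2) \<alpha>j(2) by (auto simp: has_bochner_integral_iff)
  have Q_fin: "(\<integral>\<^sup>+\<omega>. ennreal ((Q 0 \<omega> $ l) powr s) \<partial>P) < \<infinity>"
    if "0 < s" "s \<le> t" "integrable P (\<lambda>\<omega>. \<bar>Q 0 \<omega> $ l\<bar> powr t)" for l s t
  proof -
    have "(\<integral>\<^sup>+\<omega>. ennreal ((Q 0 \<omega> $ l) powr s) \<partial>P) = (\<integral>\<^sup>+\<omega>. ennreal (\<bar>Q 0 \<omega> $ l\<bar> powr s) \<partial>P)"
      by (rule nn_integral_cong_AE) (use AE_pos[of l] in \<open>auto elim!: eventually_mono simp: less_imp_le\<close>)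
    also have "\<dots> < \<infinity>"
      by (intro nn_finite_if_integrable integrable_powr_smaller[OF _ that(3)]) (use that in auto)
    finally show ?thesis .
  qed
  have A_joint: "(\<integral>\<^sup>+\<omega>. ennreal (A i 0 \<omega> powr p * A j 0 \<omega> powr q) \<partial>P) < 1"
  proof -
    let ?u = "\<lambda>\<omega>. A i 0 \<omega> powr p" and ?v = "\<lambda>\<omega>. A j 0 \<omega> powr q"
    have sq: "(?u \<omega>)\<^sup>2 = A i 0 \<omega> powr \<alpha>i" "(?v \<omega>)\<^sup>2 = A j 0 \<omega> powr \<alpha>j" for \<omega>
      by (simp_all add: power2_eq_square powr_add[symmetric] p_def q_def)
    have int_uv: "integrable P (\<lambda>\<omega>. ?u \<omega> * ?v \<omega>)"
    proof (rule Bochner_Integration.integrable_bound[OF Bochner_Integration.integrable_add[OF int_A]])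
      show "AE \<omega> in P. norm (?u \<omega> * ?v \<omega>) \<le> norm (A i 0 \<omega> powr \<alpha>i + A j 0 \<omega> powr \<alpha>j)"
        using AE_pos[of i] AE_pos[of j]
      proof eventually_elim
        case (elim \<omega>)
        then have "0 \<le> A i 0 \<omega>" "0 \<le> A j 0 \<omega>" by (auto simp: less_imp_le)
        from powr_mult_le_powr_add[OF this, of p q] show ?case by (simp add: pq)
      qed
    qed simp
    \<comment> \<open>The integrand is (u - v)^2 and u^2, v^2 have mean 1, so its mean is 2 - 2 E (u
      v); it is positive because u = v almost surely is excluded by
      \<open>different\<close>.\<close>
    have "0 < expectation (\<lambda>\<omega>. A i 0 \<omega> powr \<alpha>i + A j 0 \<omega> powr \<alpha>j - 2 * (?u \<omega> * ?v \<omega>))"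
    proof (rule expectation_pos_off_zero[where U = "\<lambda>\<omega>. ?u \<omega> - ?v \<omega>"])
      show "integrable P (\<lambda>\<omega>. A i 0 \<omega> powr \<alpha>i + A j 0 \<omega> powr \<alpha>j - 2 * (?u \<omega> * ?v \<omega>))"
        using int_A int_uv by auto
      show "\<not> (AE \<omega> in P. ?u \<omega> - ?v \<omega> = 0)"
      proof
        assume "AE \<omega> in P. ?u \<omega> - ?v \<omega> = 0"
        then have "AE \<omega> in P. A i 0 \<omega> powr \<alpha>i = A j 0 \<omega> powr \<alpha>j"
          by eventually_elim (simp add: sq[symmetric])
        with different show False by simp
      qed
      have eq: "A i 0 \<omega> powr \<alpha>i + A j 0 \<omega> powr \<alpha>j - 2 * (?u \<omega> * ?v \<omega>) = (?u \<omega> - ?v \<omega>)\<^sup>2" for \<omega>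
        by (simp add: sq[symmetric] power2_diff)
      show "0 < A i 0 \<omega> powr \<alpha>i + A j 0 \<omega> powr \<alpha>j - 2 * (?u \<omega> * ?v \<omega>)" if "?u \<omega> - ?v \<omega> \<noteq> 0" for \<omega>
        unfolding eq using that by simp
      show "A i 0 \<omega> powr \<alpha>i + A j 0 \<omega> powr \<alpha>j - 2 * (?u \<omega> * ?v \<omega>) = 0" if "?u \<omega> - ?v \<omega> = 0" for \<omega>
        unfolding eq using that by simp
    qed
    also have "\<dots> = 1 + 1 - 2 * expectation (\<lambda>\<omega>. ?u \<omega> * ?v \<omega>)"
      using int_A int_uv \<alpha>i(2) \<alpha>j(2) by (simp add: has_bochner_integral_iff)
    finally have "expectation (\<lambda>\<omega>. ?u \<omega> * ?v \<omega>) < 1" by simp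
    then show ?thesis
      by (subst nn_integral_eq_integral[OF int_uv]) (auto simp: ennreal_less_one_iff)
  qed
  obtain B where B: "0 \<le> B" "\<And>n t. (\<integral>\<^sup>+\<omega>. ennreal (Y i n t \<omega> powr p * Y j n t \<omega> powr q) \<partial>P) \<le> ennreal B"
  proof (rule Y_joint_moment[OF pq(1,2) A_joint])
    show "(\<integral>\<^sup>+\<omega>. ennreal (A i 0 \<omega> powr p) \<partial>P) < 1" by (rule A_moment_less_1[OF \<alpha>i(2,3) pq(1,3)])
    show "(\<integral>\<^sup>+\<omega>. ennreal (A j 0 \<omega> powr q) \<partial>P) < 1" by (rule A_moment_less_1[OF \<alpha>j(2,3) pq(2,4)])
    show "(\<integral>\<^sup>+\<omega>. ennreal (A i 0 \<omega> powr (2 * p)) \<partial>P) < \<infinity>" "(\<integral>\<^sup>+\<omega>. ennreal (A j 0 \<omega> powr (2 * q)) \<partial>P) < \<infinity>"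
      unfolding pq(5,6) using int_A by (auto intro!: nn_finite_if_integrable simp del: infinity_ennreal_def)
    show "(\<integral>\<^sup>+\<omega>. ennreal ((Q 0 \<omega> $ i) powr p) \<partial>P) < \<infinity>" "(\<integral>\<^sup>+\<omega>. ennreal ((Q 0 \<omega> $ i) powr (2 * p)) \<partial>P) < \<infinity>"
      by (rule Q_fin[OF _ _ \<alpha>i(4)]; use pq in simp)+
    show "(\<integral>\<^sup>+\<omega>. ennreal ((Q 0 \<omega> $ j) powr q) \<partial>P) < \<infinity>" "(\<integral>\<^sup>+\<omega>. ennreal ((Q 0 \<omega> $ j) powr (2 * q)) \<partial>P) < \<infinity>"
      by (rule Q_fin[OF _ _ \<alpha>j(4)]; use pq in simp)+
  qed (rule that)
  define g where "g \<omega> = Z i \<omega> powr p * Z j \<omega> powr q" for \<omega>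
  have [measurable]: "g \<in> borel_measurable P" unfolding g_def by measurable
  have g_nonneg: "0 \<le> g \<omega>" for \<omega> by (simp add: g_def)
  have g_fin: "(\<integral>\<^sup>+\<omega>. ennreal (g \<omega>) \<partial>P) \<le> ennreal B"
  proof (rule nn_integral_le_of_tendsto)
    show "AE \<omega> in P. (\<lambda>k. Y i (r k) (- 1) \<omega> powr p * Y j (r k) (- 1) \<omega> powr q) \<longlonglongrightarrow> g \<omega>"
      unfolding g_def using Z_lim[of i] Z_pos[of i] Z_lim[of j] Z_pos[of j]
      by eventually_elim (intro tendsto_mult tendsto_powr, auto)
  qed (use B in auto)
  have int_g: "integrable P g" by (rule integrable_if_nn_finite[OF _ g_nonneg g_fin]) simp
  \<comment> \<open>Markov's inequality alone gives O(1 / x). Keeping the indicator of x < g in the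
    bound improves this to o(1 / x), by dominated convergence with the integrable g.\<close>
  have "((\<lambda>x. expectation (\<lambda>\<omega>. g \<omega> * indicator {\<omega>. x < g \<omega>} \<omega>)) \<longlongrightarrow> expectation (\<lambda>\<omega>. 0)) at_top"
  proof (rule integral_dominated_convergence_at_top[where w = g])
    show "AE \<omega> in P. ((\<lambda>x. g \<omega> * indicator {\<omega>. x < g \<omega>} \<omega>) \<longlongrightarrow> 0) at_top"
    proof (rule AE_I2)
      fix \<omega>
      show "((\<lambda>x. g \<omega> * indicator {\<omega>. x < g \<omega>} \<omega>) \<longlongrightarrow> 0) at_top"
        by (rule tendsto_eventually, use eventually_ge_at_top[of "g \<omega>"] in eventually_elim) (simp add:
            indicator_def)
    qed
  qed (use int_g g_nonneg in \<open>auto simp: indicator_def intro!: always_eventually\<close>)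
  then have lim: "((\<lambda>x. expectation (\<lambda>\<omega>. g \<omega> * indicator {\<omega>. x < g \<omega>} \<omega>)) \<longlongrightarrow> 0) at_top" by simp
  have le: "x * prob {\<omega> \<in> space P. x < (X 0 \<omega> $ i) powr \<alpha>i \<and> x < (X 0 \<omega> $ j) powr \<alpha>j} \<le>
      expectation (\<lambda>\<omega>. g \<omega> * indicator {\<omega>. x < g \<omega>} \<omega>)" if x: "0 < x" for x
  proof -
    let ?S = "{x' :: real ^ 'd. x < (x' $ i) powr \<alpha>i \<and> x < (x' $ j) powr \<alpha>j}"
    have "prob {\<omega> \<in> space P. x < (X t \<omega> $ i) powr \<alpha>i \<and> x < (X t \<omega> $ j) powr \<alpha>j} = measure (distr P borel
        (X t)) ?S" for t
      by (subst measure_distr) (auto intro!: arg_cong[where f = prob])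
    \<comment> \<open>The comparison is made at time -1, where \<open>Z\<close> is a version of the
      solution.\<close>
    from this[of 0] this[of "- 1"]
    have "prob {\<omega> \<in> space P. x < (X 0 \<omega> $ i) powr \<alpha>i \<and> x < (X 0 \<omega> $ j) powr \<alpha>j} =
        prob {\<omega> \<in> space P. x < (X (- 1) \<omega> $ i) powr \<alpha>i \<and> x < (X (- 1) \<omega> $ j) powr \<alpha>j}"
      by (simp only: law_X[of "- 1"])
    also have "\<dots> \<le> prob {\<omega> \<in> space P. x < g \<omega>}"
    proof (rule finite_measure_mono_AE)
      show "AE \<omega> in P. \<omega> \<in> {\<omega> \<in> space P. x < (X (- 1) \<omega> $ i) powr \<alpha>i \<and> x < (X (- 1) \<omega> $ j) powr \<alpha>j} \<longrightarrow> \<omega>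
          \<in> {\<omega> \<in> space P. x < g \<omega>}"
        using Z_X[of i] Z_X[of j]
      proof eventually_elim
        case (elim \<omega>)
        show ?case
        proof safe
          assume *: "x < (X (- 1) \<omega> $ i) powr \<alpha>i" "x < (X (- 1) \<omega> $ j) powr \<alpha>j"
          have "(Z i \<omega> powr p)\<^sup>2 = Z i \<omega> powr \<alpha>i" "(Z j \<omega> powr q)\<^sup>2 = Z j \<omega> powr \<alpha>j"
            by (simp_all add: power2_eq_square powr_add[symmetric] p_def q_def)
          with * elim have "(sqrt x)\<^sup>2 < (Z i \<omega> powr p)\<^sup>2" "(sqrt x)\<^sup>2 < (Z j \<omega> powr q)\<^sup>2" using x by auto
          then have "sqrt x < Z i \<omega> powr p" "sqrt x < Z j \<omega> powr q" by (auto intro: power2_less_imp_less)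
          \<comment> \<open>Each half power exceeds sqrt x, so the product exceeds x itself.\<close>
          then have "sqrt x * sqrt x < g \<omega>" unfolding g_def using x by (intro mult_strict_mono) auto
          then show "x < g \<omega>" using x by simp
        qed
      qed
    qed measurable
    finally have "x * prob {\<omega> \<in> space P. x < (X 0 \<omega> $ i) powr \<alpha>i \<and> x < (X 0 \<omega> $ j) powr \<alpha>j} \<le> x * prob
        {\<omega> \<in> space P. x < g \<omega>}"
      using x by simp
    also have "\<dots> = expectation (\<lambda>\<omega>. x * indicator {\<omega> \<in> space P. x < g \<omega>} \<omega>)" by simp
    also have "\<dots> \<le> expectation (\<lambda>\<omega>. g \<omega> * indicator {\<omega>. x < g \<omega>} \<omega>)"
    proof (rule integral_mono)
      show "integrable P (\<lambda>\<omega>. g \<omega> * indicator {\<omega>. x < g \<omega>} \<omega>)"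
        by (rule Bochner_Integration.integrable_bound[OF int_g]) (auto simp: indicator_def)
      show "integrable P (\<lambda>\<omega>. x * indicator {\<omega> \<in> space P. x < g \<omega>} \<omega>)"
        by (intro integrable_mult_right integrable_real_indicator) (auto simp: emeasure_eq_measure)
    qed (auto simp: indicator_def)
    finally show ?thesis .
  qed
  show ?thesis
  proof (rule tendsto_sandwich[OF _ _ tendsto_const lim])
    show "\<forall>\<^sub>F x in at_top. 0 \<le> x * prob {\<omega> \<in> space P. x < (X 0 \<omega> $ i) powr \<alpha>i \<and> x < (X 0 \<omega> $ j) powr \<alpha>j}"
      using eventually_gt_at_top[of 0] by eventually_elim simp
    show "\<forall>\<^sub>F x in at_top. x * prob {\<omega> \<in> space P. x < (X 0 \<omega> $ i) powr \<alpha>i \<and> x < (X 0 \<omega> $ j) powr \<alpha>j} \<le>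
        expectation (\<lambda>\<omega>. g \<omega> * indicator {\<omega>. x < g \<omega>} \<omega>)"
      using eventually_gt_at_top[of 0] by eventually_elim (rule le)
  qed
qed

text \<open>The solution is not assumed positive; positivity passes from \<open>Z\<close> to X (- 1)
  and by stationarity to X 0.\<close>

lemma AE_X_pos:
  assumes "\<And>i. \<exists>s. 0 < s \<and> s \<le> 1 \<and> (\<integral>\<^sup>+\<omega>. ennreal (A i 0 \<omega> powr s) \<partial>P) < 1"
  shows "AE \<omega> in P. \<forall>i. 0 < X 0 \<omega> $ i"
proof -
  obtain Z :: "'d \<Rightarrow> 'w \<Rightarrow> real" where Z: "\<And>i. AE \<omega> in P. Z i \<omega> = X (- 1) \<omega> $ i" "\<And>i. AE \<omega> in P. 0 < Z i \<omega>"
    by (rule past_version[OF assms]) (rule that)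
  have "AE \<omega> in P. 0 < X 0 \<omega> $ i" for i
  proof -
    have "AE \<omega> in P. 0 < X (- 1) \<omega> $ i" using Z(1)[of i] Z(2)[of i] by eventually_elim simp
    then have "AE x in distr P borel (X (- 1)). 0 < x $ i" by (subst AE_distr_iff) auto
    then have "AE x in distr P borel (X 0). 0 < x $ i" by (simp only: law_X[of "- 1"])
    then show ?thesis by (subst (asm) AE_distr_iff) auto
  qed
  then show ?thesis by (simp add: AE_all_countable)
qed

end

section \<open>Regular variation of asymptotically independent pairs\<close>

lemma vnorm_2: "vnorm \<alpha> x = max (\<bar>x $ 1\<bar> powr \<alpha> $ 1) (\<bar>x $ 2\<bar> powr \<alpha> $ 2)" for x \<alpha> :: "real ^ 2"
  by (simp add: vnorm_def UNIV_2)

text \<open>The recursion has disappeared: only tails matter now. After raising coordinate i to the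
  power \<alpha> $ i, both tails have order 1 / x and the joint tail is of smaller order.\<close>

locale asymptotically_independent_pair = prob_space M for M :: "'w measure" +
  fixes X :: "'w \<Rightarrow> real ^ 2" and \<alpha> :: "real ^ 2" and a :: "2 \<Rightarrow> real"
  assumes X_rv [measurable]: "X \<in> borel_measurable M"
    and \<alpha>_pos: "\<And>i. 0 < \<alpha> $ i" and a_pos: "\<And>i. 0 < a i"
    and X_pos: "AE \<omega> in M. \<forall>i. 0 < X \<omega> $ i"
    and tail: "\<And>i. ((\<lambda>x. x powr (\<alpha> $ i) * prob {\<omega> \<in> space M. x < X \<omega> $ i}) \<longlongrightarrow> a i) at_top"
    and joint: "((\<lambda>x. x * prob {\<omega> \<in> space M. x < (X \<omega> $ 1) powr (\<alpha> $ 1) \<and> x < (X \<omega> $ 2) powr (\<alpha> $ 2)}) \<longlongrightarrow>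
        0) at_top"
begin

definition u :: "2 \<Rightarrow> 'w \<Rightarrow> real" where "u i \<omega> = \<bar>X \<omega> $ i\<bar> powr (\<alpha> $ i)"
definition N :: "'w \<Rightarrow> real" where "N \<omega> = vnorm \<alpha> (X \<omega>)"
definition \<Theta> :: "'w \<Rightarrow> real ^ 2" where "\<Theta> \<omega> = inv_scale \<alpha> (N \<omega>) (X \<omega>)"

lemma N_eq: "N \<omega> = max (u 1 \<omega>) (u 2 \<omega>)"
  by (simp add: N_def vnorm_2 u_def)

lemma borel_measurable_u [measurable]: "u i \<in> borel_measurable M"
  unfolding u_def by measurable

lemma borel_measurable_N [measurable]: "N \<in> borel_measurable M"
proof -
  have "N = (\<lambda>\<omega>. max (u 1 \<omega>) (u 2 \<omega>))" by (rule ext) (rule N_eq)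
  then show ?thesis by simp
qed

lemma borel_measurable_\<Theta> [measurable]: "\<Theta> \<in> borel_measurable M"
proof (subst borel_measurable_euclidean_space, intro ballI)
  fix b :: "real ^ 2" assume "b \<in> Basis"
  then obtain i where "b = axis i 1" by (auto simp: Basis_vec_def)
  then have "(\<lambda>\<omega>. \<Theta> \<omega> \<bullet> b) = (\<lambda>\<omega>. N \<omega> powr (- 1 / \<alpha> $ i) * X \<omega> $ i)"
    by (simp add: inner_axis \<Theta>_def inv_scale_def)
  then show "(\<lambda>\<omega>. \<Theta> \<omega> \<bullet> b) \<in> borel_measurable M" by simp
qed

lemma prob_u_greater:
  assumes "0 < x"
  shows "prob {\<omega> \<in> space M. x < u i \<omega>} = prob {\<omega> \<in> space M. x powr (1 / \<alpha> $ i) < X \<omega> $ i}"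
proof (rule finite_measure_eq_AE)
  show "AE \<omega> in M. \<omega> \<in> {\<omega> \<in> space M. x < u i \<omega>} \<longleftrightarrow> \<omega> \<in> {\<omega> \<in> space M. x powr (1 / \<alpha> $ i) < X \<omega> $ i}"
    using X_pos
  proof eventually_elim
    case (elim \<omega>)
    then have pos: "0 < X \<omega> $ i" by simp
    have "x < (X \<omega> $ i) powr (\<alpha> $ i) \<longleftrightarrow> x powr (1 / \<alpha> $ i) < X \<omega> $ i"
    proof -
      have "(x powr (1 / \<alpha> $ i)) powr (\<alpha> $ i) = x"
        using assms \<alpha>_pos[of i] by (simp add: powr_powr)
      then have "x < (X \<omega> $ i) powr (\<alpha> $ i) \<longleftrightarrow> (x powr (1 / \<alpha> $ i)) powr (\<alpha> $ i) < (X \<omega> $ i) powr (\<alpha> $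
          i)" by simp
      also have "\<dots> \<longleftrightarrow> x powr (1 / \<alpha> $ i) < X \<omega> $ i"
        using pos \<alpha>_pos[of i] powr_less_mono2[of "\<alpha> $ i" "x powr (1 / \<alpha> $ i)" "X \<omega> $ i"] powr_mono2[of
            "\<alpha> $ i" "X \<omega> $ i" "x powr (1 / \<alpha> $ i)"]
        by (auto simp: not_less[symmetric] less_imp_le)
      finally show ?thesis .
    qed
    then show ?case using pos by (auto simp: u_def)
  qed
qed auto

lemma u_tail: "((\<lambda>x. x * prob {\<omega> \<in> space M. x < u i \<omega>}) \<longlongrightarrow> a i) at_top"
proof -
  have "filterlim (\<lambda>x. x powr (1 / \<alpha> $ i)) at_top at_top"
    using \<alpha>_pos[of i] by real_asymp
  from filterlim_compose[OF tail[of i] this]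
  show ?thesis
  proof (rule Lim_transform_eventually)
    show "\<forall>\<^sub>F x in at_top. (x powr (1 / \<alpha> $ i)) powr (\<alpha> $ i) * prob {\<omega> \<in> space M. x powr (1 / \<alpha> $ i) < X
        \<omega> $ i} =
        x * prob {\<omega> \<in> space M. x < u i \<omega>}"
      using eventually_gt_at_top[of 0]
    proof eventually_elim
      case (elim x)
      then show ?case using \<alpha>_pos[of i] by (simp add: prob_u_greater powr_powr)
    qed
  qed
qed

lemma joint_u: "((\<lambda>x. x * prob {\<omega> \<in> space M. x < u 1 \<omega> \<and> x < u 2 \<omega>}) \<longlongrightarrow> 0) at_top"
proof -
  have "prob {\<omega> \<in> space M. x < u 1 \<omega> \<and> x < u 2 \<omega>} = prob {\<omega> \<in> space M. x < (X \<omega> $ 1) powr (\<alpha> $ 1) \<and> x <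
      (X \<omega> $ 2) powr (\<alpha> $ 2)}" for x
  proof (rule finite_measure_eq_AE)
    show "AE \<omega> in M. \<omega> \<in> {\<omega> \<in> space M. x < u 1 \<omega> \<and> x < u 2 \<omega>} \<longleftrightarrow> \<omega> \<in> {\<omega> \<in> space M. x < (X \<omega> $ 1) powr (\<alpha>
        $ 1) \<and> x < (X \<omega> $ 2) powr (\<alpha> $ 2)}"
      using X_pos
    proof eventually_elim
      case (elim \<omega>)
      then have "0 < X \<omega> $ 1" "0 < X \<omega> $ 2" by auto
      then show ?case by (simp add: u_def)
    qed
  qed auto
  then show ?thesis using joint by simp
qed

definition S :: real where "S = a 1 + a 2"

lemma S_pos: "0 < S" using a_pos[of 1] a_pos[of 2] by (simp add: S_def)

text \<open>Inclusion and exclusion, with a negligible joint term; the tail constants add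
  up.\<close>

lemma N_tail: "((\<lambda>x. x * prob {\<omega> \<in> space M. x < N \<omega>}) \<longlongrightarrow> S) at_top"
proof -
  have eq: "prob {\<omega> \<in> space M. x < N \<omega>} = prob {\<omega> \<in> space M. x < u 1 \<omega>} + prob {\<omega> \<in> space M. x < u 2 \<omega>}
      - prob {\<omega> \<in> space M. x < u 1 \<omega> \<and> x < u 2 \<omega>}" for x
  proof -
    have "{\<omega> \<in> space M. x < N \<omega>} = {\<omega> \<in> space M. x < u 1 \<omega>} \<union> {\<omega> \<in> space M. x < u 2 \<omega>}" by (auto simp: N_eq)
    moreover have "{\<omega> \<in> space M. x < u 1 \<omega> \<and> x < u 2 \<omega>} = {\<omega> \<in> space M. x < u 1 \<omega>} \<inter> {\<omega> \<in> space M. x < u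
        2 \<omega>}" by auto
    ultimately show ?thesis using measure_Un3[of "{\<omega> \<in> space M. x < u 1 \<omega>}" M "{\<omega> \<in> space M. x < u 2 \<omega>}"]
      by (simp add: fmeasurable_eq_sets)
  qed
  have "((\<lambda>x. x * prob {\<omega> \<in> space M. x < u 1 \<omega>} + x * prob {\<omega> \<in> space M. x < u 2 \<omega>} - x * prob {\<omega> \<in>
      space M. x < u 1 \<omega> \<and> x < u 2 \<omega>}) \<longlongrightarrow> a 1 + a 2 - 0) at_top"
    by (intro tendsto_intros u_tail joint_u)
  then show ?thesis unfolding eq S_def by (simp add: algebra_simps)
qed

lemma N_regularly_varying: "regularly_varying M N"
  unfolding regularly_varying_def
\<comment> \<open>The index is 1 because the tail of \<open>N\<close> has order 1 / x, whatever
  \<alpha> is.\<close>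
proof (intro exI[of _ 1] conjI allI impI)
  fix s :: real assume s: "0 < s"
  have "filterlim (\<lambda>x. s * x) at_top at_top"
    by (rule filterlim_tendsto_pos_mult_at_top[OF tendsto_const s filterlim_ident])
  from filterlim_compose[OF N_tail this]
  have "((\<lambda>x. (s * x * prob {\<omega> \<in> space M. s * x < N \<omega>}) / (x * prob {\<omega> \<in> space M. x < N \<omega>}) / s) \<longlongrightarrow> S / S
      / s) at_top"
    by (intro tendsto_divide N_tail tendsto_const) (use S_pos s in auto)
  then have "((\<lambda>x. (s * x * prob {\<omega> \<in> space M. s * x < N \<omega>}) / (x * prob {\<omega> \<in> space M. x < N \<omega>}) / s) \<longlongrightarrow>
      s powr - 1) at_top"
    using S_pos s by (simp add: powr_minus field_simps)
  then show "((\<lambda>x. prob {\<omega> \<in> space M. N \<omega> > s * x} / prob {\<omega> \<in> space M. N \<omega> > x}) \<longlongrightarrow> s powr - 1) at_top"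
    by (rule Lim_transform_eventually) (use eventually_gt_at_top[of 0] in eventually_elim, use s in simp)
qed simp

section \<open>The limit of the normalised vector and its law\<close>

definition e1 :: "real ^ 2" where "e1 = vector [1, 0]"
definition e2 :: "real ^ 2" where "e2 = vector [0, 1]"

lemma e_nth [simp]: "e1 $ 1 = 1" "e1 $ 2 = 0" "e2 $ 1 = 0" "e2 $ 2 = 1"
  by (simp_all add: e1_def e2_def vector_2)

text \<open>Normalising by the dominant coordinate makes that one exactly 1 and turns the other into
  (u j / u i) powr (1 / \<alpha> $ j), which is small when u j is small compared with x < u
  i.\<close>

lemma \<Theta>_near_axis:
  assumes pos: "\<And>i. 0 < X \<omega> $ i" and x: "0 < x" "x < u i \<omega>" "u j \<omega> \<le> \<delta> * x" and \<delta>: "0 < \<delta>" "\<delta> < 1" and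
      N: "N \<omega> = u i \<omega>"
  shows "\<Theta> \<omega> $ i = 1" "0 \<le> \<Theta> \<omega> $ j" "\<Theta> \<omega> $ j < \<delta> powr (1 / \<alpha> $ j)"
proof -
  have u_i: "0 < u i \<omega>" using x by simp
  have "(u i \<omega>) powr (- 1 / \<alpha> $ i) = inverse (X \<omega> $ i)"
    using pos[of i] \<alpha>_pos[of i] by (simp add: u_def powr_powr powr_minus)
  then show "\<Theta> \<omega> $ i = 1" using pos[of i] by (simp add: \<Theta>_def inv_scale_def N)
  show "0 \<le> \<Theta> \<omega> $ j" using pos[of j] by (simp add: \<Theta>_def inv_scale_def less_imp_le)
  have "X \<omega> $ j = (u j \<omega>) powr (1 / \<alpha> $ j)"
    using pos[of j] \<alpha>_pos[of j] by (simp add: u_def powr_powr)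
  also have "\<dots> < (\<delta> * u i \<omega>) powr (1 / \<alpha> $ j)"
    using x \<delta> \<alpha>_pos[of j] by (intro powr_less_mono2) (auto simp: u_def intro: le_less_trans)
  also have "\<dots> = \<delta> powr (1 / \<alpha> $ j) * (u i \<omega>) powr (1 / \<alpha> $ j)"
    using \<delta> u_i by (simp add: powr_mult)
  finally have "(u i \<omega>) powr (- 1 / \<alpha> $ j) * X \<omega> $ j < (u i \<omega>) powr (- 1 / \<alpha> $ j) * (\<delta> powr (1 / \<alpha> $ j)
      * (u i \<omega>) powr (1 / \<alpha> $ j))"
    using u_i by (intro mult_strict_left_mono) auto
  also have "\<dots> = \<delta> powr (1 / \<alpha> $ j)"
    using u_i by (simp add: powr_minus field_simps)
  finally show "\<Theta> \<omega> $ j < \<delta> powr (1 / \<alpha> $ j)" by (simp add: \<Theta>_def inv_scale_def N)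
qed

text \<open>The unnormalised integral over x < N is compared with f e1 and f e2 weighted by the
  single exceedances. The error \<open>D\<close> is small wherever one coordinate clearly dominates;
  the rest lies in the event that both exceed \<delta> x, of probability o(1 / x), where the three
  bounded terms contribute 3 B.\<close>

lemma conditional_expectation_tendsto:
  fixes f :: "real ^ 2 \<Rightarrow> real"
  assumes cont: "continuous_on UNIV f" and bdd: "bounded (range f)"
  shows "((\<lambda>x. \<integral>y. f y \<partial>distr (uniform_measure M {\<omega> \<in> space M. x < N \<omega>}) borel \<Theta>) \<longlongrightarrow> (a 1 * f e1 + a 2 *
      f e2) / S) at_top"
proof -
  obtain B where B: "\<And>y. \<bar>f y\<bar> \<le> B" using bdd by (auto simp: bounded_iff)
  have B0: "0 \<le> B" using B[of 0] by linarith
  have [measurable]: "f \<in> borel_measurable borel" by (rule borel_measurable_continuous_onI[OF cont])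
  define I where "I x = expectation (\<lambda>\<omega>. indicator {\<omega> \<in> space M. x < N \<omega>} \<omega> * f (\<Theta> \<omega>))" for x
  define D where "D x = I x - f e1 * prob {\<omega> \<in> space M. x < u 1 \<omega>} - f e2 * prob {\<omega> \<in> space M. x < u 2
      \<omega>}" for x
  have D_bound: "\<exists>\<delta>. 0 < \<delta> \<and> (\<forall>x>0. \<bar>D x\<bar> \<le> \<epsilon> * prob {\<omega> \<in> space M. x < N \<omega>} + 3 * B * prob {\<omega> \<in> space M.
      \<delta> * x < u 1 \<omega> \<and> \<delta> * x < u 2 \<omega>})"
    if \<epsilon>: "0 < \<epsilon>" for \<epsilon>
  proof -
    have "\<exists>d>0. \<forall>y. dist y e < d \<longrightarrow> dist (f y) (f e) < \<epsilon>" for e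
      using cont \<epsilon> unfolding continuous_on_iff by auto
    then obtain d1 d2 where d: "0 < d1" "\<And>y. dist y e1 < d1 \<Longrightarrow> dist (f y) (f e1) < \<epsilon>"
      "0 < d2" "\<And>y. dist y e2 < d2 \<Longrightarrow> dist (f y) (f e2) < \<epsilon>" by metis
    \<comment> \<open>Chosen so that \<delta> powr (1 / \<alpha> $ j) stays within the radius of
      continuity of f at the axis point whose coordinate j is 0; the cap 1 / 2 ensures \<delta> <
      1.\<close>
    define \<delta> where "\<delta> = min (1 / 2) (min (d1 powr (\<alpha> $ 2)) (d2 powr (\<alpha> $ 1)))"
    have \<delta>: "0 < \<delta>" "\<delta> < 1" using d by (auto simp: \<delta>_def)
    have "\<delta> powr (1 / \<alpha> $ 2) \<le> (d1 powr (\<alpha> $ 2)) powr (1 / \<alpha> $ 2)"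
      using \<delta> \<alpha>_pos[of 2] by (intro powr_mono2) (auto simp: \<delta>_def)
    then have \<delta>1: "\<delta> powr (1 / \<alpha> $ 2) \<le> d1" using d \<alpha>_pos[of 2] by (simp add: powr_powr)
    have "\<delta> powr (1 / \<alpha> $ 1) \<le> (d2 powr (\<alpha> $ 1)) powr (1 / \<alpha> $ 1)"
      using \<delta> \<alpha>_pos[of 1] by (intro powr_mono2) (auto simp: \<delta>_def)
    then have \<delta>2: "\<delta> powr (1 / \<alpha> $ 1) \<le> d2" using d \<alpha>_pos[of 1] by (simp add: powr_powr)
    have "\<bar>D x\<bar> \<le> \<epsilon> * prob {\<omega> \<in> space M. x < N \<omega>} + 3 * B * prob {\<omega> \<in> space M. \<delta> * x < u 1 \<omega> \<and> \<delta> * x < u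
        2 \<omega>}"
      if x: "0 < x" for x
    proof -
      let ?N = "{\<omega> \<in> space M. x < N \<omega>}" and ?u1 = "{\<omega> \<in> space M. x < u 1 \<omega>}" and ?u2 = "{\<omega> \<in> space M. x
          < u 2 \<omega>}"
      let ?E = "{\<omega> \<in> space M. \<delta> * x < u 1 \<omega> \<and> \<delta> * x < u 2 \<omega>}"
      let ?h = "\<lambda>\<omega>. indicator ?N \<omega> * f (\<Theta> \<omega>) - f e1 * indicator ?u1 \<omega> - f e2 * indicator ?u2 \<omega>"
      have int_ind: "integrable M (indicator A :: _ \<Rightarrow> real)" if "A \<in> events" for A
        using that by (intro integrable_real_indicator) (auto simp: emeasure_eq_measure)
      have int_f: "integrable M (\<lambda>\<omega>. indicator ?N \<omega> * f (\<Theta> \<omega>))"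
        by (rule integrable_const_bound[of _ B]) (use B B0 in \<open>auto simp: indicator_def\<close>)
      have int_h: "integrable M ?h" using int_f int_ind by auto
      have D_eq: "D x = expectation ?h"
        unfolding D_def I_def using int_f int_ind by simp
      have "\<bar>D x\<bar> \<le> expectation (\<lambda>\<omega>. \<bar>?h \<omega>\<bar>)"
        unfolding D_eq by (rule integral_abs_bound)
      also have "\<dots> \<le> expectation (\<lambda>\<omega>. \<epsilon> * indicator ?N \<omega> + 3 * B * indicator ?E \<omega>)"
      proof (rule integral_mono_AE)
        show "integrable M (\<lambda>\<omega>. \<bar>?h \<omega>\<bar>)" using int_h by (rule integrable_abs)
        show "integrable M (\<lambda>\<omega>. \<epsilon> * indicator ?N \<omega> + 3 * B * indicator ?E \<omega>)" using int_ind by auto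
        show "AE \<omega> in M. \<bar>?h \<omega>\<bar> \<le> \<epsilon> * indicator ?N \<omega> + 3 * B * indicator ?E \<omega>"
          using X_pos AE_space
        proof eventually_elim
          case (elim \<omega>)
          have dx: "\<delta> * x < x" using \<delta> x by simp
          \<comment> \<open>No exceedance, both coordinates above the lower level \<delta> x, or
            exactly one coordinate above x with the other at most \<delta> x.\<close>
          consider "N \<omega> \<le> x" | "\<delta> * x < u 1 \<omega>" "\<delta> * x < u 2 \<omega>" | "x < u 1 \<omega>" "u 2 \<omega> \<le> \<delta> * x" | "x < u 2
              \<omega>" "u 1 \<omega> \<le> \<delta> * x"
            using dx by (fastforce simp: N_eq)
          then show ?case
          proof cases
            case 1
            then have "\<not> x < u 1 \<omega>" "\<not> x < u 2 \<omega>" by (auto simp: N_eq)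
            then show ?thesis using 1 B0 by (simp add: indicator_def)
          next
            case 2
            have "\<bar>?h \<omega>\<bar> \<le> \<bar>f (\<Theta> \<omega>)\<bar> + \<bar>f e1\<bar> + \<bar>f e2\<bar>"
              by (auto simp: indicator_def)
            also have "\<dots> \<le> 3 * B" using B[of "\<Theta> \<omega>"] B[of e1] B[of e2] by linarith
            finally have "\<bar>?h \<omega>\<bar> \<le> 3 * B" .
            moreover have "3 * B * indicator ?E \<omega> = 3 * B" using 2 elim(2) by simp
            moreover have "0 \<le> \<epsilon> * indicator ?N \<omega>" using \<epsilon> by simp
            ultimately show ?thesis by linarith
          next
            case 3
            then have N: "N \<omega> = u 1 \<omega>" using dx by (simp add: N_eq)
            have \<Theta>: "\<Theta> \<omega> $ 1 = 1" "0 \<le> \<Theta> \<omega> $ 2" "\<Theta> \<omega> $ 2 < \<delta> powr (1 / \<alpha> $ 2)"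
              by (rule \<Theta>_near_axis[OF _ x 3 \<delta> N], use elim(1) in simp)+
            have "dist (\<Theta> \<omega>) e1 < d1"
              using \<Theta> \<delta>1 by (simp add: dist_vec_def L2_set_def UNIV_2 dist_real_def)
            then have "dist (f (\<Theta> \<omega>)) (f e1) < \<epsilon>" by (rule d)
            then have "\<bar>f (\<Theta> \<omega>) - f e1\<bar> \<le> \<epsilon>" by (simp add: dist_real_def)
            moreover have "\<not> x < u 2 \<omega>" "\<not> \<delta> * x < u 2 \<omega>" "x < N \<omega>" using 3 dx N by auto
            ultimately show ?thesis using 3 elim(2) by (simp add: indicator_def)
          next
            case 4
            then have N: "N \<omega> = u 2 \<omega>" using dx by (simp add: N_eq)
            have \<Theta>: "\<Theta> \<omega> $ 2 = 1" "0 \<le> \<Theta> \<omega> $ 1" "\<Theta> \<omega> $ 1 < \<delta> powr (1 / \<alpha> $ 1)"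
              by (rule \<Theta>_near_axis[OF _ x 4 \<delta> N], use elim(1) in simp)+
            have "dist (\<Theta> \<omega>) e2 < d2"
              using \<Theta> \<delta>2 by (simp add: dist_vec_def L2_set_def UNIV_2 dist_real_def)
            then have "dist (f (\<Theta> \<omega>)) (f e2) < \<epsilon>" by (rule d)
            then have "\<bar>f (\<Theta> \<omega>) - f e2\<bar> \<le> \<epsilon>" by (simp add: dist_real_def)
            moreover have "\<not> x < u 1 \<omega>" "\<not> \<delta> * x < u 1 \<omega>" "x < N \<omega>" using 4 dx N by auto
            ultimately show ?thesis using 4 elim(2) by (simp add: indicator_def)
          qed
        qed
      qed
      also have "\<dots> = \<epsilon> * prob ?N + 3 * B * prob ?E" using int_ind by simp
      finally show ?thesis .
    qed
    then show ?thesis using \<delta>(1) by blast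
  qed
  have D_lim: "((\<lambda>x. x * D x) \<longlongrightarrow> 0) at_top"
  proof (rule tendstoI)
    fix \<eta> :: real assume \<eta>: "0 < \<eta>"
    \<comment> \<open>As x * P (N > x) tends to S, the limit of the bound is \<eta> / 2.\<close>
    define \<epsilon> where "\<epsilon> = \<eta> / (2 * S)"
    have \<epsilon>: "0 < \<epsilon>" using \<eta> S_pos by (simp add: \<epsilon>_def)
    obtain \<delta> where \<delta>: "0 < \<delta>" "\<And>x. 0 < x \<Longrightarrow> \<bar>D x\<bar> \<le> \<epsilon> * prob {\<omega> \<in> space M. x < N \<omega>} + 3 * B * prob {\<omega> \<in>
        space M. \<delta> * x < u 1 \<omega> \<and> \<delta> * x < u 2 \<omega>}"
      using D_bound[OF \<epsilon>] by blast
    have "filterlim (\<lambda>x. \<delta> * x) at_top at_top"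
      by (rule filterlim_tendsto_pos_mult_at_top[OF tendsto_const \<delta>(1) filterlim_ident])
    from filterlim_compose[OF joint_u this]
    have "((\<lambda>x. \<epsilon> * (x * prob {\<omega> \<in> space M. x < N \<omega>}) + 3 * B / \<delta> * (\<delta> * x * prob {\<omega> \<in> space M. \<delta> * x <
        u 1 \<omega> \<and> \<delta> * x < u 2 \<omega>})) \<longlongrightarrow> \<epsilon> * S + 3 * B / \<delta> * 0) at_top"
      by (intro tendsto_intros N_tail)
    then have "\<forall>\<^sub>F x in at_top. \<epsilon> * (x * prob {\<omega> \<in> space M. x < N \<omega>}) + 3 * B / \<delta> * (\<delta> * x * prob {\<omega> \<in>
        space M. \<delta> * x < u 1 \<omega> \<and> \<delta> * x < u 2 \<omega>}) < \<eta>"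
      by (rule order_tendstoD(2)) (use \<eta> S_pos in \<open>simp add: \<epsilon>_def\<close>)
    then show "\<forall>\<^sub>F x in at_top. dist (x * D x) 0 < \<eta>"
      using eventually_gt_at_top[of 0]
    proof eventually_elim
      case (elim x)
      have "\<bar>x * D x\<bar> = x * \<bar>D x\<bar>" using elim by (simp add: abs_mult)
      also have "\<dots> \<le> x * (\<epsilon> * prob {\<omega> \<in> space M. x < N \<omega>} + 3 * B * prob {\<omega> \<in> space M. \<delta> * x < u 1 \<omega> \<and> \<delta>
          * x < u 2 \<omega>})"
        using elim by (intro mult_left_mono \<delta>) auto
      also have "\<dots> = \<epsilon> * (x * prob {\<omega> \<in> space M. x < N \<omega>}) + 3 * B / \<delta> * (\<delta> * x * prob {\<omega> \<in> space M. \<delta> *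
          x < u 1 \<omega> \<and> \<delta> * x < u 2 \<omega>})"
        using \<delta>(1) by (simp add: field_simps)
      finally show ?case using elim by simp
    qed
  qed
  have "((\<lambda>x. (x * D x + f e1 * (x * prob {\<omega> \<in> space M. x < u 1 \<omega>}) + f e2 * (x * prob {\<omega> \<in> space M. x <
      u 2 \<omega>})) / (x * prob {\<omega> \<in> space M. x < N \<omega>})) \<longlongrightarrow>
     (0 + f e1 * a 1 + f e2 * a 2) / S) at_top"
    by (intro tendsto_intros D_lim u_tail N_tail) (use S_pos in simp)
  then have "((\<lambda>x. (x * D x + f e1 * (x * prob {\<omega> \<in> space M. x < u 1 \<omega>}) + f e2 * (x * prob {\<omega> \<in> space
      M. x < u 2 \<omega>})) / (x * prob {\<omega> \<in> space M. x < N \<omega>})) \<longlongrightarrow>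
     (a 1 * f e1 + a 2 * f e2) / S) at_top" by (simp add: mult.commute)
  then show ?thesis
  proof (rule Lim_transform_eventually)
    have "\<forall>\<^sub>F x in at_top. 0 < x * prob {\<omega> \<in> space M. x < N \<omega>}"
      by (rule order_tendstoD(1)[OF N_tail S_pos])
    then show "\<forall>\<^sub>F x in at_top. (x * D x + f e1 * (x * prob {\<omega> \<in> space M. x < u 1 \<omega>}) + f e2 * (x * prob
        {\<omega> \<in> space M. x < u 2 \<omega>})) / (x * prob {\<omega> \<in> space M. x < N \<omega>}) =
       (\<integral>y. f y \<partial>distr (uniform_measure M {\<omega> \<in> space M. x < N \<omega>}) borel \<Theta>)"
      using eventually_gt_at_top[of 0]
    proof eventually_elim
      case (elim x)
      let ?A = "{\<omega> \<in> space M. x < N \<omega>}"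
      have p: "0 < prob ?A" using elim by (simp add: zero_less_mult_iff)
      \<comment> \<open>The conditional law is rewritten with a real density, the form that
        \<open>integral_density\<close> takes; the event has positive probability for large
        x.\<close>
      have "uniform_measure M ?A = density M (\<lambda>\<omega>. ennreal (indicator ?A \<omega> / prob ?A))"
        unfolding uniform_measure_def
        by (intro arg_cong[where f = "density M"] ext) (use p in \<open>auto simp: indicator_def
            emeasure_eq_measure divide_ennreal simp flip: ennreal_1\<close>)
      moreover have "(\<integral>y. f y \<partial>distr (uniform_measure M ?A) borel \<Theta>) = (\<integral>\<omega>. f (\<Theta> \<omega>) \<partial>uniform_measure M ?A)"
        by (rule integral_distr) auto
      ultimately have "(\<integral>y. f y \<partial>distr (uniform_measure M ?A) borel \<Theta>) = (\<integral>\<omega>. f (\<Theta> \<omega>) \<partial>density M (\<lambda>\<omega>.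
          ennreal (indicator ?A \<omega> / prob ?A)))"
        by simp
      also have "\<dots> = expectation (\<lambda>\<omega>. (indicator ?A \<omega> / prob ?A) *\<^sub>R f (\<Theta> \<omega>))"
        by (rule integral_density) (use p in auto)
      also have "\<dots> = I x / prob ?A" by (simp add: I_def)
      also have "\<dots> = (x * I x) / (x * prob ?A)" using elim by simp
      also have "x * I x = x * D x + f e1 * (x * prob {\<omega> \<in> space M. x < u 1 \<omega>}) + f e2 * (x * prob {\<omega> \<in>
          space M. x < u 2 \<omega>})"
        by (simp add: D_def algebra_simps)
      finally show ?case by simp
    qed
  qed
qed

text \<open>The two-point law that charges each axis in proportion to its tail constant.\<close>

definition \<mu>0 :: "(real ^ 2) measure" where
  "\<mu>0 = distr (measure_pmf (bernoulli_pmf (a 1 / S))) borel (\<lambda>b. if b then e1 else e2)"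

lemma integral_\<mu>0:
  fixes f :: "real ^ 2 \<Rightarrow> real"
  assumes "f \<in> borel_measurable borel"
  shows "(\<integral>y. f y \<partial>\<mu>0) = (a 1 * f e1 + a 2 * f e2) / S"
proof -
  have p: "0 \<le> a 1 / S" "a 1 / S \<le> 1" using a_pos[of 1] a_pos[of 2] by (auto simp: S_def field_simps)
  have "(\<integral>y. f y \<partial>\<mu>0) = (\<integral>b. f (if b then e1 else e2) \<partial>bernoulli_pmf (a 1 / S))"
    unfolding \<mu>0_def by (subst integral_distr) (use assms in auto)
  also have "\<dots> = f e1 * (a 1 / S) + f e2 * (1 - a 1 / S)"
    by (subst integral_bernoulli_pmf) (use p in auto)
  also have "1 - a 1 / S = a 2 / S" using S_pos by (simp add: S_def field_simps)
  finally show ?thesis by (simp add: add_divide_distrib mult.commute)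
qed

lemma spectral_law_\<mu>0: "spectral_law M X \<alpha> \<mu>0"
  unfolding spectral_law_def weakly_converges_def
proof (intro conjI allI impI)
  show "prob_space \<mu>0" unfolding \<mu>0_def by (rule measure_pmf.prob_space_distr) simp
  fix f :: "real ^ 2 \<Rightarrow> real" assume f: "continuous_on UNIV f" "bounded (range f)"
  have [measurable]: "f \<in> borel_measurable borel" by (rule borel_measurable_continuous_onI[OF f(1)])
  show "((\<lambda>x. \<integral>y. f y \<partial>distr (uniform_measure M {\<omega> \<in> space M. vnorm \<alpha> (X \<omega>) > x}) borel (\<lambda>\<omega>. inv_scale \<alpha>
      (vnorm \<alpha> (X \<omega>)) (X \<omega>))) \<longlongrightarrow> (\<integral>y. f y \<partial>\<mu>0)) at_top"
    using conditional_expectation_tendsto[OF f] unfolding integral_\<mu>0[OF \<open>f \<in> borel_measurable borel\<close>]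
        N_def \<Theta>_def[abs_def] .
qed (simp add: \<mu>0_def)

text \<open>A weak limit gives the same integrals as \<mu>0 to bounded continuous functions. One
  nonnegative test function that vanishes exactly at the two axis points has integral 0 under
  \<mu>0, hence vanishes almost everywhere under any limit.\<close>

lemma spectral_law_on_axes:
  assumes "spectral_law M X \<alpha> \<mu>"
  shows "AE \<theta> in \<mu>. \<theta> \<in> {vector [1, 0], vector [0, 1]}"
proof -
  interpret \<mu>: prob_space \<mu> using assms by (simp add: spectral_law_def)
  have sets_\<mu> [measurable_cong]: "sets \<mu> = sets borel" using assms by (simp add: spectral_law_def)
  define g :: "real ^ 2 \<Rightarrow> real" where "g \<theta> = min 1 (dist \<theta> e1 * dist \<theta> e2)" for \<theta>
  have g: "continuous_on UNIV g" "bounded (range g)"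
    unfolding g_def by (intro continuous_intros) (auto simp: bounded_iff intro!: exI[of _ 1])
  have [measurable]: "g \<in> borel_measurable borel" by (rule borel_measurable_continuous_onI[OF g(1)])
  have "(\<integral>y. g y \<partial>\<mu>) = (\<integral>y. g y \<partial>\<mu>0)"
    using assms spectral_law_\<mu>0 g unfolding spectral_law_def weakly_converges_def
    by (intro tendsto_unique[OF trivial_limit_at_top_linorder]) blast+
  also have "\<dots> = 0" by (subst integral_\<mu>0) (simp_all add: g_def)
  finally have "(\<integral>y. g y \<partial>\<mu>) = 0" .
  moreover have "integrable \<mu> g"
    by (rule \<mu>.integrable_const_bound[of _ 1]) (auto simp: g_def)
  ultimately have "AE y in \<mu>. g y = 0"
    by (subst (asm) integral_nonneg_eq_0_iff_AE) (auto simp: g_def)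
  then show ?thesis
    by eventually_elim (auto simp: g_def e1_def e2_def min_def split: if_splits)
qed

lemma marginal_asymp_equiv:
  "(\<lambda>x. prob {\<omega> \<in> space M. \<bar>X \<omega> $ i\<bar> > x}) \<sim>[at_top] (\<lambda>x. a i * x powr (- \<alpha> $ i))"
proof (rule asymp_equivI')
  have "((\<lambda>x. x powr (\<alpha> $ i) * prob {\<omega> \<in> space M. x < X \<omega> $ i} / a i) \<longlongrightarrow> a i / a i) at_top"
    by (intro tendsto_divide tail tendsto_const) (use a_pos[of i] in simp)
  then have lim: "((\<lambda>x. x powr (\<alpha> $ i) * prob {\<omega> \<in> space M. x < X \<omega> $ i} / a i) \<longlongrightarrow> 1) at_top"
    using a_pos[of i] by simp
  have eq: "prob {\<omega> \<in> space M. x < \<bar>X \<omega> $ i\<bar>} = prob {\<omega> \<in> space M. x < X \<omega> $ i}" for x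
  proof (rule finite_measure_eq_AE)
    show "AE \<omega> in M. \<omega> \<in> {\<omega> \<in> space M. x < \<bar>X \<omega> $ i\<bar>} \<longleftrightarrow> \<omega> \<in> {\<omega> \<in> space M. x < X \<omega> $ i}"
      using X_pos
    proof eventually_elim
      case (elim \<omega>)
      then have "0 < X \<omega> $ i" by simp
      then show ?case by simp
    qed
  qed auto
  show "((\<lambda>x. prob {\<omega> \<in> space M. \<bar>X \<omega> $ i\<bar> > x} / (a i * x powr (- \<alpha> $ i))) \<longlongrightarrow> 1) at_top"
    using lim by (rule Lim_transform_eventually)
      (use eventually_gt_at_top[of 0] in \<open>auto elim!: eventually_mono simp: eq powr_minus field_simps\<close>)
qed

theorem VSRV: "VSRV M X \<alpha>"
  unfolding VSRV_def
proof (intro conjI allI)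
  show "0 < \<alpha> $ i" for i by (rule \<alpha>_pos)
  show "\<exists>c>0. (\<lambda>x. prob {\<omega> \<in> space M. \<bar>X \<omega> $ i\<bar> > x}) \<sim>[at_top] (\<lambda>x. c * x powr (- \<alpha> $ i))" for i
    using a_pos marginal_asymp_equiv by blast
  show "regularly_varying M (\<lambda>\<omega>. vnorm \<alpha> (X \<omega>))"
    using N_regularly_varying by (simp add: N_def[abs_def])
  show "\<exists>\<mu>. spectral_law M X \<alpha> \<mu>" using spectral_law_\<mu>0 by blast
qed

end

section \<open>The theorem\<close>

text \<open>A positive denominator makes the quotient of the c a real number above 1. For the b, the
  conventions matter only when b1 = 0, and then nonnegativity of b2 gives the order
  directly.\<close>

lemma ratio_order:
  fixes b1 b2 c1 c2 :: real
  assumes "0 \<le> b1" "0 \<le> b2" "0 < c1" and "ratio c2 c1 > ratio b2 b1" "ratio b2 b1 \<ge> 1"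
  shows "b1 \<le> b2" "c1 < c2"
proof -
  have c: "ratio c2 c1 = ereal (c2 / c1)" using assms(3) by (simp add: ratio_def)
  have "1 < ratio c2 c1" using assms(4,5) by simp
  then have "1 < c2 / c1" unfolding c by simp
  then show "c1 < c2" using assms(3) by (simp add: field_simps)
  show "b1 \<le> b2"
  proof (cases "b1 = 0")
    case False
    then have "1 \<le> b2 / b1" using assms(1,5) by (simp add: ratio_def)
    then show ?thesis using assms(1) False by (simp add: field_simps)
  qed (use assms in simp)
qed

text \<open>Equal powers would give \<alpha>1 ln F = \<alpha>2 ln G > \<alpha>2 ln F, so ln F would
  have one strict sign almost surely, that of \<alpha>1 - \<alpha>2. Then the power of F would lie
  strictly on one side of 1 and could not have mean 1; \<alpha>1 = \<alpha>2 is contradictory at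
  once.\<close>

lemma (in prob_space) AE_greater_not_same_unit_power_mean:
  fixes F G :: "'a \<Rightarrow> real"
  assumes \<alpha>1: "0 < \<alpha>1" "has_bochner_integral M (\<lambda>\<omega>. F \<omega> powr \<alpha>1) 1"
    and less: "AE \<omega> in M. 0 < F \<omega> \<and> F \<omega> < G \<omega>" and \<alpha>2: "0 < \<alpha>2"
  shows "\<not> (AE \<omega> in M. F \<omega> powr \<alpha>1 = G \<omega> powr \<alpha>2)"
proof
  assume "AE \<omega> in M. F \<omega> powr \<alpha>1 = G \<omega> powr \<alpha>2"
  with less have sign: "AE \<omega> in M. 0 < (\<alpha>1 - \<alpha>2) * ln (F \<omega>) \<and> F \<omega> powr \<alpha>1 = exp (\<alpha>1 * ln (F \<omega>))"
  proof eventually_elim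
    case (elim \<omega>)
    then have pos: "0 < F \<omega>" "0 < G \<omega>" "ln (F \<omega>) < ln (G \<omega>)" by auto
    have "\<alpha>1 * ln (F \<omega>) = \<alpha>2 * ln (G \<omega>)" using elim pos by (simp add: powr_def)
    moreover have "\<alpha>2 * ln (F \<omega>) < \<alpha>2 * ln (G \<omega>)" using pos \<alpha>2 by simp
    ultimately show ?case using pos by (simp add: algebra_simps powr_def)
  qed
  have int: "integrable M (\<lambda>\<omega>. F \<omega> powr \<alpha>1 - 1)" and E: "expectation (\<lambda>\<omega>. F \<omega> powr \<alpha>1 - 1) = 0"
    using \<alpha>1(2) by (auto simp: has_bochner_integral_iff prob_space)
  consider "\<alpha>1 = \<alpha>2" | "\<alpha>2 < \<alpha>1" | "\<alpha>1 < \<alpha>2" by linarith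
  then have "AE \<omega> in M. False"
  proof cases
    case 1
    then show ?thesis using sign by simp
  next
    case 2
    have pos: "AE \<omega> in M. 0 < F \<omega> powr \<alpha>1 - 1"
      using sign by eventually_elim (use 2 \<alpha>1(1) in \<open>auto simp: zero_less_mult_iff\<close>)
    then have "AE \<omega> in M. F \<omega> powr \<alpha>1 - 1 = 0"
      using E by (subst (asm) integral_nonneg_eq_0_iff_AE[OF int]) (auto elim!: eventually_mono)
    with pos show ?thesis by eventually_elim simp
  next
    case 3
    have neg: "AE \<omega> in M. 0 < - (F \<omega> powr \<alpha>1 - 1)"
      using sign by eventually_elim (use 3 \<alpha>1(1) in \<open>auto simp: zero_less_mult_iff mult_less_0_iff\<close>)
    have int': "integrable M (\<lambda>\<omega>. - (F \<omega> powr \<alpha>1 - 1))" using int by (rule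
        Bochner_Integration.integrable_minus)
    have "expectation (\<lambda>\<omega>. - (F \<omega> powr \<alpha>1 - 1)) = 0" using E by (simp only:
        Bochner_Integration.integral_minus)
    then have "AE \<omega> in M. - (F \<omega> powr \<alpha>1 - 1) = 0"
      using neg by (subst (asm) integral_nonneg_eq_0_iff_AE[OF int']) (auto elim!: eventually_mono)
    with neg show ?thesis by eventually_elim simp
  qed
  then show False by simp
qed

theorem theorem1p1:
  fixes P :: "'w measure"
    and b c \<alpha> :: "real ^ 2"
    and M :: "int \<Rightarrow> 'w \<Rightarrow> real"
    and Q X :: "int \<Rightarrow> 'w \<Rightarrow> real ^ 2"
  assumes "prob_space P"
    and "\<forall>i. b $ i \<ge> 0 \<and> c $ i \<ge> 0"
    and "noise P M Q"
    and "stationary_solution P b c M Q X"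
    and "A1 P b c (M 0)"
    and "A2 P b c (M 0) \<alpha>"
    and "A3 P (M 0) (Q 0) \<alpha>"
    and "A4 P b c (M 0)"
    and "A5 P b c (M 0) (Q 0)"
    and "A6 P (Q 0) \<alpha>"
    and "AE \<omega> in P. M 0 \<omega> > 0 \<and> Q 0 \<omega> $ 1 > 0 \<and> Q 0 \<omega> $ 2 > 0"
    and "c $ 1 > 0"
    and "ratio (c $ 2) (c $ 1) > ratio (b $ 2) (b $ 1)"
    and "ratio (b $ 2) (b $ 1) \<ge> 1"
  shows "VSRV P (X 0) \<alpha> \<and>
         (\<forall>\<mu>. spectral_law P (X 0) \<alpha> \<mu> \<longrightarrow>
            (AE \<theta> in \<mu>. \<theta> \<in> {vector [1, 0], vector [0, 1]}))"
proof -
  interpret prob_space P by fact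
  have order: "b $ 1 \<le> b $ 2" "c $ 1 < c $ 2"
    using ratio_order[of "b $ 1" "b $ 2" "c $ 1" "c $ 2"] assms(2,12,13,14) by auto
  interpret S: diagonal_SRE P b c M Q X
  proof
    show "noise P M Q" "stationary_solution P b c M Q X" by fact+
    show "0 \<le> b $ i" for i using assms(2) by simp
    show "0 < c $ i" for i using assms(12) order(2) exhaust_2[of i] by auto
    show "AE \<omega> in P. M 0 \<omega> > 0 \<and> (\<forall>i. Q 0 \<omega> $ i > 0)"
      using assms(11) by (simp add: forall_2)
  qed
  have \<alpha>_pos: "0 < \<alpha> $ i" for i using assms(6) by (simp add: A2_def)
  have A_abs: "AE \<omega> in P. \<bar>b $ i + c $ i * M 0 \<omega>\<bar> = S.A i 0 \<omega>" for i
    using S.AE_pos[of i] by eventually_elim (simp add: S.A_def[symmetric] less_imp_le)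
  have A_\<alpha>: "has_bochner_integral P (\<lambda>\<omega>. S.A i 0 \<omega> powr (\<alpha> $ i)) 1" for i
  proof -
    have "has_bochner_integral P (\<lambda>\<omega>. \<bar>b $ i + c $ i * M 0 \<omega>\<bar> powr (\<alpha> $ i)) 1"
      using assms(6) by (simp add: A2_def)
    then show ?thesis
      by (subst (asm) has_bochner_integral_cong_AE[where g = "\<lambda>\<omega>. S.A i 0 \<omega> powr (\<alpha> $ i)"])
         (use A_abs[of i] in \<open>auto elim!: eventually_mono\<close>)
  qed
  have nonlattice: "\<not> (AE \<omega> in P. ln (S.A i 0 \<omega>) \<in> range (\<lambda>k::int. h * of_int k))" if h: "0 < h" for i h
  proof
    assume *: "AE \<omega> in P. ln (S.A i 0 \<omega>) \<in> range (\<lambda>k::int. h * of_int k)"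
    have "AE \<omega> in P. ln \<bar>b $ i + c $ i * M 0 \<omega>\<bar> \<in> range (\<lambda>k::int. h * of_int k)"
      using * A_abs[of i] by eventually_elim simp
    moreover have "{x. x \<in> range (\<lambda>k::int. h * of_int k)} \<in> sets borel"
      unfolding Collect_mem_eq by (rule sets.countable) auto
    ultimately have "AE x in distr P borel (\<lambda>\<omega>. ln \<bar>b $ i + c $ i * M 0 \<omega>\<bar>). x \<in> range (\<lambda>k::int. h *
        of_int k)"
      by (subst AE_distr_iff) auto
    then have "arithmetic (distr P borel (\<lambda>\<omega>. ln \<bar>b $ i + c $ i * M 0 \<omega>\<bar>))"
      using h unfolding arithmetic_def by blast
    then show False using assms(8) by (simp add: A4_def)
  qed
  have nondeg: "\<not> (AE \<omega> in P. ln (S.A i 0 \<omega>) = 0)" for i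
  proof
    assume "AE \<omega> in P. ln (S.A i 0 \<omega>) = 0"
    then have "AE \<omega> in P. ln (S.A i 0 \<omega>) \<in> range (\<lambda>k::int. 1 * of_int k)"
      by eventually_elim (auto intro!: image_eqI[of _ _ 0])
    with nonlattice[of 1 i] show False by simp
  qed
  note contraction = S.A_moment_less_1_small[OF A_\<alpha> nondeg \<alpha>_pos]
  have "\<exists>\<epsilon>>0. integrable P (\<lambda>\<omega>. \<bar>M 0 \<omega>\<bar> powr (\<alpha> $ i + \<epsilon>)) \<and> integrable P (\<lambda>\<omega>. \<bar>Q 0 \<omega> $ i\<bar> powr (\<alpha> $ i +
      \<epsilon>))" for i
  proof -
    obtain \<epsilon> where \<epsilon>: "0 < \<epsilon>" "integrable P (\<lambda>\<omega>. \<bar>M 0 \<omega>\<bar> powr (\<alpha> $ i + \<epsilon>))" "integrable P (\<lambda>\<omega>. infnorm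
        (Q 0 \<omega>) powr (\<alpha> $ i + \<epsilon>))"
      using assms(7) unfolding A3_def by blast
    have "integrable P (\<lambda>\<omega>. \<bar>Q 0 \<omega> $ i\<bar> powr (\<alpha> $ i + \<epsilon>))"
    proof (rule Bochner_Integration.integrable_bound[OF \<epsilon>(3)])
      show "AE \<omega> in P. norm (\<bar>Q 0 \<omega> $ i\<bar> powr (\<alpha> $ i + \<epsilon>)) \<le> norm (infnorm (Q 0 \<omega>) powr (\<alpha> $ i + \<epsilon>))"
        using \<epsilon>(1) \<alpha>_pos[of i] by (intro AE_I2) (auto intro!: powr_mono2 component_le_infnorm_cart)
    qed simp
    then show ?thesis using \<epsilon> by blast
  qed
  then obtain \<epsilon> where \<epsilon>: "\<And>i. 0 < \<epsilon> i" "\<And>i. integrable P (\<lambda>\<omega>. \<bar>M 0 \<omega>\<bar> powr (\<alpha> $ i + \<epsilon> i))"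
      "\<And>i. integrable P (\<lambda>\<omega>. \<bar>Q 0 \<omega> $ i\<bar> powr (\<alpha> $ i + \<epsilon> i))" by metis
  have "\<forall>i. \<exists>a. 0 < a \<and> ((\<lambda>x. x powr (\<alpha> $ i) * prob {\<omega> \<in> space P. x < X 0 \<omega> $ i}) \<longlongrightarrow> a) at_top"
    by (intro allI S.marginal_tail[OF \<alpha>_pos A_\<alpha> nonlattice \<epsilon> contraction])
  then obtain a where "\<forall>i. 0 < a i \<and> ((\<lambda>x. x powr (\<alpha> $ i) * prob {\<omega> \<in> space P. x < X 0 \<omega> $ i}) \<longlongrightarrow> a i)
      at_top"
    by (rule choice[THEN exE])
  then have a: "\<And>i. 0 < a i" "\<And>i. ((\<lambda>x. x powr (\<alpha> $ i) * prob {\<omega> \<in> space P. x < X 0 \<omega> $ i}) \<longlongrightarrow> a i) at_top"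
    by blast+
  have Q_\<alpha>: "integrable P (\<lambda>\<omega>. \<bar>Q 0 \<omega> $ i\<bar> powr (\<alpha> $ i))" for i
    by (rule integrable_powr_smaller[OF _ \<epsilon>(3)]) (use \<alpha>_pos[of i] \<epsilon>(1)[of i] in auto)
  have "AE \<omega> in P. 0 < S.A 1 0 \<omega> \<and> S.A 1 0 \<omega> < S.A 2 0 \<omega>"
    using S.AE_pos[of 1] assms(11)
  proof eventually_elim
    case (elim \<omega>)
    \<comment> \<open>Strictness of the order of the multipliers comes from the c together with M >
      0; the b are ordered only weakly.\<close>
    have "c $ 1 * M 0 \<omega> < c $ 2 * M 0 \<omega>" using elim(2) order(2) by simp
    moreover have "0 < S.A 1 0 \<omega>" using elim(1) by blast
    ultimately show ?case using order(1) unfolding S.A_def by linarith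
  qed
  then have "\<not> (AE \<omega> in P. S.A 1 0 \<omega> powr (\<alpha> $ 1) = S.A 2 0 \<omega> powr (\<alpha> $ 2))"
    by (rule AE_greater_not_same_unit_power_mean[OF \<alpha>_pos A_\<alpha> _ \<alpha>_pos])
  note joint = S.joint_tail[OF \<alpha>_pos A_\<alpha> nondeg Q_\<alpha> \<alpha>_pos A_\<alpha> nondeg Q_\<alpha> this contraction]
  interpret V: asymptotically_independent_pair P "X 0" \<alpha> a
    by unfold_locales (rule S.borel_measurable_X \<alpha>_pos a joint S.AE_X_pos[OF contraction])+
  show ?thesis by (intro conjI allI impI V.VSRV V.spectral_law_on_axes)
qed

end
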